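(* Let $n,m\ge1$, $\mu>0$, $\nu>-1$, $D_{n,m}(\mu)=\{(z,w)\in\mathbb{C}^n\times\mathbb{C}^m:\|w\|^2<e^{-\mu\|z\|^2}\}$ endowed with the Kähler metric $g(\mu;\nu)$ with Kähler form $\frac{\sqrt{-1}}{2\pi}\partial\bar\partial\Phi$, $\Phi(z,w)=\nu\mu\|z\|^2-\ln\left(e^{-\mu\|z\|^2}-\|w\|^2\right)$. Let $\alpha>m+n$. Then the Rawnsley $\varepsilon$-function of $(D_{n,m}(\mu),g(\mu;\nu))$ is $$\varepsilon_{(\alpha,g(\mu;\nu))}(z,w)=(\alpha-m-n)_{m+n}(1-\|\tilde w\|^2)^\alpha\sum_{q\in\mathbb{N}^m}\psi(\alpha,|q|)\frac{\Gamma(|q|+\alpha)}{\Gamma(\alpha)\prod_{i=1}^m\Gamma(q_i+1)}\tilde w^q\overline{\tilde w^q},$$ where $\tilde w=e^{\frac{\mu}{2}\|z\|^2}w$, $(\alpha)_k=\frac{\Gamma(\alpha+k)}{\Gamma(\alpha)}$, $\psi(\alpha,|q|)=\frac{\Gamma(\alpha-m-n)\chi(\alpha,|q|)}{\Gamma(\alpha+|q|)}$ and $$\chi(\alpha,|q|)=\frac{[(\nu+1)\alpha+|q|]^n}{\sum_{d=0}^n\binom{n}{d}\nu^{n-d}\frac{\Gamma(\alpha-m-d)}{\Gamma(\alpha-d+|q|)}}.$$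
   Context: Let $\mathcal{H}_\alpha$ be the Hilbert space of holomorphic $f$ on $D_{n,m}(\mu)$ with $\int|f|^2e^{-\alpha\Phi}\frac{\omega^{n+m}}{(n+m)!}<\infty$, where $\omega=\frac{\sqrt{-1}}{2\pi}\partial\bar\partial\Phi$, and $K_\alpha(Z,\bar Z)$ its reproducing kernel on the diagonal. The Rawnsley $\varepsilon$-function is $\varepsilon_{(\alpha,g(\mu;\nu))}(Z)=e^{-\alpha\Phi(Z)}K_\alpha(Z,\bar Z)$. $\mathbb{N}$ includes $0$; $|q|=\sum q_i$; $\tilde w^q=\prod_j \tilde w_j^{q_j}$; $\nu^0=1$. *)

theory Defs
  imports "HOL-Analysis.Analysis"
begin

definition zpart :: "complex^('n::finite + 'm::finite) \<Rightarrow> complex^'n" where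
  "zpart Z = (\<chi> j. Z $ Inl j)"

definition wpart :: "complex^('n::finite + 'm::finite) \<Rightarrow> complex^'m" where
  "wpart Z = (\<chi> k. Z $ Inr k)"

definition sqn :: "complex^'a::finite \<Rightarrow> real" where
  "sqn v = (\<Sum>j\<in>UNIV. (cmod (v $ j))^2)"

definition Dom :: "real \<Rightarrow> (complex^('n::finite + 'm::finite)) set" where
  "Dom \<mu> = {Z. sqn (wpart Z) < exp (- \<mu> * sqn (zpart Z))}"

definition Phi :: "real \<Rightarrow> real \<Rightarrow> complex^('n::finite + 'm::finite) \<Rightarrow> real" where
  "Phi \<mu> \<nu> Z = \<nu> * \<mu> * sqn (zpart Z) - ln (exp (- \<mu> * sqn (zpart Z)) - sqn (wpart Z))"

definition dirder :: "complex^'k::finite \<Rightarrow> (complex^'k \<Rightarrow> complex) \<Rightarrow> complex^'k \<Rightarrow> complex" where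
  "dirder v G p = vector_derivative (\<lambda>t::real. G (p + t *\<^sub>R v)) (at 0)"

definition wirt_d :: "'k::finite \<Rightarrow> (complex^'k \<Rightarrow> complex) \<Rightarrow> complex^'k \<Rightarrow> complex" where
  "wirt_d j G p = (dirder (axis j 1) G p - \<i> * dirder (axis j \<i>) G p) / 2"

definition wirt_dbar :: "'k::finite \<Rightarrow> (complex^'k \<Rightarrow> complex) \<Rightarrow> complex^'k \<Rightarrow> complex" where
  "wirt_dbar j G p = (dirder (axis j 1) G p + \<i> * dirder (axis j \<i>) G p) / 2"

definition cHess :: "(complex^'k::finite \<Rightarrow> real) \<Rightarrow> complex^'k \<Rightarrow> complex^'k^'k" where
  "cHess F p = (\<chi> j k. wirt_d j (wirt_dbar k (\<lambda>q. complex_of_real (F q))) p)"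

text \<open>Density of omega^N/N! w.r.t. Lebesgue measure, omega = (i/2pi) ddbar F:
  det(g)/pi^N.\<close>
definition volden :: "(complex^'k::finite \<Rightarrow> real) \<Rightarrow> complex^'k \<Rightarrow> real" where
  "volden F p = Re (det (cHess F p)) / pi ^ CARD('k)"

definition holo_on :: "(complex^'k::finite) set \<Rightarrow> (complex^'k \<Rightarrow> complex) \<Rightarrow> bool" where
  "holo_on D f \<longleftrightarrow> (\<forall>Z\<in>D. \<exists>L. (f has_derivative L) (at Z) \<and> (\<forall>c v. L (c *s v) = c * L v))"

definition wt :: "real \<Rightarrow> (complex^'k::finite \<Rightarrow> real) \<Rightarrow> complex^'k \<Rightarrow> real" where
  "wt \<alpha> F Z = exp (- \<alpha> * F Z) * volden F Z"

definition Hsp :: "(complex^'k::finite) set \<Rightarrow> real \<Rightarrow> (complex^'k \<Rightarrow> real) \<Rightarrow> (complex^'k \<Rightarrow> complex) set" where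
  "Hsp D \<alpha> F = {f. holo_on D f \<and>
      (\<integral>\<^sup>+ Z. indicator D Z * ennreal (wt \<alpha> F Z * (cmod (f Z))^2) \<partial>lebesgue) < \<infinity>}"

definition Hinner :: "(complex^'k::finite) set \<Rightarrow> real \<Rightarrow> (complex^'k \<Rightarrow> real) \<Rightarrow>
    (complex^'k \<Rightarrow> complex) \<Rightarrow> (complex^'k \<Rightarrow> complex) \<Rightarrow> complex" where
  "Hinner D \<alpha> F f g = (LINT Z:D|lebesgue. wt \<alpha> F Z *\<^sub>R (f Z * cnj (g Z)))"

definition Kdiag :: "(complex^'k::finite) set \<Rightarrow> real \<Rightarrow> (complex^'k \<Rightarrow> real) \<Rightarrow> complex^'k \<Rightarrow> complex" where
  "Kdiag D \<alpha> F Z = (THE c. \<exists>k\<in>Hsp D \<alpha> F.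
      (\<forall>f\<in>Hsp D \<alpha> F. f Z = Hinner D \<alpha> F f k) \<and> c = k Z)"

definition rawnsley :: "(complex^'k::finite) set \<Rightarrow> real \<Rightarrow> (complex^'k \<Rightarrow> real) \<Rightarrow> complex^'k \<Rightarrow> complex" where
  "rawnsley D \<alpha> F Z = complex_of_real (exp (- \<alpha> * F Z)) * Kdiag D \<alpha> F Z"

definition poch :: "real \<Rightarrow> nat \<Rightarrow> real" where
  "poch a k = Gamma (a + real k) / Gamma a"

definition chi :: "nat \<Rightarrow> nat \<Rightarrow> real \<Rightarrow> real \<Rightarrow> nat \<Rightarrow> real" where
  "chi n m \<nu> a s = ((\<nu> + 1) * a + real s) ^ n /
     (\<Sum>d=0..n. real (n choose d) * \<nu> ^ (n - d) * Gamma (a - real m - real d) / Gamma (a - real d + real s))"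

definition psi :: "nat \<Rightarrow> nat \<Rightarrow> real \<Rightarrow> real \<Rightarrow> nat \<Rightarrow> real" where
  "psi n m \<nu> a s = Gamma (a - real m - real n) * chi n m \<nu> a s / Gamma (a + real s)"

end

(*
  The domain is a complete Reinhardt domain and the weight depends only on the moduli of the
  coordinates. Hence every element of the weighted Bergman space has a monomial expansion on the
  domain, distinct monomials are orthogonal, and the kernel on the diagonal is the sum of
  |Z^a|^2 / N a, where N a is the squared norm of the monomial Z^a. Here
  det g = mu^n (nu + 1/(1-T))^n (1-T)^(-m-1) e^(m mu |z|^2) with T = e^(mu |z|^2) |w|^2, so that N a
  factors into Gamma integrals in |z|^2 and Beta integrals in T. For a fixed exponent of w the sum
  over the exponents of z is an exponential series.
*)
theory Submission
  imports Defs "HOL-Complex_Analysis.Cauchy_Integral_Formula" "HOL-Probability.Distributions" "HOL-Real_Asymp.Real_Asymp"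
begin

text \<open>The diagonal kernel is a description over representers, so a reproducing element must be
  exhibited: the candidate is the sum of cnj(Z^a) Y^a / N a, checked directly rather than through
  completeness of the space. The obstacle is that the two series being paired need not converge
  uniformly on the domain, whereas orthogonality concerns single pairs of monomials. Origin of the
  constants: let p, q be the exponents of z, w and \<beta> = (\<nu>+1)\<alpha> + |q|. The w-integral
  leaves a factor e^(-\<mu>\<beta>|z|^2), so the z-integral gives (\<mu>\<beta>)^(-n-|p|). Summing
  over p produces e^(\<beta>\<mu>|z|^2), and the n spare powers of \<beta> are the numerator of
  \<open>chi\<close>. Its denominator comes from binomial expansion of (\<nu> + 1/(1-T))^n under the
  T-integral; term d converges for \<alpha> > m + d. In e^(\<beta>\<mu>|z|^2), the part with
  (\<nu>+1)\<alpha> is cancelled by e^(-\<alpha>\<Phi>) and the part with |q| rescales w.\<close>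

no_notation Infinite_Set_Sum.abs_summable_on (infix \<open>abs'_summable'_on\<close> 50)

section \<open>Power series in several complex variables\<close>

text \<open>Boundedness is given on the open disc only, with no continuity up to the boundary.
  Cauchy's inequality is therefore used on circles of radius \<rho> < r, and \<rho> tends to
  r.\<close>

lemma norm_taylor_coeff_le:
  fixes f :: "complex \<Rightarrow> complex"
  assumes hol: "f holomorphic_on ball 0 r" and r: "r > 0"
    and bd: "\<And>z. z \<in> ball 0 r \<Longrightarrow> cmod (f z) \<le> M"
  shows "cmod ((deriv ^^ n) f 0 / fact n) \<le> M / r ^ n"
proof -
  have *: "cmod ((deriv ^^ n) f 0 / fact n) * \<rho> ^ n \<le> M" if "0 < \<rho>" "\<rho> < r" for \<rho>
  proof -
    have "cmod ((deriv ^^ n) f 0) \<le> fact n * M / \<rho> ^ n"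
    proof (rule Cauchy_inequality)
      show "f holomorphic_on ball 0 \<rho>"
        by (rule holomorphic_on_subset[OF hol]) (use that in auto)
      show "continuous_on (cball 0 \<rho>) f"
        by (rule holomorphic_on_imp_continuous_on[OF holomorphic_on_subset[OF hol]]) (use that in auto)
      show "\<And>x. cmod (0 - x) = \<rho> \<Longrightarrow> cmod (f x) \<le> M"
        using that by (intro bd) auto
    qed (use that in auto)
    then show ?thesis using that by (simp add: norm_divide field_simps)
  qed
  have "((\<lambda>\<rho>. cmod ((deriv ^^ n) f 0 / fact n) * \<rho> ^ n) \<longlongrightarrow> cmod ((deriv ^^ n) f 0 / fact n) * r ^ n) (at_left r)"
    by (intro tendsto_intros)
  moreover have "eventually (\<lambda>\<rho>. cmod ((deriv ^^ n) f 0 / fact n) * \<rho> ^ n \<le> M) (at_left r)"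
    using eventually_at_left_real[OF r] by eventually_elim (auto intro!: *)
  ultimately have "cmod ((deriv ^^ n) f 0 / fact n) * r ^ n \<le> M"
    by (intro tendsto_upperbound) auto
  then show ?thesis using r by (simp add: field_simps)
qed

text \<open>Only separate holomorphy and a bound are assumed, so there is no joint continuity with
  which to differentiate a Cauchy integral in the parameter. Instead, by strong induction on n, the
  n-th coefficient is the uniform limit, as u tends to 0, of (h s u minus its Taylor polynomial of
  degree below n) / u^n, and these quotients are holomorphic in s.\<close>

lemma taylor_coeff_holomorphic:
  fixes h :: "complex \<Rightarrow> complex \<Rightarrow> complex"
  assumes b: "b > 0"
    and hol1: "\<And>u. u \<in> ball 0 b \<Longrightarrow> (\<lambda>s. h s u) holomorphic_on ball 0 a"
    and hol2: "\<And>s. s \<in> ball 0 a \<Longrightarrow> h s holomorphic_on ball 0 b"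
    and bd: "\<And>s u. s \<in> ball 0 a \<Longrightarrow> u \<in> ball 0 b \<Longrightarrow> cmod (h s u) \<le> M"
  shows "(\<lambda>s. (deriv ^^ n) (h s) 0 / fact n) holomorphic_on ball 0 a"
proof (induction n rule: less_induct)
  case (less n)
  define c where "c = (\<lambda>l s. (deriv ^^ l) (h s) 0 / fact l)"
  \<comment> \<open>Nonzero sample points tending to 0; the shift by 2 keeps them strictly inside
    the disc already for N = 0 and the ratio of the tail series at most 1/2.\<close>
  define U where "U = (\<lambda>N::nat. of_real (b / (real N + 2)) :: complex)"
  define F where "F = (\<lambda>N s. (h s (U N) - (\<Sum>l<n. c l s * U N ^ l)) / U N ^ n)"
  have nU: "cmod (U N) = b / (real N + 2)" for N
    using b unfolding U_def by (simp only: norm_of_real) simp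
  have Ub: "U N \<in> ball 0 b" for N
  proof -
    have "b / (real N + 2) < b / 1" using b by (intro divide_strict_left_mono) auto
    then show ?thesis by (simp add: nU)
  qed
  have U0: "U N \<noteq> 0" for N
    using nU[of N] b by (metis add_nonneg_pos divide_pos_pos norm_zero of_nat_0_le_iff order_less_irrefl zero_less_numeral)
  have cb: "cmod (c l s) \<le> M / b ^ l" if "s \<in> ball 0 a" for l s
    unfolding c_def by (rule norm_taylor_coeff_le[OF hol2[OF that] b]) (use that bd in auto)
  have M: "M \<ge> 0" if "s \<in> ball 0 a" for s :: complex
    using bd[of s 0] that b norm_ge_zero[of "h s 0"] by (simp del: norm_ge_zero)
  \<comment> \<open>The coefficient bound M / b^l turns the Taylor tail beyond degree n into a
    geometric series of ratio 1/(N+2). Its sum is independent of s, which makes the convergence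
    uniform.\<close>
  have err: "cmod (F N s - c n s) \<le> M / b ^ n / (real N + 1)" if s: "s \<in> ball 0 a" for N s
  proof -
    have "(\<lambda>l. c l s * (U N - 0) ^ l) sums h s (U N)"
      unfolding c_def by (rule holomorphic_power_series[OF hol2[OF s] Ub])
    then have S: "(\<lambda>l. c l s * U N ^ l) sums h s (U N)" by simp
    have "(\<lambda>l. c (l + Suc n) s * U N ^ (l + Suc n)) sums (h s (U N) - (\<Sum>l<Suc n. c l s * U N ^ l))"
      by (rule sums_split_initial_segment[OF S])
    then have "(\<lambda>l. c (l + Suc n) s * U N ^ (l + Suc n) / U N ^ n) sums ((h s (U N) - (\<Sum>l<Suc n. c l s * U N ^ l)) / U N ^ n)"
      by (rule sums_divide)
    moreover have "(h s (U N) - (\<Sum>l<Suc n. c l s * U N ^ l)) / U N ^ n = F N s - c n s"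
      unfolding F_def using U0[of N] by (simp add: field_simps)
    moreover have "c (l + Suc n) s * U N ^ (l + Suc n) / U N ^ n = c (l + Suc n) s * U N ^ Suc l" for l
      using U0[of N] by (simp add: power_add field_simps)
    ultimately have S2: "(\<lambda>l. c (l + Suc n) s * U N ^ Suc l) sums (F N s - c n s)" by simp
    have "(\<lambda>l. (1 / (real N + 2)) ^ l) sums (1 / (1 - 1 / (real N + 2)))"
      by (rule geometric_sums) (auto simp: abs_if)
    then have "(\<lambda>l. M / b ^ n / (real N + 2) * (1 / (real N + 2)) ^ l) sums (M / b ^ n / (real N + 2) * (1 / (1 - 1 / (real N + 2))))"
      by (rule sums_mult)
    moreover have "M / b ^ n / (real N + 2) * (1 / (1 - 1 / (real N + 2))) = M / b ^ n / (real N + 1)"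
    proof -
      have "1 - 1 / (real N + 2) = (real N + 1) / (real N + 2)" by (simp add: field_simps)
      then show ?thesis by simp
    qed
    ultimately have S3: "(\<lambda>l. M / b ^ n / (real N + 2) * (1 / (real N + 2)) ^ l) sums (M / b ^ n / (real N + 1))"
      by (simp only:)
    have "cmod (\<Sum>l. c (l + Suc n) s * U N ^ Suc l) \<le> (\<Sum>l. M / b ^ n / (real N + 2) * (1 / (real N + 2)) ^ l)"
    proof (rule norm_suminf_le)
      fix l
      have "cmod (c (l + Suc n) s * U N ^ Suc l) \<le> M / b ^ (l + Suc n) * (b / (real N + 2)) ^ Suc l"
        unfolding norm_mult norm_power nU by (intro mult_right_mono cb s) (use b in auto)
      also have "\<dots> = M / b ^ n / (real N + 2) * (1 / (real N + 2)) ^ l"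
        using b by (simp add: power_add power_divide field_simps)
      finally show "cmod (c (l + Suc n) s * U N ^ Suc l) \<le> M / b ^ n / (real N + 2) * (1 / (real N + 2)) ^ l" .
    qed (use S3 in \<open>auto simp: sums_iff\<close>)
    then show ?thesis using S2 S3 by (simp add: sums_iff)
  qed
  have ch: "c l holomorphic_on ball 0 a" if "l < n" for l
    using less[OF that] by (simp only: c_def)
  have "c n holomorphic_on ball 0 a"
  proof (rule holomorphic_uniform_sequence[where f = F])
    show "F N holomorphic_on ball 0 a" for N
      unfolding F_def using Ub U0 by (auto intro!: holomorphic_intros hol1 ch)
    fix s assume s: "s \<in> ball (0::complex) a"
    then obtain d where d: "d > 0" "cball s d \<subseteq> ball 0 a" by (meson open_ball open_contains_cball)
    have "uniform_limit (cball s d) F (c n) sequentially"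
    proof (rule uniform_limitI)
      fix e :: real assume e: "e > 0"
      have "(\<lambda>N. M / b ^ n / (real N + 1)) \<longlonglongrightarrow> 0"
        by real_asymp
      then have "eventually (\<lambda>N. M / b ^ n / (real N + 1) < e) sequentially"
        using e by (rule order_tendstoD)
      then show "\<forall>\<^sub>F N in sequentially. \<forall>x\<in>cball s d. dist (F N x) (c n x) < e"
      proof eventually_elim
        case (elim N)
        show ?case
        proof
          fix x assume "x \<in> cball s d"
          then have "x \<in> ball 0 a" using d by blast
          from err[OF this, of N] elim show "dist (F N x) (c n x) < e" by (simp add: dist_norm)
        qed
      qed
    qed
    then show "\<exists>d>0. cball s d \<subseteq> ball 0 a \<and> uniform_limit (cball s d) F (c n) sequentially"
      using d by blast
  qed auto
  then show ?case by (simp add: c_def)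
qed

section \<open>Iterated Taylor expansion on polydiscs\<close>

definition polydisc :: "('k \<Rightarrow> real) \<Rightarrow> ('k \<Rightarrow> complex) set" where
  "polydisc r = {t. \<forall>i. cmod (t i) < r i}"

text \<open>The bound is part of the notion: it supplies what joint continuity would give, namely
  holomorphy of the coefficients in the other variables and a geometric majorant for the multiple
  series.\<close>

definition sep_holomorphic :: "('k \<Rightarrow> real) \<Rightarrow> real \<Rightarrow> (('k \<Rightarrow> complex) \<Rightarrow> complex) \<Rightarrow> bool" where
  "sep_holomorphic r M f \<longleftrightarrow> (\<forall>t\<in>polydisc r. cmod (f t) \<le> M \<and>
     (\<forall>i. (\<lambda>s. f (t(i := s))) holomorphic_on ball 0 (r i)))"

text \<open>The coefficient remains a function of all coordinates, constant in coordinate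
  \<open>j\<close>, so that the operation can be iterated within one function type.\<close>

definition taylor_coeff :: "'k \<Rightarrow> nat \<Rightarrow> (('k \<Rightarrow> complex) \<Rightarrow> complex) \<Rightarrow> ('k \<Rightarrow> complex) \<Rightarrow> complex" where
  "taylor_coeff j n f t = (deriv ^^ n) (\<lambda>s. f (t(j := s))) 0 / fact n"

fun taylor_coeffs :: "'k list \<Rightarrow> ('k \<Rightarrow> nat) \<Rightarrow> (('k \<Rightarrow> complex) \<Rightarrow> complex) \<Rightarrow> ('k \<Rightarrow> complex) \<Rightarrow> complex" where
  "taylor_coeffs [] a f = f"
| "taylor_coeffs (j # js) a f = taylor_coeff j (a j) (taylor_coeffs js a f)"

lemma polydisc_upd: "t \<in> polydisc r \<Longrightarrow> s \<in> ball 0 (r i) \<Longrightarrow> t(i := s) \<in> polydisc r"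
  by (auto simp: polydisc_def)

lemma polydisc_pos: "t \<in> polydisc r \<Longrightarrow> r i > 0"
  by (metis (mono_tags, lifting) mem_Collect_eq norm_ge_zero order_le_less_trans polydisc_def)

lemma taylor_coeff_sums:
  assumes "sep_holomorphic r M f" "t \<in> polydisc r"
  shows "(\<lambda>n. taylor_coeff j n f t * t j ^ n) sums f t"
proof -
  have "(\<lambda>s. f (t(j := s))) holomorphic_on ball 0 (r j)"
    using assms by (auto simp: sep_holomorphic_def)
  moreover have "t j \<in> ball 0 (r j)" using assms by (auto simp: polydisc_def)
  ultimately show ?thesis
    using holomorphic_power_series[of "\<lambda>s. f (t(j := s))" 0 "r j" "t j"] by (simp add: taylor_coeff_def)
qed

text \<open>This closure property drives the iteration over the variables: the polyradius stays the
  same, and each extraction costs a factor \<open>r j ^ n\<close> in the bound. In the direction j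
  the coefficient is constant; in another direction the two-variable lemma above applies.\<close>

lemma sep_holomorphic_taylor_coeff:
  assumes f: "sep_holomorphic r M f"
  shows "sep_holomorphic r (M / r j ^ n) (taylor_coeff j n f)"
  unfolding sep_holomorphic_def
proof (intro ballI conjI allI)
  fix t assume t: "t \<in> polydisc r"
  show "cmod (taylor_coeff j n f t) \<le> M / r j ^ n"
    unfolding taylor_coeff_def
    by (rule norm_taylor_coeff_le)
       (use f t polydisc_pos[OF t] in \<open>auto simp: sep_holomorphic_def polydisc_upd\<close>)
  fix i
  show "(\<lambda>s. taylor_coeff j n f (t(i := s))) holomorphic_on ball 0 (r i)"
  proof (cases "i = j")
    case True then show ?thesis by (simp add: taylor_coeff_def)
  next
    case False
    show ?thesis unfolding taylor_coeff_def
    proof (rule taylor_coeff_holomorphic)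
      show "r j > 0" by (rule polydisc_pos[OF t])
      show "(\<lambda>s. f (t(i := s, j := u))) holomorphic_on ball 0 (r i)" if "u \<in> ball 0 (r j)" for u
        using f polydisc_upd[OF t that] False by (subst fun_upd_twist) (auto simp: sep_holomorphic_def)
      show "(\<lambda>u. f (t(i := s, j := u))) holomorphic_on ball 0 (r j)" if "s \<in> ball 0 (r i)" for s
        using f polydisc_upd[OF t that] False by (auto simp: sep_holomorphic_def)
      show "cmod (f (t(i := s, j := u))) \<le> M" if "s \<in> ball 0 (r i)" "u \<in> ball 0 (r j)" for s u
        using f polydisc_upd[OF polydisc_upd[OF t that(1)] that(2)] by (auto simp: sep_holomorphic_def)
    qed
  qed
qed

lemma sep_holomorphic_taylor_coeffs:
  assumes f: "sep_holomorphic r M f" and "distinct js"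
  shows "sep_holomorphic r (M / (\<Prod>j\<in>set js. r j ^ a j)) (taylor_coeffs js a f)"
  using assms(2)
proof (induction js)
  case (Cons j js)
  then have "sep_holomorphic r (M / (\<Prod>j\<in>set js. r j ^ a j)) (taylor_coeffs js a f)" by simp
  from sep_holomorphic_taylor_coeff[OF this, of j "a j"] show ?case
    using Cons.prems by (simp add: mult.commute)
qed (use f in auto)

text \<open>Every listed coordinate is overwritten when its coefficient is taken. Once all
  coordinates are listed, the iterated coefficient is a constant.\<close>

lemma taylor_coeffs_cong:
  assumes "\<And>i. i \<notin> set js \<Longrightarrow> t i = t' i"
  shows "taylor_coeffs js a f t = taylor_coeffs js a f t'"
  using assms
proof (induction js arbitrary: t t')
  case Nil
  then have "t = t'" by auto
  then show ?case by simp
next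
  case (Cons j js)
  have "taylor_coeffs js a f (t(j := s)) = taylor_coeffs js a f (t'(j := s))" for s
    by (rule Cons.IH) (use Cons.prems in auto)
  then show ?case by (simp add: taylor_coeff_def)
qed

lemma taylor_coeffs_cong_exponents:
  assumes "\<And>i. i \<in> set js \<Longrightarrow> a i = b i"
  shows "taylor_coeffs js a f = taylor_coeffs js b f"
  using assms by (induction js) auto

text \<open>Multiplies out finitely many nonnegative series. It serves for geometric series, as
  majorants, and for exponential series, in the summation over the exponents of z.\<close>

lemma prod_has_sum_PiE:
  fixes f :: "'k \<Rightarrow> nat \<Rightarrow> real"
  assumes "finite A" "\<And>j. j \<in> A \<Longrightarrow> f j sums s j" "\<And>j n. j \<in> A \<Longrightarrow> f j n \<ge> 0"
  shows "((\<lambda>a. \<Prod>j\<in>A. f j (a j)) has_sum (\<Prod>j\<in>A. s j)) (PiE A (\<lambda>_. UNIV))"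
proof -
  have hs: "(f j has_sum s j) UNIV" if "j \<in> A" for j
    using assms(2,3)[OF that] by (intro norm_summable_imp_has_sum) (auto simp: sums_iff)
  have s: "f j abs_summable_on UNIV" if "j \<in> A" for j
    using has_sum_imp_summable[OF hs[OF that]] assms(3)[OF that] by simp
  have "Infinite_Set_Sum.abs_summable_on (\<lambda>a. \<Prod>j\<in>A. f j (a j)) (PiE A (\<lambda>_. UNIV))"
    by (rule abs_summable_on_prod_PiE[OF assms(1)]) (use s in \<open>simp_all only: abs_summable_equivalent[symmetric] countableI_type\<close>)
  then have "(\<lambda>a. \<Prod>j\<in>A. f j (a j)) summable_on (PiE A (\<lambda>_. UNIV))"
    unfolding abs_summable_equivalent[symmetric] by (rule Infinite_Sum.abs_summable_summable)
  moreover have "infsum (\<lambda>a. \<Prod>j\<in>A. f j (a j)) (PiE A (\<lambda>_. UNIV)) = (\<Prod>j\<in>A. infsum (f j) UNIV)"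
    by (rule infsum_prod_PiE_abs[OF assms(1) s])
  moreover have "(\<Prod>j\<in>A. infsum (f j) UNIV) = (\<Prod>j\<in>A. s j)"
    by (intro prod.cong refl infsumI hs)
  ultimately show ?thesis by (simp add: has_sum_iff)
qed

lemma prod_power_has_sum:
  fixes x :: "'k \<Rightarrow> real"
  assumes "finite A" "\<And>j. j \<in> A \<Longrightarrow> 0 \<le> x j \<and> x j < 1"
  shows "((\<lambda>a. \<Prod>j\<in>A. x j ^ a j) has_sum (\<Prod>j\<in>A. 1 / (1 - x j))) (PiE A (\<lambda>_. UNIV))"
  by (rule prod_has_sum_PiE) (use assms in \<open>auto intro!: geometric_sums\<close>)

text \<open>The product of geometric series with ratios |t_j| / r_j majorises the terms, because the
  coefficient bound carries exactly the powers of r. Absolute summability then lets the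
  variable-by-variable expansions be merged into a single unordered sum.\<close>

lemma taylor_coeffs_has_sum:
  assumes f: "sep_holomorphic r M f" and t: "t \<in> polydisc r" and "distinct js"
  shows "((\<lambda>a. taylor_coeffs js a f t * (\<Prod>j\<in>set js. t j ^ a j)) has_sum f t) (PiE (set js) (\<lambda>_. UNIV))"
    and "(\<lambda>a. taylor_coeffs js a f t * (\<Prod>j\<in>set js. t j ^ a j)) abs_summable_on (PiE (set js) (\<lambda>_. UNIV))"
proof -
  have r: "r j > 0" for j by (rule polydisc_pos[OF t])
  have M: "M \<ge> 0" using f t order_trans[OF norm_ge_zero[of "f t"]] by (auto simp: sep_holomorphic_def)
  have ab: "(\<lambda>a. taylor_coeffs js a f t * (\<Prod>j\<in>set js. t j ^ a j)) abs_summable_on (PiE (set js) (\<lambda>_. UNIV))"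
    if "distinct js" for js
  proof (rule Infinite_Sum.abs_summable_on_comparison_test')
    have "((\<lambda>a. \<Prod>j\<in>set js. (cmod (t j) / r j) ^ a j) has_sum (\<Prod>j\<in>set js. 1 / (1 - cmod (t j) / r j))) (PiE (set js) (\<lambda>_. UNIV))"
      by (rule prod_power_has_sum) (use t r in \<open>auto simp: polydisc_def less_imp_le\<close>)
    then show "(\<lambda>a. M * (\<Prod>j\<in>set js. (cmod (t j) / r j) ^ a j)) summable_on (PiE (set js) (\<lambda>_. UNIV))"
      by (intro summable_on_cmult_right) (rule has_sum_imp_summable)
    fix a :: "'a \<Rightarrow> nat"
    have "cmod (taylor_coeffs js a f t) \<le> M / (\<Prod>j\<in>set js. r j ^ a j)"
      using sep_holomorphic_taylor_coeffs[OF f that, of a] t by (auto simp: sep_holomorphic_def)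
    then have "cmod (taylor_coeffs js a f t) * (\<Prod>j\<in>set js. cmod (t j) ^ a j) \<le> M / (\<Prod>j\<in>set js. r j ^ a j) * (\<Prod>j\<in>set js. cmod (t j) ^ a j)"
      by (intro mult_right_mono prod_nonneg) auto
    then show "norm (taylor_coeffs js a f t * (\<Prod>j\<in>set js. t j ^ a j)) \<le> M * (\<Prod>j\<in>set js. (cmod (t j) / r j) ^ a j)"
      by (simp add: norm_mult prod_norm[symmetric] norm_power power_divide prod_dividef)
  qed
  show "(\<lambda>a. taylor_coeffs js a f t * (\<Prod>j\<in>set js. t j ^ a j)) abs_summable_on (PiE (set js) (\<lambda>_. UNIV))"
    by (rule ab) fact
  show "((\<lambda>a. taylor_coeffs js a f t * (\<Prod>j\<in>set js. t j ^ a j)) has_sum f t) (PiE (set js) (\<lambda>_. UNIV))"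
    using assms(3)
  proof (induction js)
    case Nil
    then show ?case by (simp add: has_sum_finite_iff)
  next
    case (Cons j js)
    let ?F = "\<lambda>a. taylor_coeffs (j # js) a f t * (\<Prod>j\<in>set (j # js). t j ^ a j)"
    let ?B = "PiE (set js) (\<lambda>_. UNIV :: nat set)"
    have j: "j \<notin> set js" and d: "distinct js" using Cons.prems by auto
    have pi: "PiE (set (j # js)) (\<lambda>_. UNIV :: nat set) = (\<lambda>(g,y). g(j:=y)) ` (?B \<times> UNIV)"
      using PiE_insert_eq[of j "set js" "\<lambda>_. UNIV :: nat set"] by auto
    have inj: "inj_on (\<lambda>(g,y). g(j:=y)) (?B \<times> (UNIV :: nat set))"
      using inj_combinator'[OF j, of "\<lambda>_. UNIV :: nat set"] by simp
    have sm: "?F summable_on PiE (set (j # js)) (\<lambda>_. UNIV)"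
      by (rule Infinite_Sum.abs_summable_summable[OF ab]) (use Cons.prems in auto)
    then have "(\<lambda>p. ?F (case p of (g,y) \<Rightarrow> g(j:=y))) summable_on (?B \<times> UNIV)"
      unfolding pi by (subst (asm) summable_on_reindex[OF inj]) (simp add: o_def)
    then have sm2: "(\<lambda>p. ?F ((fst p)(j := snd p))) summable_on (?B \<times> UNIV)"
      by (simp add: case_prod_beta)
    then have sm3: "(\<lambda>(a,n). ?F (a(j := n))) summable_on (SIGMA a:?B. UNIV)"
      by (simp only: case_prod_unfold)
    have inner: "((\<lambda>n. ?F ((fst (a,n))(j := snd (a,n)))) has_sum (taylor_coeffs js a f t * (\<Prod>j\<in>set js. t j ^ a j))) UNIV"
      if "a \<in> ?B" for a
    proof -
      have eq: "?F ((fst (a,n))(j := snd (a,n))) = (taylor_coeff j n (taylor_coeffs js a f) t * t j ^ n) * (\<Prod>j\<in>set js. t j ^ a j)" for n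
      proof -
        have "taylor_coeffs js (a(j := n)) f = taylor_coeffs js a f"
          by (rule taylor_coeffs_cong_exponents) (use j in auto)
        moreover have "(\<Prod>i\<in>set js. t i ^ (a(j := n)) i) = (\<Prod>j\<in>set js. t j ^ a j)"
          by (rule prod.cong) (use j in auto)
        ultimately show ?thesis using j by (simp add: mult_ac)
      qed
      have "(\<lambda>n. ?F ((fst (a,n))(j := snd (a,n)))) summable_on UNIV"
        using summable_on_SigmaD1[OF sm3 that] by (simp only: fst_conv snd_conv)
      then have "((\<lambda>n. ?F ((fst (a,n))(j := snd (a,n)))) has_sum infsum (\<lambda>n. ?F ((fst (a,n))(j := snd (a,n)))) UNIV) UNIV"
        by (rule has_sum_infsum)
      \<comment> \<open>That the unordered sum exists is inherited from the double family; its value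
        is read off from the ordered one-variable Taylor series.\<close>
      moreover from has_sum_imp_sums[OF this]
      have "infsum (\<lambda>n. ?F ((fst (a,n))(j := snd (a,n)))) UNIV = taylor_coeffs js a f t * (\<Prod>j\<in>set js. t j ^ a j)"
        unfolding eq using sums_mult2[OF taylor_coeff_sums[OF sep_holomorphic_taylor_coeffs[OF f d] t]] sums_unique2 by blast
      ultimately show ?thesis by simp
    qed
    have "((\<lambda>p. ?F ((fst p)(j := snd p))) has_sum f t) (?B \<times> UNIV)"
      by (rule has_sum_SigmaI[OF inner Cons.IH[OF d] sm2])
    then show ?case
      unfolding pi by (subst has_sum_reindex[OF inj]) (simp add: o_def case_prod_beta)
  qed
qed

text \<open>The quantifiers matter: the coefficients, evaluated at the origin, are fixed by f before
  any polyradius or bound is chosen. Expansions on different polydiscs thus share their coefficients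
  and fit together on a union of polydiscs.\<close>

lemma power_series_expansion:
  fixes f :: "('k::finite \<Rightarrow> complex) \<Rightarrow> complex"
  obtains c :: "('k \<Rightarrow> nat) \<Rightarrow> complex" where
    "\<And>r M t. sep_holomorphic r M f \<Longrightarrow> t \<in> polydisc r \<Longrightarrow>
       ((\<lambda>a. c a * (\<Prod>j\<in>UNIV. t j ^ a j)) has_sum f t) UNIV \<and>
       (\<lambda>a. c a * (\<Prod>j\<in>UNIV. t j ^ a j)) abs_summable_on UNIV"
proof -
  obtain js :: "'k list" where js: "set js = UNIV" "distinct js"
    using finite_distinct_list[of "UNIV :: 'k set"] by auto
  show thesis
  proof (rule that[of "\<lambda>a. taylor_coeffs js a f (\<lambda>_. 0)"])
    fix r M t assume *: "sep_holomorphic r M f" "t \<in> polydisc r"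
    have "taylor_coeffs js a f t = taylor_coeffs js a f (\<lambda>_. 0)" for a
      by (rule taylor_coeffs_cong) (simp add: js)
    then show "((\<lambda>a. taylor_coeffs js a f (\<lambda>_. 0) * (\<Prod>j\<in>UNIV. t j ^ a j)) has_sum f t) UNIV \<and>
       (\<lambda>a. taylor_coeffs js a f (\<lambda>_. 0) * (\<Prod>j\<in>UNIV. t j ^ a j)) abs_summable_on UNIV"
      using taylor_coeffs_has_sum[OF * js(2)] by (simp add: js)
  qed
qed

section \<open>Lebesgue measure on complex vectors\<close>

lemma prod_Basis_vec:
  fixes g :: "'a::euclidean_space^'k::finite \<Rightarrow> 'b::comm_monoid_mult"
  shows "prod g Basis = (\<Prod>i\<in>UNIV. \<Prod>b\<in>Basis. g (axis i b))"
proof -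
  have B: "(Basis :: ('a^'k) set) = (\<lambda>(i,b). axis i b) ` (UNIV \<times> Basis)"
    by (auto simp: Basis_vec_def)
  have "inj_on (\<lambda>(i,b). axis i b :: 'a^'k) (UNIV \<times> Basis)"
    by (auto simp: inj_on_def axis_eq_axis)
  then show ?thesis
    unfolding B by (subst prod.reindex) (auto simp: prod.cartesian_product case_prod_unfold)
qed

lemma vec_lambda_measurable [measurable]:
  "(\<lambda>f. \<chi> i. (f i :: 'a::euclidean_space)) \<in> PiM (UNIV :: 'k::finite set) (\<lambda>_. borel) \<rightarrow>\<^sub>M borel"
proof (subst borel_measurable_euclidean_space, intro ballI)
  fix b :: "'a^'k" assume "b \<in> Basis"
  then obtain i u where "b = axis i u" by (auto simp: Basis_vec_def)
  then show "(\<lambda>f. (\<chi> i. f i) \<bullet> b) \<in> borel_measurable (PiM UNIV (\<lambda>_. borel))"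
    by (simp add: inner_axis)
qed

lemma vec_nth_measurable [measurable]:
  "(\<lambda>v::'a::euclidean_space^'k::finite. v $ i) \<in> borel_measurable borel"
  by (intro borel_measurable_continuous_onI continuous_intros)

text \<open>Lebesgue measure is characterised by the volumes of boxes, and a box of vectors is a
  product of boxes. This makes Fubini and coordinatewise transformations available.\<close>

lemma lborel_vec:
  "(lborel :: ('a::euclidean_space^'k::finite) measure) = distr (PiM UNIV (\<lambda>_. lborel)) borel (\<lambda>f. \<chi> i. f i)"
proof (rule lborel_eqI)
  interpret product_sigma_finite "\<lambda>_::'k. lborel :: 'a measure" by standard
  fix l u :: "'a^'k" assume le: "\<And>b. b \<in> Basis \<Longrightarrow> l \<bullet> b \<le> u \<bullet> b"
  have le': "l $ i \<bullet> b \<le> u $ i \<bullet> b" if "b \<in> Basis" for i b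
    using le[of "axis i b"] that by (auto simp: Basis_vec_def inner_axis)
  have pre: "(\<lambda>f. \<chi> i. f i) -` box l u \<inter> space (PiM UNIV (\<lambda>_. lborel)) = PiE UNIV (\<lambda>i. box (l $ i) (u $ i))"
    by (auto simp: space_PiM mem_box Basis_vec_def inner_axis PiE_iff)
  have m: "(\<lambda>f. \<chi> i. (f i :: 'a)) \<in> PiM (UNIV :: 'k::finite set) (\<lambda>_. lborel) \<rightarrow>\<^sub>M borel"
    using vec_lambda_measurable by (simp cong: measurable_cong_sets sets_PiM_cong)
  have "emeasure (distr (PiM UNIV (\<lambda>_. lborel)) borel (\<lambda>f. \<chi> i. f i)) (box l u)
      = emeasure (PiM UNIV (\<lambda>_::'k. lborel)) (PiE UNIV (\<lambda>i. box (l $ i) (u $ i)))"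
    by (subst emeasure_distr[OF m]) (auto simp: pre)
  also have "\<dots> = (\<Prod>i\<in>UNIV. emeasure lborel (box (l $ i) (u $ i)))"
    by (subst emeasure_PiM) auto
  also have "\<dots> = (\<Prod>i\<in>UNIV. ennreal (\<Prod>b\<in>Basis. (u $ i - l $ i) \<bullet> b))"
    by (intro prod.cong refl emeasure_lborel_box le')
  also have "\<dots> = ennreal (\<Prod>i\<in>UNIV. \<Prod>b\<in>Basis. (u $ i - l $ i) \<bullet> b)"
    by (intro prod_ennreal prod_nonneg) (use le' in \<open>auto simp: inner_diff_left\<close>)
  also have "(\<Prod>i\<in>UNIV. \<Prod>b\<in>Basis. (u $ i - l $ i) \<bullet> b) = (\<Prod>b\<in>Basis. (u - l) \<bullet> b)"
    by (simp add: prod_Basis_vec inner_axis)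
  finally show "emeasure (distr (PiM UNIV (\<lambda>_. lborel)) borel (\<lambda>f. \<chi> i. f i)) (box l u) = ennreal (\<Prod>b\<in>Basis. (u - l) \<bullet> b)" .
qed simp

lemma nn_integral_vec:
  fixes f :: "'a::euclidean_space^'k::finite \<Rightarrow> ennreal"
  assumes [measurable]: "f \<in> borel_measurable borel"
  shows "(\<integral>\<^sup>+v. f v \<partial>lborel) = (\<integral>\<^sup>+x. f (\<chi> i. x i) \<partial>PiM UNIV (\<lambda>_. lborel))"
proof -
  have m: "(\<lambda>f. \<chi> i. (f i :: 'a)) \<in> PiM (UNIV :: 'k::finite set) (\<lambda>_. lborel) \<rightarrow>\<^sub>M borel"
    using vec_lambda_measurable by (simp cong: measurable_cong_sets sets_PiM_cong)
  show ?thesis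
    by (subst lborel_vec, subst nn_integral_distr[OF m]) auto
qed

lemma Complex_measurable [measurable (raw)]:
  assumes "f \<in> borel_measurable M" "g \<in> borel_measurable M"
  shows "(\<lambda>x. Complex (f x) (g x)) \<in> borel_measurable M"
  using assms by (simp add: borel_measurable_complex_iff)

lemma lborel_complex:
  "(lborel :: complex measure) = distr (lborel \<Otimes>\<^sub>M lborel) borel (\<lambda>p. Complex (fst p) (snd p))"
proof (rule lborel_eqI)
  fix l u :: complex assume le: "\<And>b. b \<in> Basis \<Longrightarrow> l \<bullet> b \<le> u \<bullet> b"
  have le': "Re l \<le> Re u" "Im l \<le> Im u"
    using le[of 1] le[of \<i>] by (auto simp: Basis_complex_def)
  have pre: "(\<lambda>p. Complex (fst p) (snd p)) -` box l u \<inter> space (lborel \<Otimes>\<^sub>M lborel) = {Re l<..<Re u} \<times> {Im l<..<Im u}"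
    by (auto simp: space_pair_measure mem_box Basis_complex_def)
  have m: "(\<lambda>p. Complex (fst p) (snd p)) \<in> lborel \<Otimes>\<^sub>M lborel \<rightarrow>\<^sub>M borel" by measurable
  have "emeasure (distr (lborel \<Otimes>\<^sub>M lborel) borel (\<lambda>p. Complex (fst p) (snd p))) (box l u)
      = emeasure (lborel \<Otimes>\<^sub>M lborel) ({Re l<..<Re u} \<times> {Im l<..<Im u})"
    by (subst emeasure_distr[OF m]) (auto simp: pre)
  also have "\<dots> = emeasure lborel {Re l<..<Re u} * emeasure lborel {Im l<..<Im u}"
    by (rule lborel.emeasure_pair_measure_Times) auto
  also have "\<dots> = ennreal (\<Prod>b\<in>Basis. (u - l) \<bullet> b)"
    using le' by (simp add: Basis_complex_def ennreal_mult)
  finally show "emeasure (distr (lborel \<Otimes>\<^sub>M lborel) borel (\<lambda>p. Complex (fst p) (snd p))) (box l u) = ennreal (\<Prod>b\<in>Basis. (u - l) \<bullet> b)" .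
qed simp

lemma nn_integral_complex:
  assumes [measurable]: "f \<in> borel_measurable borel"
  shows "(\<integral>\<^sup>+z. f z \<partial>lborel) = (\<integral>\<^sup>+y. \<integral>\<^sup>+x. f (Complex x y) \<partial>lborel \<partial>lborel)"
    and "(\<integral>\<^sup>+z. f z \<partial>lborel) = (\<integral>\<^sup>+x. \<integral>\<^sup>+y. f (Complex x y) \<partial>lborel \<partial>lborel)"
proof -
  have *: "(\<integral>\<^sup>+z. f z \<partial>lborel) = (\<integral>\<^sup>+p. f (Complex (fst p) (snd p)) \<partial>(lborel \<Otimes>\<^sub>M lborel))"
    by (subst lborel_complex, subst nn_integral_distr) auto
  show "(\<integral>\<^sup>+z. f z \<partial>lborel) = (\<integral>\<^sup>+x. \<integral>\<^sup>+y. f (Complex x y) \<partial>lborel \<partial>lborel)"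
    unfolding * by (subst lborel.nn_integral_fst[symmetric]) auto
  show "(\<integral>\<^sup>+z. f z \<partial>lborel) = (\<integral>\<^sup>+y. \<integral>\<^sup>+x. f (Complex x y) \<partial>lborel \<partial>lborel)"
    unfolding * by (subst lborel_pair.nn_integral_snd[symmetric]) auto
qed

text \<open>A rotation is a product of three shears.\<close>

lemma nn_integral_complex_rotate:
  assumes [measurable]: "f \<in> borel_measurable borel" and \<omega>: "cmod \<omega> = 1" "Re \<omega> \<noteq> -1"
  shows "(\<integral>\<^sup>+z. f (\<omega> * z) \<partial>lborel) = (\<integral>\<^sup>+z. f z \<partial>lborel)"
proof -
  define S where "S = (\<lambda>c z. Complex (Re z + c * Im z) (Im z))"
  define T where "T = (\<lambda>c z. Complex (Re z) (Im z + c * Re z))"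
  have [measurable]: "S c \<in> borel_measurable borel" "T c \<in> borel_measurable borel" for c
    unfolding S_def T_def by (intro borel_measurable_continuous_onI continuous_intros)+
  have S: "(\<integral>\<^sup>+z. g (S c z) \<partial>lborel) = (\<integral>\<^sup>+z. g z \<partial>lborel)" if [measurable]: "g \<in> borel_measurable borel" for g c
  proof -
    have "(\<integral>\<^sup>+x. g (Complex x y) \<partial>lborel) = (\<integral>\<^sup>+x. g (Complex (c * y + x) y) \<partial>lborel)" for y
      using nn_integral_real_affine[of "\<lambda>x. g (Complex x y)" 1 "c * y"] by simp
    then show ?thesis
      by (simp add: nn_integral_complex(1) S_def add.commute)
  qed
  have T: "(\<integral>\<^sup>+z. g (T c z) \<partial>lborel) = (\<integral>\<^sup>+z. g z \<partial>lborel)" if [measurable]: "g \<in> borel_measurable borel" for g c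
  proof -
    have "(\<integral>\<^sup>+y. g (Complex x y) \<partial>lborel) = (\<integral>\<^sup>+y. g (Complex x (c * x + y)) \<partial>lborel)" for x
      using nn_integral_real_affine[of "\<lambda>y. g (Complex x y)" 1 "c * x"] by simp
    then show ?thesis
      by (simp add: nn_integral_complex(2) T_def add.commute)
  qed
  \<comment> \<open>For \<omega> = e^(i\<theta>) this is -tan(\<theta>/2), the shear parameter of
    the decomposition; it is why \<omega> = -1 is excluded. The middle shear has parameter sin
    \<theta>.\<close>
  define t where "t = - Im \<omega> / (1 + Re \<omega>)"
  have ne: "1 + Re \<omega> \<noteq> 0" using \<omega> by linarith
  have sq: "(Im \<omega>)\<^sup>2 = (1 - Re \<omega>) * (1 + Re \<omega>)"
    using \<omega>(1) by (simp add: cmod_def power2_eq_square algebra_simps)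
  have t1: "t * Im \<omega> = Re \<omega> - 1"
    using ne sq by (simp add: t_def field_simps power2_eq_square)
  have t2: "t * (1 + Re \<omega>) = - Im \<omega>" using ne by (simp add: t_def)
  have eq: "\<omega> * z = S t (T (Im \<omega>) (S t z))" for z
  proof -
    have "Re z + t * Im z + t * (Im z + Im \<omega> * (Re z + t * Im z))
        = Re z + (t * Im \<omega>) * Re z + Im z * (t * (1 + (1 + t * Im \<omega>)))"
      by (simp add: algebra_simps)
    also have "\<dots> = Re z + (Re \<omega> - 1) * Re z + Im z * (- Im \<omega>)"
      unfolding t1 using t2 by simp
    also have "\<dots> = Re \<omega> * Re z - Im \<omega> * Im z"
      by (simp add: algebra_simps)
    finally have 1: "Re z + t * Im z + t * (Im z + Im \<omega> * (Re z + t * Im z)) = Re \<omega> * Re z - Im \<omega> * Im z" .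
    have "Im z + Im \<omega> * (Re z + t * Im z) = Im z + Im \<omega> * Re z + (t * Im \<omega>) * Im z" by (simp add: algebra_simps)
    also have "\<dots> = Re \<omega> * Im z + Im \<omega> * Re z" unfolding t1 by (simp add: algebra_simps)
    finally show ?thesis using 1 by (simp add: S_def T_def complex_eq_iff)
  qed
  have "(\<integral>\<^sup>+z. f (\<omega> * z) \<partial>lborel) = (\<integral>\<^sup>+z. f (S t (T (Im \<omega>) z)) \<partial>lborel)"
    unfolding eq by (rule S) measurable
  also have "\<dots> = (\<integral>\<^sup>+z. f (S t z) \<partial>lborel)" by (rule T) measurable
  also have "\<dots> = (\<integral>\<^sup>+z. f z \<partial>lborel)" by (rule S) measurable
  finally show ?thesis .
qed

text \<open>A product measure is determined by its values on product sets, and the preimage of such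
  a set under a coordinatewise rotation is again one, so the one-dimensional invariance
  suffices.\<close>

lemma lborel_rotate:
  fixes \<omega> :: "'k::finite \<Rightarrow> complex"
  assumes \<omega>: "\<And>i. cmod (\<omega> i) = 1" "\<And>i. Re (\<omega> i) \<noteq> -1"
  shows "distr lborel borel (\<lambda>v::complex^'k. \<chi> i. \<omega> i * v $ i) = lborel"
proof -
  interpret product_sigma_finite "\<lambda>_::'k. lborel :: complex measure" by standard
  let ?P = "PiM (UNIV :: 'k set) (\<lambda>_. lborel :: complex measure)"
  have mR: "(\<lambda>f. \<lambda>i\<in>UNIV. \<omega> i * f i) \<in> ?P \<rightarrow>\<^sub>M ?P" by measurable
  have P: "distr ?P ?P (\<lambda>f. \<lambda>i\<in>UNIV. \<omega> i * f i) = ?P"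
  proof (rule PiM_eqI)
    fix A :: "'k \<Rightarrow> complex set" assume A: "\<And>i. i \<in> UNIV \<Longrightarrow> A i \<in> sets lborel"
    have 1: "emeasure lborel ((\<lambda>z. \<omega> i * z) -` A i) = emeasure lborel (A i)" for i
    proof -
      have [measurable]: "A i \<in> sets borel" using A by auto
      have "(\<lambda>z. \<omega> i * z) -` A i \<inter> space borel \<in> sets borel" by measurable
      then have "emeasure lborel ((\<lambda>z. \<omega> i * z) -` A i) = (\<integral>\<^sup>+z. indicator (A i) (\<omega> i * z) \<partial>lborel)"
        by (subst nn_integral_indicator[symmetric]) (auto intro!: nn_integral_cong simp del: nn_integral_indicator simp: indicator_def)
      also have "\<dots> = (\<integral>\<^sup>+z. indicator (A i) z \<partial>lborel)"
        by (rule nn_integral_complex_rotate) (use \<omega> in auto)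
      finally show ?thesis by simp
    qed
    have 2: "(\<lambda>z. \<omega> i * z) -` A i \<in> sets lborel" for i
    proof -
      have [measurable]: "A i \<in> sets borel" using A by auto
      have "(\<lambda>z. \<omega> i * z) -` A i \<inter> space borel \<in> sets borel" by measurable
      then show ?thesis by simp
    qed
    have pre: "(\<lambda>f. \<lambda>i\<in>UNIV. \<omega> i * f i) -` PiE UNIV A \<inter> space ?P = PiE UNIV (\<lambda>i. (\<lambda>z. \<omega> i * z) -` A i)"
      by (auto simp: space_PiM PiE_iff)
    have "emeasure (distr ?P ?P (\<lambda>f. \<lambda>i\<in>UNIV. \<omega> i * f i)) (PiE UNIV A) = emeasure ?P (PiE UNIV (\<lambda>i. (\<lambda>z. \<omega> i * z) -` A i))"
      using A by (subst emeasure_distr[OF mR]) (auto simp: pre)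
    also have "\<dots> = (\<Prod>i\<in>UNIV. emeasure lborel (A i))"
      using 2 by (subst emeasure_PiM) (auto simp: 1)
    finally show "emeasure (distr ?P ?P (\<lambda>f. \<lambda>i\<in>UNIV. \<omega> i * f i)) (PiE UNIV A) = (\<Prod>i\<in>UNIV. emeasure lborel (A i))" .
  qed auto
  have m: "(\<lambda>f. \<chi> i. f i) \<in> ?P \<rightarrow>\<^sub>M borel"
    using vec_lambda_measurable by (simp cong: measurable_cong_sets sets_PiM_cong)
  have m2: "(\<lambda>v::complex^'k. \<chi> i. \<omega> i * v $ i) \<in> borel \<rightarrow>\<^sub>M borel"
    by (intro borel_measurable_continuous_onI continuous_intros)
  have "distr lborel borel (\<lambda>v::complex^'k. \<chi> i. \<omega> i * v $ i) = distr ?P borel (\<lambda>f. \<chi> i. \<omega> i * f i)"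
    unfolding lborel_vec by (subst distr_distr[OF m2 m]) (simp add: o_def)
  also have "\<dots> = distr (distr ?P ?P (\<lambda>f. \<lambda>i\<in>UNIV. \<omega> i * f i)) borel (\<lambda>f. \<chi> i. f i)"
    by (subst distr_distr[OF m mR]) (simp add: o_def restrict_UNIV)
  also have "\<dots> = lborel" unfolding P lborel_vec ..
  finally show ?thesis .
qed

text \<open>The set |z|^2 \<le> a is a disc of area pi a, so the two measures agree on half-lines,
  which generate the Borel sets. This replaces polar coordinates.\<close>

lemma distr_cmod_sq:
  "distr lborel borel (\<lambda>z::complex. (cmod z)\<^sup>2) = density lborel (\<lambda>x. ennreal pi * indicator {0..} x)"
proof (rule measure_eqI_generator_eq[where E = "range atMost" and \<Omega> = UNIV and A = "\<lambda>i. {..real i}"])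
  show "Int_stable (range (atMost :: real \<Rightarrow> _))" by (auto simp: Int_stable_def)
  have em: "emeasure (distr lborel borel (\<lambda>z::complex. (cmod z)\<^sup>2)) {..a} = (if a < 0 then 0 else ennreal (pi * a))" for a
  proof -
    have "(\<lambda>z::complex. (cmod z)\<^sup>2) -` {..a} = (if a < 0 then {} else cball 0 (sqrt a))"
      by (auto simp: real_le_rsqrt) (smt (verit) zero_le_power2, metis norm_ge_zero real_sqrt_le_iff real_sqrt_pow2_iff real_sqrt_power)
    then show ?thesis
      by (subst emeasure_distr) (auto simp: emeasure_cball unit_ball_vol_2)
  qed
  show "emeasure (distr lborel borel (\<lambda>z::complex. (cmod z)\<^sup>2)) X = emeasure (density lborel (\<lambda>x. ennreal pi * indicator {0..} x)) X"
    if X: "X \<in> range atMost" for X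
  proof -
    obtain a where a: "X = {..a}" using X by auto
    have "emeasure (density lborel (\<lambda>x. ennreal pi * indicator {0..} x)) X = (\<integral>\<^sup>+x. ennreal pi * indicator {0..a} x \<partial>lborel)"
      unfolding a by (subst emeasure_density) (auto intro!: nn_integral_cong simp: indicator_def)
    also have "\<dots> = (if a < 0 then 0 else ennreal (pi * a))"
      by (subst nn_integral_cmult) (auto simp: ennreal_mult)
    finally show ?thesis by (simp add: a em)
  qed
  show "emeasure (distr lborel borel (\<lambda>z::complex. (cmod z)\<^sup>2)) {..real i} \<noteq> \<infinity>" for i
    by (simp add: em)
  show "(\<Union>i. {..real i}) = UNIV" by (auto intro: real_arch_simple)
qed (auto simp: borel_eq_atMost)

definition join_vec :: "'a^'n::finite \<Rightarrow> 'a^'m::finite \<Rightarrow> 'a^('n + 'm)" where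
  "join_vec z w = (\<chi> i. case i of Inl j \<Rightarrow> z $ j | Inr k \<Rightarrow> w $ k)"

lemma join_vec_nth [simp]: "join_vec z w $ Inl j = z $ j" "join_vec z w $ Inr k = w $ k"
  by (simp_all add: join_vec_def)

lemma prod_UNIV_sum:
  "(\<Prod>i\<in>(UNIV::('n::finite + 'm::finite) set). g i) = (\<Prod>j\<in>UNIV. g (Inl j)) * (\<Prod>k\<in>UNIV. g (Inr k))"
  by (subst UNIV_sum, subst prod.union_disjoint) (auto simp: prod.reindex)

lemma join_vec_measurable [measurable]:
  "(\<lambda>p. join_vec (fst p) (snd p) :: 'a::euclidean_space^('n::finite + 'm::finite)) \<in> borel_measurable (borel \<Otimes>\<^sub>M borel)"
  unfolding borel_prod join_vec_def
proof (intro borel_measurable_continuous_onI continuous_intros)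
  show "continuous_on UNIV (\<lambda>p::('a^'n) \<times> ('a^'m). case i of Inl j \<Rightarrow> fst p $ j | Inr k \<Rightarrow> snd p $ k)" for i
    by (cases i) (auto intro!: continuous_intros)
qed

lemma lborel_join:
  "(lborel :: ('a::euclidean_space^('n::finite + 'm::finite)) measure) = distr (lborel \<Otimes>\<^sub>M lborel) borel (\<lambda>p. join_vec (fst p) (snd p))"
proof (rule lborel_eqI)
  fix l u :: "'a^('n + 'm)" assume le: "\<And>b. b \<in> Basis \<Longrightarrow> l \<bullet> b \<le> u \<bullet> b"
  have le': "l $ i \<bullet> b \<le> u $ i \<bullet> b" if "b \<in> Basis" for i b
    using le[of "axis i b"] that by (auto simp: Basis_vec_def inner_axis)
  let ?L = "\<lambda>v::'a^('n + 'm). \<chi> j. v $ Inl j" and ?R = "\<lambda>v::'a^('n + 'm). \<chi> j. v $ Inr j"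
  have pre: "(\<lambda>p. join_vec (fst p) (snd p)) -` box l u \<inter> space (lborel \<Otimes>\<^sub>M lborel) = box (?L l) (?L u) \<times> box (?R l) (?R u)"
    by (auto simp: space_pair_measure mem_box Basis_vec_def inner_axis) (metis join_vec_nth old.sum.exhaust)+
  have m: "(\<lambda>p. join_vec (fst p) (snd p) :: 'a^('n + 'm)) \<in> lborel \<Otimes>\<^sub>M lborel \<rightarrow>\<^sub>M borel" by measurable
  have "emeasure (distr (lborel \<Otimes>\<^sub>M lborel) borel (\<lambda>p. join_vec (fst p) (snd p))) (box l u)
      = emeasure (lborel \<Otimes>\<^sub>M lborel) (box (?L l) (?L u) \<times> box (?R l) (?R u))"
    by (subst emeasure_distr[OF m]) (auto simp: pre)
  also have "\<dots> = emeasure lborel (box (?L l) (?L u)) * emeasure lborel (box (?R l) (?R u))"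
    by (rule lborel.emeasure_pair_measure_Times) auto
  also have "\<dots> = ennreal (\<Prod>b\<in>Basis. (?L u - ?L l) \<bullet> b) * ennreal (\<Prod>b\<in>Basis. (?R u - ?R l) \<bullet> b)"
    by (intro arg_cong2[where f = "(*)"] emeasure_lborel_box) (auto simp: Basis_vec_def inner_axis le')
  also have "\<dots> = ennreal ((\<Prod>b\<in>Basis. (?L u - ?L l) \<bullet> b) * (\<Prod>b\<in>Basis. (?R u - ?R l) \<bullet> b))"
    by (intro ennreal_mult[symmetric] prod_nonneg) (auto simp: Basis_vec_def inner_axis inner_diff_left le')
  also have "(\<Prod>b\<in>Basis. (?L u - ?L l) \<bullet> b) * (\<Prod>b\<in>Basis. (?R u - ?R l) \<bullet> b) = (\<Prod>b\<in>Basis. (u - l) \<bullet> b)"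
    by (simp add: prod_Basis_vec inner_axis prod_UNIV_sum)
  finally show "emeasure (distr (lborel \<Otimes>\<^sub>M lborel) borel (\<lambda>p. join_vec (fst p) (snd p))) (box l u) = ennreal (\<Prod>b\<in>Basis. (u - l) \<bullet> b)" .
qed simp

lemma nn_integral_join:
  fixes f :: "'a::euclidean_space^('n::finite + 'm::finite) \<Rightarrow> ennreal"
  assumes [measurable]: "f \<in> borel_measurable borel"
  shows "(\<integral>\<^sup>+v. f v \<partial>lborel) = (\<integral>\<^sup>+z. \<integral>\<^sup>+w. f (join_vec z w) \<partial>lborel \<partial>lborel)"
proof -
  have "(\<integral>\<^sup>+v. f v \<partial>lborel) = (\<integral>\<^sup>+p. f (join_vec (fst p) (snd p)) \<partial>(lborel \<Otimes>\<^sub>M lborel))"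
    by (subst lborel_join, subst nn_integral_distr) auto
  then show ?thesis by (subst (asm) lborel.nn_integral_fst[symmetric]) auto
qed

section \<open>Power series on complete Reinhardt domains\<close>

definition mon :: "('k::finite \<Rightarrow> nat) \<Rightarrow> complex^'k \<Rightarrow> complex" where
  "mon a Y = (\<Prod>j\<in>UNIV. (Y $ j) ^ a j)"

text \<open>Completeness is built in: moduli may shrink as well as rotate, so each point brings
  along the whole closed polydisc that it spans around 0.\<close>

definition reinhardt :: "(complex^'k::finite) set \<Rightarrow> bool" where
  "reinhardt D \<longleftrightarrow> (\<forall>Y\<in>D. \<forall>X. (\<forall>i. cmod (X $ i) \<le> cmod (Y $ i)) \<longrightarrow> X \<in> D)"

lemma norm_mon: "cmod (mon a Y) = (\<Prod>j\<in>UNIV. cmod (Y $ j) ^ a j)"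
  by (simp add: mon_def norm_power flip: prod_norm)

lemma continuous_mon [continuous_intros]: "continuous_on S (mon a)"
  unfolding mon_def by (intro continuous_intros)

lemma mon_measurable [measurable]: "mon a \<in> borel_measurable borel"
  by (intro borel_measurable_continuous_onI continuous_intros)

text \<open>The point whose coordinates are the moduli of Y lies in D, and openness allows all of
  them to grow by the same amount. Hence Y is interior to a polydisc whose corner still lies in D;
  this margin yields geometric convergence throughout.\<close>

lemma reinhardt_enlarge:
  assumes "open D" "reinhardt D" "Y \<in> D"
  obtains e where "e > 0" "(\<chi> i. complex_of_real (cmod (Y $ i) + e)) \<in> D"
proof -
  define X where "X = (\<lambda>e. \<chi> i. complex_of_real (cmod (Y $ i) + e))"
  have "X 0 \<in> D" using assms(2,3) unfolding reinhardt_def X_def by force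
  moreover have "continuous_on UNIV X" unfolding X_def by (intro continuous_intros)
  ultimately have "open (X -` D)" "0 \<in> X -` D"
    using assms(1) continuous_open_preimage[of UNIV X D] by auto
  then obtain e where "e > 0" "ball 0 e \<subseteq> X -` D" using open_contains_ball by blast
  then have "X (e/2) \<in> D" by (auto simp: subset_iff)
  then show thesis using that[of "e/2"] \<open>e > 0\<close> by (auto simp: X_def)
qed

lemma holo_on_continuous: "holo_on D f \<Longrightarrow> continuous_on D f"
  unfolding holo_on_def
  by (meson continuous_at_imp_continuous_on has_derivative_continuous)

lemma holo_on_coordinate:
  assumes f: "holo_on D f" and t: "(\<chi> i. (t(j := s)) i) \<in> D"
  shows "(\<lambda>s. f (\<chi> i. (t(j := s)) i)) field_differentiable (at s)"
proof -
  obtain L where L: "(f has_derivative L) (at (\<chi> i. (t(j := s)) i))" "\<forall>c v. L (c *s v) = c * L v"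
    using bspec[OF f[unfolded holo_on_def] t] by (elim exE conjE)
  have "((\<lambda>s. \<chi> i. (t(j := s)) i) has_derivative (\<lambda>h. axis j h)) (at s)"
  proof -
    have "linear (axis j :: complex \<Rightarrow> complex^'a)"
      by (simp add: linear_iff vec_eq_iff axis_def)
    then have "(axis j has_derivative axis j) (at s)"
      by (intro bounded_linear_imp_has_derivative) (simp add: linear_conv_bounded_linear)
    then have "((\<lambda>s. (\<chi> i. (t(j := 0)) i) + axis j s) has_derivative (\<lambda>h. 0 + axis j h)) (at s)"
      by (intro has_derivative_add has_derivative_const)
    moreover have "(\<lambda>s. \<chi> i. (t(j := s)) i) = (\<lambda>s. (\<chi> i. (t(j := 0)) i) + axis j s)"
      by (rule ext) (simp add: vec_eq_iff axis_def)
    ultimately show ?thesis by simp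
  qed
  from has_derivative_compose[OF this L(1)]
  have 1: "((\<lambda>s. f (\<chi> i. (t(j := s)) i)) has_derivative (\<lambda>h. L (axis j h))) (at s)" .
  have 2: "(\<lambda>h. L (axis j h)) = (\<lambda>h. L (axis j 1) * h)"
  proof
    fix h :: complex
    have "axis j h = h *s axis j 1" by (simp add: axis_def vec_eq_iff)
    then show "L (axis j h) = L (axis j 1) * h" using L(2)[rule_format, of h "axis j 1"] by (metis mult.commute)
  qed
  have "((\<lambda>s. f (\<chi> i. (t(j := s)) i)) has_derivative (\<lambda>h. L (axis j 1) * h)) (at s)"
    by (rule back_subst[of "\<lambda>g. (_ has_derivative g) _", OF 1 2])
  then show ?thesis unfolding field_differentiable_def has_field_derivative_def by (rule exI)
qed

text \<open>Around each Y a slightly larger closed polydisc lies in D, and f is bounded on it by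
  compactness. The resulting bound and polyradius vary with Y, but the coefficients do not, so one
  series represents f on all of D.\<close>

lemma holo_on_power_series:
  fixes D :: "(complex^'k::finite) set"
  assumes D: "open D" "reinhardt D" and f: "holo_on D f"
  obtains c :: "('k \<Rightarrow> nat) \<Rightarrow> complex" where
    "\<And>Y. Y \<in> D \<Longrightarrow> ((\<lambda>a. c a * mon a Y) has_sum f Y) UNIV"
    "\<And>Y. Y \<in> D \<Longrightarrow> (\<lambda>a. c a * mon a Y) abs_summable_on UNIV"
proof -
  define g where "g = (\<lambda>t. f (\<chi> i. t i))"
  obtain c :: "('k \<Rightarrow> nat) \<Rightarrow> complex" where c: 
    "\<And>r M t. sep_holomorphic r M g \<Longrightarrow> t \<in> polydisc r \<Longrightarrow>
       ((\<lambda>a. c a * (\<Prod>j\<in>UNIV. t j ^ a j)) has_sum g t) UNIV \<and>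
       (\<lambda>a. c a * (\<Prod>j\<in>UNIV. t j ^ a j)) abs_summable_on UNIV"
    by (rule power_series_expansion[where f = g]) blast
  have "((\<lambda>a. c a * mon a Y) has_sum f Y) UNIV \<and> (\<lambda>a. c a * mon a Y) abs_summable_on UNIV" if Y: "Y \<in> D" for Y
  proof -
    obtain e where e: "e > 0" "(\<chi> i. complex_of_real (cmod (Y $ i) + e)) \<in> D"
      using reinhardt_enlarge[OF D Y] .
    define r where "r = (\<lambda>i. cmod (Y $ i) + e)"
    define K where "K = {v :: complex^'k. \<forall>i. cmod (v $ i) \<le> r i}"
    have KD: "K \<subseteq> D"
    proof
      fix v assume "v \<in> K"
      then have "\<forall>i. cmod (v $ i) \<le> cmod ((\<chi> i. complex_of_real (cmod (Y $ i) + e)) $ i)"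
        using e(1) by (auto simp: K_def r_def simp del: of_real_add)
      then show "v \<in> D" using D(2) e(2) unfolding reinhardt_def by blast
    qed
    have "closed K" unfolding K_def
      by (intro closed_Collect_all closed_Collect_le continuous_intros)
    moreover have "bounded K"
    proof (rule boundedI)
      fix v assume "v \<in> K"
      have "norm v \<le> (\<Sum>i\<in>UNIV. norm (v $ i))" unfolding norm_vec_def by (rule L2_set_le_sum) auto
      also have "\<dots> \<le> (\<Sum>i\<in>UNIV. r i)" using \<open>v \<in> K\<close> by (intro sum_mono) (auto simp: K_def)
      finally show "norm v \<le> (\<Sum>i\<in>UNIV. r i)" .
    qed
    ultimately have "compact K" by (simp add: compact_eq_bounded_closed)
    then have "compact (f ` K)"
      using holo_on_continuous[OF f] KD by (intro compact_continuous_image) (auto intro: continuous_on_subset)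
    then obtain M where M: "\<And>v. v \<in> K \<Longrightarrow> cmod (f v) \<le> M"
      by (meson bounded_iff compact_imp_bounded imageI)
    have pK: "(\<chi> i. t i) \<in> K" if "t \<in> polydisc r" for t
      using that by (auto simp: polydisc_def K_def less_imp_le)
    have "sep_holomorphic r M g"
      unfolding sep_holomorphic_def
    proof (intro ballI conjI allI)
      fix t assume t: "t \<in> polydisc r"
      show "cmod (g t) \<le> M" unfolding g_def by (rule M[OF pK[OF t]])
      fix i
      show "(\<lambda>s. g (t(i := s))) holomorphic_on ball 0 (r i)"
        unfolding holomorphic_on_def g_def
      proof
        fix s :: complex assume "s \<in> ball 0 (r i)"
        then have "(\<chi> j. (t(i := s)) j) \<in> D" using KD pK[OF polydisc_upd[OF t]] by blast
        from holo_on_coordinate[OF f this]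
        show "(\<lambda>s. f (\<chi> j. (t(i := s)) j)) field_differentiable (at s within ball 0 (r i))"
          by (rule field_differentiable_at_within)
      qed
    qed
    from c[OF this, of "\<lambda>i. Y $ i"] show ?thesis
      using e(1) by (simp add: g_def mon_def polydisc_def r_def)
  qed
  then show thesis using that by blast
qed

section \<open>Termwise differentiation of power series\<close>

text \<open>The differential of a monomial by the product rule. For \<open>a j = 0\<close> the
  truncated exponent \<open>a j - 1\<close> is 0, but the factor \<open>of_nat (a j)\<close> removes
  that summand.\<close>

definition mon_deriv :: "('k::finite \<Rightarrow> nat) \<Rightarrow> complex^'k \<Rightarrow> complex^'k \<Rightarrow> complex" where
  "mon_deriv a x h = (\<Sum>j\<in>UNIV. (of_nat (a j) * (x $ j) ^ (a j - 1) * h $ j) * (\<Prod>i\<in>UNIV - {j}. (x $ i) ^ a i))"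

lemma has_derivative_mon: "(mon a has_derivative mon_deriv a x) (at x within S)"
proof -
  have 1: "((\<lambda>x. (x $ j) ^ a j) has_derivative (\<lambda>h. of_nat (a j) * (x $ j) ^ (a j - 1) * h $ j)) (at x within S)" for j
  proof -
    have "((\<lambda>x. x $ j) has_derivative (\<lambda>h. h $ j)) (at x within S)"
      by (intro bounded_linear_imp_has_derivative bounded_linear_vec_nth)
    then show ?thesis by (auto intro!: derivative_eq_intros simp: fun_eq_iff)
  qed
  show ?thesis
    unfolding mon_def[abs_def] mon_deriv_def[abs_def] by (rule has_derivative_prod[OF 1])
qed

text \<open>The product of the left side with e is one term of the binomial expansion of (r + e)^n.
  It trades a derivative for a slightly larger radius.\<close>

lemma mult_power_pred_le:
  fixes r e :: real
  assumes "r \<ge> 0" "e > 0"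
  shows "of_nat n * r ^ (n - 1) \<le> (r + e) ^ n / e"
proof (cases n)
  case (Suc k)
  have "of_nat n * r ^ (n - 1) * e \<le> (r + e) ^ n"
    unfolding Suc
  proof (induction k)
    case (Suc k)
    have "of_nat (Suc (Suc k)) * r ^ (Suc (Suc k) - 1) * e = r * (of_nat (Suc k) * r ^ (Suc k - 1) * e) + e * r ^ Suc k"
      by (simp add: algebra_simps)
    also have "\<dots> \<le> r * (r + e) ^ Suc k + e * (r + e) ^ Suc k"
      using Suc assms by (intro add_mono mult_left_mono power_mono) auto
    also have "\<dots> = (r + e) ^ Suc (Suc k)" by (simp add: algebra_simps)
    finally show ?case .
  qed (use assms in auto)
  then show ?thesis using assms by (simp add: field_simps)
qed (use assms in auto)

lemma norm_mon_deriv_le: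
  fixes x :: "complex^'k::finite"
  assumes e: "e > 0" and r: "\<And>i. cmod (x $ i) \<le> r i"
  shows "cmod (mon_deriv a x h) \<le> real CARD('k) / e * (\<Prod>i\<in>UNIV. (r i + e) ^ a i) * norm h"
proof -
  have r0: "r i \<ge> 0" for i using r[of i] norm_ge_zero order_trans by blast
  have "cmod (mon_deriv a x h) \<le> (\<Sum>j\<in>(UNIV::'k set). 1 / e * (\<Prod>i\<in>UNIV. (r i + e) ^ a i) * norm h)"
    unfolding mon_deriv_def
  proof (rule order_trans[OF norm_sum], rule sum_mono)
    fix j
    have "cmod (of_nat (a j) * (x $ j) ^ (a j - 1) * h $ j * (\<Prod>i\<in>UNIV - {j}. (x $ i) ^ a i))
      = of_nat (a j) * cmod (x $ j) ^ (a j - 1) * cmod (h $ j) * (\<Prod>i\<in>UNIV - {j}. cmod (x $ i) ^ a i)"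
      by (simp add: norm_mult norm_power flip: prod_norm)
    also have "\<dots> \<le> ((r j + e) ^ a j / e) * norm h * (\<Prod>i\<in>UNIV - {j}. (r i + e) ^ a i)"
    proof (intro mult_mono prod_mono prod_nonneg conjI)
      have "of_nat (a j) * cmod (x $ j) ^ (a j - 1) \<le> of_nat (a j) * r j ^ (a j - 1)"
        by (intro mult_left_mono power_mono r) auto
      also have "\<dots> \<le> (r j + e) ^ a j / e" by (rule mult_power_pred_le[OF r0 e])
      finally show "of_nat (a j) * cmod (x $ j) ^ (a j - 1) \<le> (r j + e) ^ a j / e" .
      show "cmod (x $ i) ^ a i \<le> (r i + e) ^ a i" for i
        using r[of i] e by (intro power_mono) auto
    qed (use e r0 in \<open>auto simp: Finite_Cartesian_Product.norm_nth_le add_nonneg_nonneg less_imp_le\<close>)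
    also have "\<dots> = 1 / e * (\<Prod>i\<in>UNIV. (r i + e) ^ a i) * norm h"
      by (subst prod.remove[of UNIV j]) auto
    finally show "cmod (of_nat (a j) * (x $ j) ^ (a j - 1) * h $ j * (\<Prod>i\<in>UNIV - {j}. (x $ i) ^ a i)) \<le> 1 / e * (\<Prod>i\<in>UNIV. (r i + e) ^ a i) * norm h" .
  qed
  then show ?thesis by simp
qed

lemma mon_deriv_scale: "mon_deriv a x (s *s h) = s * mon_deriv a x h"
  by (simp add: mon_deriv_def sum_distrib_left mult_ac)

text \<open>Near Y the differentials of the terms are dominated by the moduli of the terms at a
  single enlarged point of D, where the series converges absolutely. The series can therefore be
  differentiated term by term, and complex homogeneity passes to the limit.\<close>

lemma power_series_holo_on:
  fixes D :: "(complex^'k::finite) set" and E :: "nat \<Rightarrow> 'k \<Rightarrow> nat"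
  assumes D: "open D" "reinhardt D"
    and sm: "\<And>Y. Y \<in> D \<Longrightarrow> summable (\<lambda>n. norm (c n * mon (E n) Y))"
  shows "holo_on D (\<lambda>Y. \<Sum>n. c n * mon (E n) Y)"
  unfolding holo_on_def
proof
  fix Y assume Y: "Y \<in> D"
  obtain e' where e': "e' > 0" "(\<chi> i. complex_of_real (cmod (Y $ i) + e')) \<in> D"
    using reinhardt_enlarge[OF D Y] .
  \<comment> \<open>One half of the margin absorbs the motion of the point inside the ball, the
    other half the loss of radius in bounding the derivative.\<close>
  define e where "e = e' / 2"
  have e: "e > 0" using e' by (simp add: e_def)
  have *: "(\<chi> i. complex_of_real ((cmod (Y $ i) + e) + e)) \<in> D"
  proof -
    have "(cmod (Y $ i) + e) + e = cmod (Y $ i) + e'" for i by (simp add: e_def)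
    then show ?thesis using e'(2) by (simp only:)
  qed
  define B where "B = (\<lambda>n. cmod (c n) * (real CARD('k) / e * (\<Prod>i\<in>UNIV. ((cmod (Y $ i) + e) + e) ^ E n i)))"
  have B: "summable B"
  proof -
    have "summable (\<lambda>n. real CARD('k) / e * norm (c n * mon (E n) (\<chi> i. complex_of_real ((cmod (Y $ i) + e) + e))))"
      by (intro summable_mult sm *)
    moreover have "cmod (complex_of_real (cmod (Y $ i) + e + e)) = cmod (Y $ i) + e + e" for i
      unfolding norm_of_real using e by simp
    ultimately show ?thesis by (simp add: B_def norm_mult norm_mon mult_ac del: of_real_add)
  qed
  define S where "S = ball Y e"
  have dB: "cmod (c n * mon_deriv (E n) x h) \<le> B n * norm h" if "x \<in> S" for x h n
  proof -
    have "cmod (x $ i) \<le> cmod (Y $ i) + e" for i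
    proof -
      have "cmod (x $ i - Y $ i) \<le> norm (x - Y)" using Finite_Cartesian_Product.norm_nth_le[of "x - Y" i] by simp
      also have "\<dots> < e" using that by (simp add: S_def dist_norm norm_minus_commute)
      finally show ?thesis using norm_triangle_sub[of "x $ i" "Y $ i"] by linarith
    qed
    from norm_mon_deriv_le[OF e this, of "E n" h] show ?thesis
      unfolding norm_mult B_def by (subst mult.assoc) (rule mult_left_mono[OF _ norm_ge_zero])
  qed
  have ds: "summable (\<lambda>n. norm (c n * mon_deriv (E n) x h))" if "x \<in> S" for x h
    by (rule summable_comparison_test'[OF summable_mult2[OF B, of "norm h"]]) (use dB[OF that] in auto)
  define g' where "g' = (\<lambda>x h. \<Sum>n. c n * mon_deriv (E n) x h)"
  have "\<exists>g. \<forall>x\<in>S. (\<lambda>n. c n * mon (E n) x) sums g x \<and> (g has_derivative g' x) (at x within S)"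
  proof (rule has_derivative_series)
    show "convex S" by (simp add: S_def)
    show "((\<lambda>x. c n * mon (E n) x) has_derivative (\<lambda>h. c n * mon_deriv (E n) x h)) (at x within S)" for n x
      by (intro has_derivative_mult_right has_derivative_mon)
    show "Y \<in> S" using e by (simp add: S_def)
    show "(\<lambda>n. c n * mon (E n) Y) sums (\<Sum>n. c n * mon (E n) Y)"
      by (rule summable_sums[OF summable_norm_cancel[OF sm[OF Y]]])
    fix \<epsilon> :: real assume "\<epsilon> > 0"
    then obtain N where N: "\<And>n. n \<ge> N \<Longrightarrow> norm (\<Sum>i. B (i + n)) < \<epsilon>"
      using suminf_exist_split[OF _ B] by blast
    show "\<forall>\<^sub>F n in sequentially. \<forall>x\<in>S. \<forall>h. norm ((\<Sum>i<n. c i * mon_deriv (E i) x h) - g' x h) \<le> \<epsilon> * norm h"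
      using eventually_ge_at_top[of N]
    proof eventually_elim
      case (elim n)
      show ?case
      proof (intro ballI allI)
        fix x h assume x: "x \<in> S"
        have "g' x h = (\<Sum>i. c (i + n) * mon_deriv (E (i + n)) x h) + (\<Sum>i<n. c i * mon_deriv (E i) x h)"
          unfolding g'_def by (rule suminf_split_initial_segment[OF summable_norm_cancel[OF ds[OF x]]])
        then have "norm ((\<Sum>i<n. c i * mon_deriv (E i) x h) - g' x h) = norm (\<Sum>i. c (i + n) * mon_deriv (E (i + n)) x h)"
          by simp
        also have "\<dots> \<le> (\<Sum>i. B (i + n) * norm h)"
          by (rule norm_suminf_le[OF dB[OF x]]) (intro summable_mult2 summable_ignore_initial_segment B)
        also have "\<dots> = (\<Sum>i. B (i + n)) * norm h"
          by (rule suminf_mult2[symmetric]) (intro summable_ignore_initial_segment B)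
        also have "\<dots> \<le> \<epsilon> * norm h"
          using N[OF elim] by (intro mult_right_mono) auto
        finally show "norm ((\<Sum>i<n. c i * mon_deriv (E i) x h) - g' x h) \<le> \<epsilon> * norm h" .
      qed
    qed
  qed
  then obtain g where g: "\<And>x. x \<in> S \<Longrightarrow> (\<lambda>n. c n * mon (E n) x) sums g x"
    "\<And>x. x \<in> S \<Longrightarrow> (g has_derivative g' x) (at x within S)" by blast
  have YS: "Y \<in> S" "open S" using e by (auto simp: S_def)
  have "((\<lambda>Y. \<Sum>n. c n * mon (E n) Y) has_derivative g' Y) (at Y)"
  proof (rule has_derivative_transform_within_open[OF _ YS(2,1)])
    show "(g has_derivative g' Y) (at Y)" using g(2)[OF YS(1)] at_within_open[OF YS] by simp
    show "g x = (\<Sum>n. c n * mon (E n) x)" if "x \<in> S" for x using g(1)[OF that] by (simp add: sums_iff)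
  qed
  moreover have "g' Y (s *s v) = s * g' Y v" for s v
    unfolding g'_def mon_deriv_scale
    by (subst suminf_mult[symmetric]) (auto intro!: summable_norm_cancel[OF ds[OF YS(1)]] simp: mult_ac)
  ultimately show "\<exists>L. ((\<lambda>Y. \<Sum>n. c n * mon (E n) Y) has_derivative L) (at Y) \<and> (\<forall>c v. L (c *s v) = c * L v)"
    by blast
qed

section \<open>Weighted Bergman kernels of Reinhardt domains\<close>

text \<open>Invariance under independent rotations of the coordinates is exactly what makes distinct
  monomials orthogonal over a subset of D.\<close>

definition torus_invariant :: "(complex^'k::finite) set \<Rightarrow> bool" where
  "torus_invariant S \<longleftrightarrow> (\<forall>X Y. (\<forall>i. cmod (X $ i) = cmod (Y $ i)) \<longrightarrow> X \<in> S \<longrightarrow> Y \<in> S)"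

lemma reinhardt_torus_invariant: "reinhardt D \<Longrightarrow> torus_invariant D"
  unfolding reinhardt_def torus_invariant_def by (metis order_refl)

lemma measurable_indicator_mult_continuous:
  fixes g :: "complex^'k::finite \<Rightarrow> complex"
  assumes "open D" "continuous_on D g"
  shows "(\<lambda>Y. indicator D Y *\<^sub>R g Y) \<in> borel_measurable borel"
  using assms by (intro borel_measurable_continuous_on_indicator) auto

lemma cnj_measurable [measurable]: "cnj \<in> borel_measurable borel"
  by (intro borel_measurable_continuous_onI continuous_intros)

text \<open>Since \<open>ennreal (N a)\<close> is a finite value, the last assumption includes that
  every monomial is square integrable; positivity of \<open>N a\<close> is derived below.\<close>

locale reinhardt_weight =
  fixes D :: "(complex^'k::finite) set" and \<alpha> :: real and F :: "complex^'k \<Rightarrow> real"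
    and N :: "('k \<Rightarrow> nat) \<Rightarrow> real"
  assumes open_D: "open D" and reinhardt_D: "reinhardt D" and D_nonempty: "D \<noteq> {}"
    and wt_measurable [measurable]: "(\<lambda>Y. indicator D Y * wt \<alpha> F Y) \<in> borel_measurable borel"
    and wt_pos: "Y \<in> D \<Longrightarrow> wt \<alpha> F Y > 0"
    and wt_radial: "X \<in> D \<Longrightarrow> Y \<in> D \<Longrightarrow> (\<And>i. cmod (X $ i) = cmod (Y $ i)) \<Longrightarrow> wt \<alpha> F X = wt \<alpha> F Y"
    and N: "(\<integral>\<^sup>+Y. indicator D Y * ennreal (wt \<alpha> F Y * (cmod (mon a Y))\<^sup>2) \<partial>lborel) = ennreal (N a)"
begin

section \<open>The weighted measure and the growth of the monomial norms\<close>

text \<open>The cutoff to D sits in the density, so that norms and pairings become ordinary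
  integrals over the whole space. The norm of the constant monomial shows that the total mass is
  finite.\<close>

definition M :: "(complex^'k) measure" where
  "M = density lborel (\<lambda>Y. ennreal (indicator D Y * wt \<alpha> F Y))"

lemma D_borel [measurable]: "D \<in> sets borel"
  using open_D by simp

lemma sets_M [measurable_cong, simp]: "sets M = sets borel" and space_M [simp]: "space M = UNIV"
  by (simp_all add: M_def)

lemma wt_nonneg: "indicator D Y * wt \<alpha> F Y \<ge> 0"
  using wt_pos[of Y] by (auto simp: indicator_def less_imp_le)

lemma nn_integral_M:
  assumes [measurable]: "f \<in> borel_measurable borel"
  shows "(\<integral>\<^sup>+Y. f Y \<partial>M) = (\<integral>\<^sup>+Y. indicator D Y * ennreal (wt \<alpha> F Y) * f Y \<partial>lborel)"
  unfolding M_def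
proof (subst nn_integral_density)
  show "(\<lambda>Y. ennreal (indicator D Y * wt \<alpha> F Y)) \<in> borel_measurable lborel" by measurable
qed (auto intro!: nn_integral_cong simp: indicator_def)

lemma AE_M_D: "AE Y in M. Y \<in> D"
proof -
  have "AE Y in lborel. 0 < ennreal (indicator D Y * wt \<alpha> F Y) \<longrightarrow> Y \<in> D"
    by (auto simp: indicator_def)
  then show ?thesis unfolding M_def by (subst AE_density) auto
qed

lemma nn_integral_mon: "(\<integral>\<^sup>+Y. ennreal ((cmod (mon a Y))\<^sup>2) \<partial>M) = ennreal (N a)"
proof -
  have "indicator D Y * ennreal (wt \<alpha> F Y) * ennreal ((cmod (mon a Y))\<^sup>2) = indicator D Y * ennreal (wt \<alpha> F Y * (cmod (mon a Y))\<^sup>2)" for Y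
    using wt_pos[of Y] by (auto simp: indicator_def ennreal_mult')
  then show ?thesis using N[of a] by (subst nn_integral_M) auto
qed

lemma finite_M: "finite_measure M"
proof
  have "emeasure M (space M) = ennreal (N (\<lambda>_. 0))"
    using nn_integral_mon[of "\<lambda>_. 0"] by (simp add: mon_def)
  then show "emeasure M (space M) \<noteq> \<infinity>" by simp
qed

text \<open>The weight is positive on D and a nonempty open set is not Lebesgue negligible.\<close>

lemma emeasure_M_pos:
  assumes S: "open S" "S \<inter> D \<noteq> {}"
  shows "emeasure M S > 0"
proof (rule ccontr)
  have [measurable]: "S \<in> sets borel" using S by simp
  assume "\<not> emeasure M S > 0"
  then have "emeasure M S = 0" by (simp add: not_gr_zero)
  then have "(\<integral>\<^sup>+Y. ennreal (indicator D Y * wt \<alpha> F Y) * indicator S Y \<partial>lborel) = 0"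
    by (simp add: M_def emeasure_density)
  then have "AE Y in lborel. ennreal (indicator D Y * wt \<alpha> F Y) * indicator S Y = 0"
    by (subst (asm) nn_integral_0_iff_AE) auto
  then have "AE Y in lborel. Y \<notin> S \<inter> D"
    by eventually_elim (use wt_pos in \<open>fastforce simp: indicator_def split: if_splits\<close>)
  then have "S \<inter> D \<in> null_sets lborel"
    using AE_iff_null_sets[of "S \<inter> D" lborel] S open_D by auto
  then have "negligible (S \<inter> D)"
    by (simp add: negligible_iff_null_sets null_sets_completionI)
  then show False using open_not_negligible[of "S \<inter> D"] S open_D by auto
qed

text \<open>Take r_i = |Z_i| + e/2. The open set where every modulus exceeds r_i meets D, hence has
  positive mass m, and there |Y^a| is at least r^a. The gap between |Z_i| and r_i is what makes the
  kernel series converge.\<close>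

lemma N_lower_bound:
  assumes Z: "Z \<in> D"
  obtains r m where "m > 0" "\<And>i. cmod (Z $ i) < r i" "\<And>a. (\<Prod>i\<in>UNIV. r i ^ a i)\<^sup>2 * m \<le> N a"
proof -
  obtain e where e: "e > 0" "(\<chi> i. complex_of_real (cmod (Z $ i) + e)) \<in> D"
    using reinhardt_enlarge[OF open_D reinhardt_D Z] .
  define r where "r = (\<lambda>i. cmod (Z $ i) + e / 2)"
  define S where "S = {Y :: complex^'k. \<forall>i. r i < cmod (Y $ i)}"
  have r0: "r i > 0" for i using e by (simp add: r_def add_nonneg_pos)
  have "S = (\<Inter>i. {Y. r i < cmod (Y $ i)})" by (auto simp: S_def)
  then have "open S" by (auto intro!: open_INT open_Collect_less continuous_intros)
  then have [measurable]: "S \<in> sets borel" by simp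
  have "(\<chi> i. complex_of_real (cmod (Z $ i) + e)) \<in> S"
  proof -
    have "cmod (complex_of_real (cmod (Z $ i) + e)) = cmod (Z $ i) + e" for i
      unfolding norm_of_real using e by simp
    then show ?thesis using e by (simp add: S_def r_def del: of_real_add)
  qed
  then have "emeasure M S > 0" using e \<open>open S\<close> by (intro emeasure_M_pos) auto
  interpret finite_measure M by (rule finite_M)
  have m: "measure M S > 0" using \<open>emeasure M S > 0\<close> by (simp add: emeasure_eq_measure)
  have "(\<Prod>i\<in>UNIV. r i ^ a i)\<^sup>2 * measure M S \<le> N a" for a
  proof -
    have p: "(\<Prod>i\<in>UNIV. r i ^ a i)\<^sup>2 * measure M S > 0"
      using m r0 by (intro mult_pos_pos zero_less_power prod_pos) auto
    have "ennreal ((\<Prod>i\<in>UNIV. r i ^ a i)\<^sup>2 * measure M S) = (\<integral>\<^sup>+Y. ennreal ((\<Prod>i\<in>UNIV. r i ^ a i)\<^sup>2) * indicator S Y \<partial>M)"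
      by (subst nn_integral_cmult_indicator) (auto simp: emeasure_eq_measure ennreal_mult)
    also have "\<dots> \<le> (\<integral>\<^sup>+Y. ennreal ((cmod (mon a Y))\<^sup>2) \<partial>M)"
    proof (rule nn_integral_mono)
      fix Y
      show "ennreal ((\<Prod>i\<in>UNIV. r i ^ a i)\<^sup>2) * indicator S Y \<le> ennreal ((cmod (mon a Y))\<^sup>2)"
      proof (cases "Y \<in> S")
        case True
        then have "(\<Prod>i\<in>UNIV. r i ^ a i) \<le> cmod (mon a Y)"
          unfolding norm_mon using r0 by (intro prod_mono) (auto simp: S_def less_imp_le intro!: power_mono)
        then show ?thesis using True r0
          by (auto intro!: ennreal_leI power_mono prod_nonneg simp: less_imp_le)
      qed simp
    qed
    finally have "ennreal ((\<Prod>i\<in>UNIV. r i ^ a i)\<^sup>2 * measure M S) \<le> ennreal (N a)" by (simp add: nn_integral_mon)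
    then show ?thesis using p by (meson ennreal_le_iff2 not_le)
  qed
  then show thesis using that[of "measure M S" r] m e by (auto simp: r_def)
qed

lemma N_pos: "N a > 0"
proof -
  obtain Z where "Z \<in> D" using D_nonempty by auto
  then obtain r m where rm: "m > 0" "\<And>i. cmod (Z $ i) < r i" "\<And>a. (\<Prod>i\<in>UNIV. r i ^ a i)\<^sup>2 * m \<le> N a"
    by (rule N_lower_bound) blast
  have "r i > 0" for i using rm(2)[of i] norm_ge_zero order_le_less_trans by blast
  then have "(\<Prod>i\<in>UNIV. r i ^ a i)\<^sup>2 * m > 0"
    using rm(1) by (intro mult_pos_pos zero_less_power prod_pos) auto
  then show ?thesis using rm(3)[of a] by linarith
qed

text \<open>By the lower bound on the norms, the terms are dominated by a product of geometric
  series with ratios (|Z_i| / r_i)^2, divided by m.\<close>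

lemma kernel_summable:
  assumes Z: "Z \<in> D"
  shows "(\<lambda>a. (cmod (mon a Z))\<^sup>2 / N a) summable_on UNIV"
proof -
  obtain r m where rm: "m > 0" "\<And>i. cmod (Z $ i) < r i" "\<And>a. (\<Prod>i\<in>UNIV. r i ^ a i)\<^sup>2 * m \<le> N a"
    using Z by (rule N_lower_bound) blast
  have r0: "r i > 0" for i using rm(2)[of i] norm_ge_zero order_le_less_trans by blast
  define x where "x = (\<lambda>i. (cmod (Z $ i) / r i)\<^sup>2)"
  have x: "0 \<le> x i \<and> x i < 1" for i
    using rm(2)[of i] r0[of i] by (auto simp: x_def power_less_one_iff)
  have "((\<lambda>a. \<Prod>j\<in>UNIV. x j ^ a j) has_sum (\<Prod>j\<in>UNIV. 1 / (1 - x j))) (PiE UNIV (\<lambda>_. UNIV))"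
    by (rule prod_power_has_sum) (use x in auto)
  then have "(\<lambda>a. \<Prod>j\<in>UNIV. x j ^ a j) summable_on UNIV"
    by (auto dest!: has_sum_imp_summable)
  from summable_on_cmult_left[OF this, of "inverse m"]
  have "(\<lambda>a. (\<Prod>j\<in>UNIV. x j ^ a j) / m) summable_on UNIV"
    by (simp add: divide_inverse)
  then show ?thesis
  proof (rule summable_on_comparison_test)
    fix a :: "'k \<Rightarrow> nat"
    have p: "(\<Prod>i\<in>UNIV. r i ^ a i)\<^sup>2 * m > 0"
      using rm(1) r0 by (intro mult_pos_pos zero_less_power prod_pos) auto
    have "(cmod (mon a Z))\<^sup>2 / N a \<le> (cmod (mon a Z))\<^sup>2 / ((\<Prod>i\<in>UNIV. r i ^ a i)\<^sup>2 * m)"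
      using rm(3)[of a] p by (intro divide_left_mono) (auto intro!: mult_pos_pos simp: N_pos)
    also have "\<dots> = (\<Prod>j\<in>UNIV. x j ^ a j) / m"
      by (simp add: norm_mon x_def power_divide prod_dividef power_mult[symmetric] prod_power_distrib mult.commute)
    finally show "(cmod (mon a Z))\<^sup>2 / N a \<le> (\<Prod>j\<in>UNIV. x j ^ a j) / m" .
  qed (auto simp: N_pos less_imp_le)
qed

lemma integrable_mon_sq: "integrable M (\<lambda>Y. (cmod (mon a Y))\<^sup>2)"
  and integral_mon_sq: "(\<integral>Y. (cmod (mon a Y))\<^sup>2 \<partial>M) = N a"
proof -
  show "integrable M (\<lambda>Y. (cmod (mon a Y))\<^sup>2)"
    by (rule integrableI_nn_integral_finite[where x = "N a"]) (auto simp: nn_integral_mon)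
  show "(\<integral>Y. (cmod (mon a Y))\<^sup>2 \<partial>M) = N a"
    by (subst integral_eq_nn_integral) (auto simp: nn_integral_mon N_pos less_imp_le)
qed

lemma integrable_mon_mult:
  assumes [measurable]: "S \<in> sets borel"
  shows "integrable M (\<lambda>Y. indicator S Y *\<^sub>R (mon a Y * cnj (mon b Y)))"
proof (rule Bochner_Integration.integrable_bound)
  show "integrable M (\<lambda>Y. (cmod (mon a Y))\<^sup>2 + (cmod (mon b Y))\<^sup>2)"
    by (intro Bochner_Integration.integrable_add integrable_mon_sq)
  have "x * y \<le> x\<^sup>2 + y\<^sup>2" if "x \<ge> 0" "y \<ge> 0" for x y :: real
    using sum_squares_bound[of x y] that mult_nonneg_nonneg[OF that] by linarith
  then show "AE Y in M. cmod (indicator S Y *\<^sub>R (mon a Y * cnj (mon b Y))) \<le> norm ((cmod (mon a Y))\<^sup>2 + (cmod (mon b Y))\<^sup>2)"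
    by (auto simp: indicator_def norm_mult)
qed measurable

text \<open>Rotating a coordinate in which the exponents differ preserves S, the weight and Lebesgue
  measure, but multiplies the integrand by a constant \<kappa> different from 1. The integral equals
  \<kappa> times itself and so vanishes.\<close>

lemma integral_mon_orthogonal:
  assumes [measurable]: "S \<in> sets borel" and S: "S \<subseteq> D" "torus_invariant S" and "a \<noteq> b"
  shows "(\<integral>Y. indicator S Y *\<^sub>R (mon a Y * cnj (mon b Y)) \<partial>M) = 0"
proof -
  obtain j where j: "a j \<noteq> b j" using \<open>a \<noteq> b\<close> by auto
  define k where "k = \<bar>real (a j) - real (b j)\<bar>"
  have k: "k \<ge> 1" using j by (auto simp: k_def)
  \<comment> \<open>This angle makes \<kappa> equal to i or -i, and it is at most pi/2, so that the
    real part of the rotation factor is nonnegative, as the three-shear argument demands of a factor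
    other than -1.\<close>
  define \<theta> where "\<theta> = pi / (2 * k)"
  have \<theta>: "0 < \<theta>" "\<theta> \<le> pi / 2" using k by (auto simp: \<theta>_def field_simps)
  define \<omega> where "\<omega> = (\<lambda>i::'k. if i = j then cis \<theta> else 1)"
  have cos: "cos \<theta> \<ge> 0" using \<theta> by (intro cos_ge_zero) auto
  have om: "cmod (\<omega> i) = 1" "Re (\<omega> i) \<noteq> -1" for i using cos by (auto simp: \<omega>_def)
  define R where "R = (\<lambda>v::complex^'k. \<chi> i. \<omega> i * v $ i)"
  have [measurable]: "R \<in> borel_measurable borel"
    unfolding R_def by (intro borel_measurable_continuous_onI continuous_intros)
  have R: "distr lborel borel R = lborel" unfolding R_def by (rule lborel_rotate[OF om])
  have nR: "cmod (R Y $ i) = cmod (Y $ i)" for Y i by (simp add: R_def norm_mult om)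
  have RS: "R Y \<in> T \<longleftrightarrow> Y \<in> T" if "torus_invariant T" for Y T
    using that nR unfolding torus_invariant_def by metis
  have monR: "mon a (R Y) = cis (real (a j) * \<theta>) * mon a Y" for a Y
  proof -
    have "(\<Prod>i\<in>UNIV. \<omega> i ^ a i) = cis (real (a j) * \<theta>)"
      by (subst prod.remove[of UNIV j]) (auto simp: \<omega>_def Complex.DeMoivre)
    then show ?thesis by (simp add: mon_def R_def power_mult_distrib prod.distrib)
  qed
  define \<kappa> where "\<kappa> = cis ((real (a j) - real (b j)) * \<theta>)"
  have "(real (a j) - real (b j)) * \<theta> = pi / 2 \<or> (real (a j) - real (b j)) * \<theta> = - (pi / 2)"
    using k by (auto simp: \<theta>_def k_def abs_if field_simps)
  then have "\<kappa> = \<i> \<or> \<kappa> = - \<i>"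
    unfolding \<kappa>_def by (elim disjE) (simp_all only: cis_pi_half cis_minus_pi_half simp_thms)
  then have kap: "\<kappa> \<noteq> 1" by (auto simp: complex_eq_iff)
  define G where "G = (\<lambda>Y. (indicator D Y * wt \<alpha> F Y) *\<^sub>R (indicator S Y *\<^sub>R (mon a Y * cnj (mon b Y))))"
  have [measurable]: "G \<in> borel_measurable borel" unfolding G_def by measurable
  have GR: "G (R Y) = \<kappa> * G Y" for Y
  proof -
    have "wt \<alpha> F (R Y) = wt \<alpha> F Y" if "Y \<in> D"
      using wt_radial[of "R Y" Y] that RS[OF reinhardt_torus_invariant[OF reinhardt_D]] nR by auto
    moreover have "mon a (R Y) * cnj (mon b (R Y)) = \<kappa> * (mon a Y * cnj (mon b Y))"
    proof -
      have "cis (real (a j) * \<theta>) * cnj (cis (real (b j) * \<theta>)) = \<kappa>"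
        by (simp add: \<kappa>_def cis_cnj cis_mult algebra_simps)
      moreover have "mon a (R Y) * cnj (mon b (R Y)) = (cis (real (a j) * \<theta>) * cnj (cis (real (b j) * \<theta>))) * (mon a Y * cnj (mon b Y))"
        unfolding monR complex_cnj_mult by (simp only: mult_ac)
      ultimately show ?thesis by (simp only:)
    qed
    ultimately show ?thesis
      using RS[OF S(2)] RS[OF reinhardt_torus_invariant[OF reinhardt_D]]
      by (auto simp: G_def indicator_def)
  qed
  have "(\<integral>Y. G Y \<partial>lborel) = (\<integral>Y. G Y \<partial>distr lborel borel R)" by (simp add: R)
  also have "\<dots> = \<kappa> * (\<integral>Y. G Y \<partial>lborel)"
    by (subst integral_distr) (auto simp: GR)
  finally have "(\<integral>Y. G Y \<partial>lborel) = 0" using kap by simp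
  then show ?thesis
    unfolding M_def G_def by (subst integral_density) (auto simp: wt_nonneg)
qed

text \<open>An enumeration of the multi-indices: dominated convergence and Tannery's theorem are
  about sequences, whereas the expansions are unordered sums.\<close>

definition E :: "nat \<Rightarrow> 'k \<Rightarrow> nat" where "E = from_nat_into UNIV"

lemma bij_E: "bij_betw E UNIV UNIV"
proof -
  have "infinite (UNIV :: ('k \<Rightarrow> nat) set)"
    by (simp add: infinite_UNIV_nat finite_UNIV_fun)
  then show ?thesis unfolding E_def by (intro bij_betw_from_nat_into) auto
qed

lemma E_inject: "E i = E j \<longleftrightarrow> i = j"
  using bij_E by (auto simp: bij_betw_def inj_on_def)

lemma has_sum_E:
  fixes f :: "('k \<Rightarrow> nat) \<Rightarrow> 'b::{comm_monoid_add, t2_space}"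
  shows "(f has_sum x) UNIV \<longleftrightarrow> ((\<lambda>i. f (E i)) has_sum x) UNIV"
  using has_sum_reindex_bij_betw[OF bij_E] by blast

lemma abs_summable_E:
  fixes f :: "('k \<Rightarrow> nat) \<Rightarrow> 'b::real_normed_vector"
  assumes "f abs_summable_on UNIV"
  shows "summable (\<lambda>i. norm (f (E i)))"
  using assms has_sum_E[of "\<lambda>a. norm (f a)"] has_sum_imp_sums
  unfolding summable_on_def summable_def by blast

text \<open>Integrals over \<open>D\<close> are approximated by integrals over sets on which the partial sums of two
  power series are bounded. These sets are invariant under rotations of the coordinates, so the
  monomials remain orthogonal on them, and termwise integration is justified by dominated
  convergence.\<close>

definition trunc :: "(nat \<Rightarrow> complex) \<Rightarrow> (nat \<Rightarrow> complex) \<Rightarrow> real \<Rightarrow> (complex^'k) set" where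
  "trunc c d R = {Y\<in>D. \<forall>n. (\<Sum>i<n. cmod (c i * mon (E i) Y)) \<le> R \<and> (\<Sum>i<n. cmod (d i * mon (E i) Y)) \<le> R}"

lemma trunc_measurable [measurable]: "trunc c d R \<in> sets borel"
proof -
  have "{Y \<in> space borel. Y \<in> D \<and> (\<forall>n. (\<Sum>i<n. cmod (c i * mon (E i) Y)) \<le> R \<and> (\<Sum>i<n. cmod (d i * mon (E i) Y)) \<le> R)} \<in> sets borel"
    by measurable
  then show ?thesis by (simp add: trunc_def)
qed

lemma trunc_subset: "trunc c d R \<subseteq> D"
  by (auto simp: trunc_def)

lemma trunc_invariant: "torus_invariant (trunc c d R)"
proof -
  have 1: "cmod (mon a X) = cmod (mon a Y)" if "\<forall>i. cmod (X $ i) = cmod (Y $ i)" for a and X Y :: "complex^'k"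
    using that by (simp add: norm_mon)
  show ?thesis
    unfolding torus_invariant_def
  proof (intro allI impI)
    fix X Y :: "complex^'k"
    assume *: "\<forall>i. cmod (X $ i) = cmod (Y $ i)" "X \<in> trunc c d R"
    have "Y \<in> D"
      using reinhardt_torus_invariant[OF reinhardt_D] * by (auto simp: trunc_def torus_invariant_def)
    then show "Y \<in> trunc c d R" using *(2) 1[OF *(1)] by (simp add: trunc_def norm_mult)
  qed
qed

lemma trunc_eventually:
  assumes "Y \<in> D" "summable (\<lambda>i. norm (c i * mon (E i) Y))" "summable (\<lambda>i. norm (d i * mon (E i) Y))"
  shows "eventually (\<lambda>R. Y \<in> trunc c d (real R)) sequentially"
proof -
  define B where "B = max (\<Sum>i. norm (c i * mon (E i) Y)) (\<Sum>i. norm (d i * mon (E i) Y))"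
  have "eventually (\<lambda>R. real R \<ge> B) sequentially" by real_asymp
  then show ?thesis
  proof eventually_elim
    case (elim R)
    have "(\<Sum>i<n. cmod (c i * mon (E i) Y)) \<le> B" "(\<Sum>i<n. cmod (d i * mon (E i) Y)) \<le> B" for n
      using sum_le_suminf[OF assms(2), of "{..<n}"] sum_le_suminf[OF assms(3), of "{..<n}"]
      by (auto simp: B_def)
    then show ?case using elim assms(1) by (auto simp: trunc_def intro: order_trans)
  qed
qed

text \<open>On the truncated set both families of partial sums are bounded by R, so their products
  are bounded by R^2, a constant integrable for the finite measure \<open>M\<close>. Orthogonality
  on the same set reduces the double sum to its diagonal.\<close>

lemma truncated_pairing:
  assumes f: "\<And>Y. Y \<in> D \<Longrightarrow> (\<lambda>i. c i * mon (E i) Y) sums f Y"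
    and g: "\<And>Y. Y \<in> D \<Longrightarrow> (\<lambda>i. d i * mon (E i) Y) sums g Y"
  shows "integrable M (\<lambda>Y. indicator (trunc c d R) Y *\<^sub>R (f Y * cnj (g Y)))"
    and "(\<lambda>i. c i * cnj (d i) * complex_of_real (\<integral>Y. indicator (trunc c d R) Y * (cmod (mon (E i) Y))\<^sup>2 \<partial>M))
      sums (\<integral>Y. indicator (trunc c d R) Y *\<^sub>R (f Y * cnj (g Y)) \<partial>M)"
proof -
  interpret finite_measure M by (rule finite_M)
  let ?S = "trunc c d R"
  define s where "s = (\<lambda>n Y. indicator ?S Y *\<^sub>R ((\<Sum>i<n. c i * mon (E i) Y) * cnj (\<Sum>i<n. d i * mon (E i) Y)))"
  let ?h = "\<lambda>Y. indicator ?S Y *\<^sub>R (f Y * cnj (g Y))"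
  have lim: "(\<lambda>n. s n Y) \<longlonglongrightarrow> ?h Y" for Y
  proof (cases "Y \<in> ?S")
    case True
    then have "Y \<in> D" using trunc_subset by blast
    from f[OF this] g[OF this] show ?thesis
      unfolding s_def sums_def by (intro tendsto_intros)
  qed (simp add: s_def)
  have [measurable]: "s n \<in> borel_measurable borel" for n unfolding s_def by measurable
  have hm [measurable]: "?h \<in> borel_measurable borel"
    by (rule borel_measurable_LIMSEQ_metric[OF _ lim]) measurable
  have bd: "cmod (s n Y) \<le> R * R" if "R \<ge> 0" for n Y
  proof (cases "Y \<in> ?S")
    case True
    then have "cmod (\<Sum>i<n. c i * mon (E i) Y) \<le> R" "cmod (\<Sum>i<n. d i * mon (E i) Y) \<le> R"
      unfolding trunc_def by (auto intro: order_trans[OF norm_sum])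
    then show ?thesis using True that
      unfolding s_def by (simp add: norm_mult mult_mono del: cnj_sum)
  qed (use that in \<open>simp add: s_def\<close>)
  \<comment> \<open>For negative R the truncated set is empty, since already the empty partial sum 0
    exceeds R; the absolute values cover both cases.\<close>
  have bd': "cmod (s n Y) \<le> \<bar>R\<bar> * \<bar>R\<bar>" for n Y
  proof (cases "R \<ge> 0")
    case False
    then have "?S = {}" by (auto simp: trunc_def intro!: exI[of _ 0])
    then show ?thesis by (simp add: s_def)
  qed (use bd in auto)
  have w: "integrable M (\<lambda>_. \<bar>R\<bar> * \<bar>R\<bar>)" by (rule integrable_const)
  show "integrable M ?h"
    by (rule integrable_dominated_convergence[where s = s, OF _ _ w]) (use lim bd' in auto)
  have "(\<lambda>n. \<integral>Y. s n Y \<partial>M) \<longlonglongrightarrow> (\<integral>Y. ?h Y \<partial>M)"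
    by (rule integral_dominated_convergence[where w = "\<lambda>_. \<bar>R\<bar> * \<bar>R\<bar>", OF _ _ w]) (use lim bd' in auto)
  moreover have "(\<integral>Y. s n Y \<partial>M) = (\<Sum>i<n. c i * cnj (d i) * complex_of_real (\<integral>Y. indicator ?S Y * (cmod (mon (E i) Y))\<^sup>2 \<partial>M))" for n
  proof -
    have dg: "(\<integral>Y. indicator ?S Y *\<^sub>R (mon a Y * cnj (mon a Y)) \<partial>M) = complex_of_real (\<integral>Y. indicator ?S Y * (cmod (mon a Y))\<^sup>2 \<partial>M)" for a
      by (subst integral_complex_of_real[symmetric], intro Bochner_Integration.integral_cong refl)
         (simp add: complex_norm_square scaleR_conv_of_real del: of_real_power flip: complex_norm_square)
    have I: "integrable M (\<lambda>Y. c i * cnj (d j) * (indicator ?S Y *\<^sub>R (mon (E i) Y * cnj (mon (E j) Y))))" for i j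
      by (intro integrable_mult_right integrable_mon_mult trunc_measurable)
    have "(\<integral>Y. s n Y \<partial>M) = (\<integral>Y. (\<Sum>i<n. \<Sum>j<n. c i * cnj (d j) * (indicator ?S Y *\<^sub>R (mon (E i) Y * cnj (mon (E j) Y)))) \<partial>M)"
      by (intro Bochner_Integration.integral_cong refl)
         (auto simp: s_def sum_product indicator_def intro!: sum.cong)
    also have "\<dots> = (\<Sum>i<n. \<integral>Y. (\<Sum>j<n. c i * cnj (d j) * (indicator ?S Y *\<^sub>R (mon (E i) Y * cnj (mon (E j) Y)))) \<partial>M)"
      by (rule Bochner_Integration.integral_sum) (intro Bochner_Integration.integrable_sum I)
    also have "\<dots> = (\<Sum>i<n. \<Sum>j<n. \<integral>Y. c i * cnj (d j) * (indicator ?S Y *\<^sub>R (mon (E i) Y * cnj (mon (E j) Y))) \<partial>M)"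
      by (intro sum.cong refl Bochner_Integration.integral_sum I)
    also have "\<dots> = (\<Sum>i<n. \<Sum>j<n. c i * cnj (d j) * (\<integral>Y. indicator ?S Y *\<^sub>R (mon (E i) Y * cnj (mon (E j) Y)) \<partial>M))"
      by (intro sum.cong refl integral_mult_right_zero)
    also have "\<dots> = (\<Sum>i<n. \<Sum>j<n. if j = i then c i * cnj (d i) * (\<integral>Y. indicator ?S Y *\<^sub>R (mon (E i) Y * cnj (mon (E i) Y)) \<partial>M) else 0)"
      by (intro sum.cong refl) (auto simp: integral_mon_orthogonal[OF _ trunc_subset trunc_invariant] E_inject)
    also have "\<dots> = (\<Sum>i<n. c i * cnj (d i) * (\<integral>Y. indicator ?S Y *\<^sub>R (mon (E i) Y * cnj (mon (E i) Y)) \<partial>M))"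
      by (intro sum.cong refl) (simp add: sum.delta)
    also have "\<dots> = (\<Sum>i<n. c i * cnj (d i) * complex_of_real (\<integral>Y. indicator ?S Y * (cmod (mon (E i) Y))\<^sup>2 \<partial>M))"
      by (simp only: dg)
    finally show ?thesis .
  qed
  ultimately show "(\<lambda>i. c i * cnj (d i) * complex_of_real (\<integral>Y. indicator (trunc c d R) Y * (cmod (mon (E i) Y))\<^sup>2 \<partial>M))
      sums (\<integral>Y. indicator (trunc c d R) Y *\<^sub>R (f Y * cnj (g Y)) \<partial>M)"
    unfolding sums_def by simp
qed

lemma integrable_trunc_mon_sq: "integrable M (\<lambda>Y. indicator (trunc c d R) Y * (cmod (mon a Y))\<^sup>2)"
  by (rule Bochner_Integration.integrable_bound[OF integrable_mon_sq[of a]]) (auto simp: indicator_def)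

lemma trunc_norm_nonneg: "0 \<le> (\<integral>Y. indicator (trunc c d R) Y * (cmod (mon a Y))\<^sup>2 \<partial>M)"
  by (rule integral_nonneg_AE) auto

lemma trunc_norm_le: "(\<integral>Y. indicator (trunc c d R) Y * (cmod (mon a Y))\<^sup>2 \<partial>M) \<le> N a"
  unfolding integral_mon_sq[symmetric]
  by (rule integral_mono[OF integrable_trunc_mon_sq integrable_mon_sq]) (auto simp: indicator_def)

lemma trunc_norm_tendsto:
  assumes "\<And>Y. Y \<in> D \<Longrightarrow> summable (\<lambda>i. norm (c i * mon (E i) Y))"
    and "\<And>Y. Y \<in> D \<Longrightarrow> summable (\<lambda>i. norm (d i * mon (E i) Y))"
  shows "(\<lambda>R. \<integral>Y. indicator (trunc c d (real R)) Y * (cmod (mon a Y))\<^sup>2 \<partial>M) \<longlonglongrightarrow> N a"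
  unfolding integral_mon_sq[symmetric]
proof (rule integral_dominated_convergence[where w = "\<lambda>Y. (cmod (mon a Y))\<^sup>2"])
  show "AE Y in M. (\<lambda>R. indicator (trunc c d (real R)) Y * (cmod (mon a Y))\<^sup>2) \<longlonglongrightarrow> (cmod (mon a Y))\<^sup>2"
    using AE_M_D
  proof eventually_elim
    case (elim Y)
    show ?case
      by (rule tendsto_eventually)
         (use trunc_eventually[OF elim assms(1,2)[OF elim]] in eventually_elim, simp)
  qed
qed (use integrable_mon_sq in \<open>auto simp: indicator_def\<close>)

section \<open>The reproducing kernel\<close>

definition kernel_coeff :: "complex^'k \<Rightarrow> nat \<Rightarrow> complex" where
  "kernel_coeff Z i = cnj (mon (E i) Z) / complex_of_real (N (E i))"

definition kernel :: "complex^'k \<Rightarrow> complex^'k \<Rightarrow> complex" where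
  "kernel Z Y = (\<Sum>i. kernel_coeff Z i * mon (E i) Y)"

lemma kernel_summable_E:
  assumes "Z \<in> D"
  shows "summable (\<lambda>i. (cmod (mon (E i) Z))\<^sup>2 / N (E i))"
proof -
  have "(\<lambda>a. (cmod (mon a Z))\<^sup>2 / N a) abs_summable_on UNIV"
    using kernel_summable[OF assms] by (simp add: N_pos less_imp_le)
  from abs_summable_E[OF this] show ?thesis by (simp add: N_pos less_imp_le)
qed

text \<open>By xy \<le> x^2 + y^2 the mixed series is dominated by the two diagonal series at Z and
  at Y.\<close>

lemma kernel_abs_summable:
  assumes "Z \<in> D" "Y \<in> D"
  shows "summable (\<lambda>i. norm (kernel_coeff Z i * mon (E i) Y))"
proof (rule summable_comparison_test')
  show "summable (\<lambda>i. (cmod (mon (E i) Z))\<^sup>2 / N (E i) + (cmod (mon (E i) Y))\<^sup>2 / N (E i))"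
    by (intro summable_add kernel_summable_E assms)
  fix i
  have "x * y \<le> x\<^sup>2 + y\<^sup>2" if "x \<ge> 0" "y \<ge> 0" for x y :: real
    using sum_squares_bound[of x y] that mult_nonneg_nonneg[OF that] by linarith
  then have "cmod (mon (E i) Z) * cmod (mon (E i) Y) / N (E i) \<le> ((cmod (mon (E i) Z))\<^sup>2 + (cmod (mon (E i) Y))\<^sup>2) / N (E i)"
    by (intro divide_right_mono) (auto simp: N_pos less_imp_le)
  then show "norm (norm (kernel_coeff Z i * mon (E i) Y)) \<le> (cmod (mon (E i) Z))\<^sup>2 / N (E i) + (cmod (mon (E i) Y))\<^sup>2 / N (E i)"
    using N_pos[of "E i"] by (simp add: kernel_coeff_def norm_mult norm_divide add_divide_distrib)
qed

lemma kernel_sums: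
  assumes "Z \<in> D" "Y \<in> D"
  shows "(\<lambda>i. kernel_coeff Z i * mon (E i) Y) sums kernel Z Y"
  unfolding kernel_def by (rule summable_sums[OF summable_norm_cancel[OF kernel_abs_summable[OF assms]]])

lemma kernel_holo_on:
  assumes "Z \<in> D"
  shows "holo_on D (kernel Z)"
  unfolding kernel_def[abs_def]
  by (rule power_series_holo_on[OF open_D reinhardt_D kernel_abs_summable[OF assms]])

text \<open>A member of the space is arbitrary outside D, so measurability is asserted only after
  multiplication with the indicator.\<close>

lemma holo_on_indicator_measurable:
  assumes "holo_on D f"
  shows "(\<lambda>Y. indicator D Y *\<^sub>R f Y) \<in> borel_measurable borel"
  by (rule measurable_indicator_mult_continuous[OF open_D holo_on_continuous[OF assms]])

lemma Hsp_iff: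
  assumes "holo_on D f"
  shows "f \<in> Hsp D \<alpha> F \<longleftrightarrow> (\<integral>\<^sup>+Y. ennreal ((cmod (indicator D Y *\<^sub>R f Y))\<^sup>2) \<partial>M) < \<infinity>"
proof -
  note [measurable] = holo_on_indicator_measurable[OF assms]
  have "(\<integral>\<^sup>+ Z. indicator D Z * ennreal (wt \<alpha> F Z * (cmod (f Z))^2) \<partial>lebesgue)
    = (\<integral>\<^sup>+ Z. indicator D Z * ennreal (wt \<alpha> F Z * (cmod (f Z))^2) \<partial>lborel)"
    by (rule nn_integral_completion)
  also have "\<dots> = (\<integral>\<^sup>+Y. ennreal ((cmod (indicator D Y *\<^sub>R f Y))\<^sup>2) \<partial>M)"
  proof (subst nn_integral_M)
    show "(\<lambda>Y. ennreal ((cmod (indicator D Y *\<^sub>R f Y))\<^sup>2)) \<in> borel_measurable borel" by measurable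
    show "(\<integral>\<^sup>+ Z. indicator D Z * ennreal (wt \<alpha> F Z * (cmod (f Z))^2) \<partial>lborel) =
      (\<integral>\<^sup>+Y. indicator D Y * ennreal (wt \<alpha> F Y) * ennreal ((cmod (indicator D Y *\<^sub>R f Y))\<^sup>2) \<partial>lborel)"
      by (intro nn_integral_cong) (use wt_pos in \<open>auto simp: indicator_def ennreal_mult' less_imp_le\<close>)
  qed
  finally show ?thesis using assms by (simp add: Hsp_def)
qed

lemma Hinner_eq:
  assumes "holo_on D f" "holo_on D g"
  shows "Hinner D \<alpha> F f g = (\<integral>Y. indicator D Y *\<^sub>R (f Y * cnj (g Y)) \<partial>M)"
proof -
  note [measurable] = holo_on_indicator_measurable[OF assms(1)] holo_on_indicator_measurable[OF assms(2)]
  have eq: "indicator D Y *\<^sub>R (f Y * cnj (g Y)) = (indicator D Y *\<^sub>R f Y) * cnj (indicator D Y *\<^sub>R g Y)" for Y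
    by (simp add: indicator_def)
  have eq2: "indicator D Y *\<^sub>R (wt \<alpha> F Y *\<^sub>R (f Y * cnj (g Y)))
    = (indicator D Y * wt \<alpha> F Y) *\<^sub>R ((indicator D Y *\<^sub>R f Y) * cnj (indicator D Y *\<^sub>R g Y))" for Y
    by (simp add: indicator_def)
  have "Hinner D \<alpha> F f g = (\<integral>Y. indicator D Y *\<^sub>R (wt \<alpha> F Y *\<^sub>R (f Y * cnj (g Y))) \<partial>lborel)"
    unfolding Hinner_def set_lebesgue_integral_def eq2 by (rule integral_completion) measurable
  also have "\<dots> = (\<integral>Y. indicator D Y *\<^sub>R (f Y * cnj (g Y)) \<partial>M)"
    unfolding M_def eq eq2
  proof (subst integral_density)
    show "(\<lambda>Y. (indicator D Y *\<^sub>R f Y) * cnj (indicator D Y *\<^sub>R g Y)) \<in> borel_measurable lborel" by measurable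
  qed (auto simp: wt_nonneg)
  finally show ?thesis .
qed

text \<open>On each truncated set the squared norm of the kernel is a diagonal sum bounded by the
  value K of the kernel at (Z, Z), because truncated monomial norms are at most the full ones.
  Fatou's lemma carries the bound to D.\<close>

lemma kernel_in_Hsp:
  assumes Z: "Z \<in> D"
  shows "kernel Z \<in> Hsp D \<alpha> F"
proof -
  let ?k = "kernel_coeff Z"
  note [measurable] = holo_on_indicator_measurable[OF kernel_holo_on[OF Z]]
  define K where "K = (\<Sum>i. (cmod (mon (E i) Z))\<^sup>2 / N (E i))"
  define u where "u = (\<lambda>R Y. ennreal ((cmod (indicator (trunc ?k ?k (real R)) Y *\<^sub>R (indicator D Y *\<^sub>R kernel Z Y)))\<^sup>2))"
  have [measurable]: "u R \<in> borel_measurable borel" for R :: nat unfolding u_def by measurable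
  have uR: "(\<integral>\<^sup>+Y. u R Y \<partial>M) \<le> ennreal K" for R
  proof -
    let ?S = "trunc ?k ?k (real R)"
    let ?n = "\<lambda>i. \<integral>Y. indicator ?S Y * (cmod (mon (E i) Y))\<^sup>2 \<partial>M"
    note tp = truncated_pairing[OF kernel_sums[OF Z] kernel_sums[OF Z], where R = "real R"]
    have eq: "indicator ?S Y *\<^sub>R (kernel Z Y * cnj (kernel Z Y)) = complex_of_real ((cmod (indicator ?S Y *\<^sub>R (indicator D Y *\<^sub>R kernel Z Y)))\<^sup>2)" for Y
      using trunc_subset[of ?k ?k "real R"]
      by (auto simp: indicator_def complex_norm_square[symmetric])
    have i: "integrable M (\<lambda>Y. (cmod (indicator ?S Y *\<^sub>R (indicator D Y *\<^sub>R kernel Z Y)))\<^sup>2)"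
      using tp(1) unfolding eq complex_of_real_integrable_eq .
    have "(\<lambda>i. ?k i * cnj (?k i) * complex_of_real (?n i)) sums complex_of_real (\<integral>Y. (cmod (indicator ?S Y *\<^sub>R (indicator D Y *\<^sub>R kernel Z Y)))\<^sup>2 \<partial>M)"
      using tp(2) unfolding eq integral_complex_of_real .
    moreover have "?k i * cnj (?k i) * complex_of_real (?n i) = complex_of_real ((cmod (mon (E i) Z))\<^sup>2 / (N (E i))\<^sup>2 * ?n i)" for i
    proof -
      have "?k i * cnj (?k i) = complex_of_real ((cmod (?k i))\<^sup>2)" by (rule complex_norm_square[symmetric])
      also have "(cmod (?k i))\<^sup>2 = (cmod (mon (E i) Z))\<^sup>2 / (N (E i))\<^sup>2"
        by (simp add: kernel_coeff_def norm_divide power_divide)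
      finally show ?thesis by (simp only: of_real_mult)
    qed
    ultimately have s: "(\<lambda>i. (cmod (mon (E i) Z))\<^sup>2 / (N (E i))\<^sup>2 * ?n i) sums (\<integral>Y. (cmod (indicator ?S Y *\<^sub>R (indicator D Y *\<^sub>R kernel Z Y)))\<^sup>2 \<partial>M)"
      by (simp only: sums_of_real_iff)
    have "(\<integral>Y. (cmod (indicator ?S Y *\<^sub>R (indicator D Y *\<^sub>R kernel Z Y)))\<^sup>2 \<partial>M) \<le> K"
      unfolding K_def
    proof (rule sums_le[OF _ s summable_sums[OF kernel_summable_E[OF Z]]])
      fix i
      have "(cmod (mon (E i) Z))\<^sup>2 / (N (E i))\<^sup>2 * ?n i \<le> (cmod (mon (E i) Z))\<^sup>2 / (N (E i))\<^sup>2 * N (E i)"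
        by (intro mult_left_mono trunc_norm_le) auto
      also have "\<dots> = (cmod (mon (E i) Z))\<^sup>2 / N (E i)"
        using N_pos[of "E i"] by (simp add: power2_eq_square)
      finally show "(cmod (mon (E i) Z))\<^sup>2 / (N (E i))\<^sup>2 * ?n i \<le> (cmod (mon (E i) Z))\<^sup>2 / N (E i)" .
    qed
    then show ?thesis
      unfolding u_def using i by (subst nn_integral_eq_integral) (auto intro: ennreal_leI)
  qed
  have "(\<integral>\<^sup>+Y. ennreal ((cmod (indicator D Y *\<^sub>R kernel Z Y))\<^sup>2) \<partial>M) = (\<integral>\<^sup>+Y. liminf (\<lambda>R. u R Y) \<partial>M)"
  proof (rule nn_integral_cong_AE)
    show "AE Y in M. ennreal ((cmod (indicator D Y *\<^sub>R kernel Z Y))\<^sup>2) = liminf (\<lambda>R. u R Y)"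
      using AE_M_D
    proof eventually_elim
      case (elim Y)
      have "(\<lambda>R. u R Y) \<longlonglongrightarrow> ennreal ((cmod (indicator D Y *\<^sub>R kernel Z Y))\<^sup>2)"
        by (rule tendsto_eventually)
           (use trunc_eventually[OF elim kernel_abs_summable[OF Z elim] kernel_abs_summable[OF Z elim]] in eventually_elim, simp add: u_def)
      from lim_imp_Liminf[OF _ this] show ?case by simp
    qed
  qed
  also have "\<dots> \<le> liminf (\<lambda>R. \<integral>\<^sup>+Y. u R Y \<partial>M)"
    by (rule nn_integral_liminf) measurable
  also have "\<dots> \<le> liminf (\<lambda>R. ennreal K)"
    by (intro Liminf_mono always_eventually allI uR)
  also have "\<dots> < \<infinity>" by (simp add: Liminf_const)
  finally show ?thesis by (subst Hsp_iff[OF kernel_holo_on[OF Z]])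
qed

lemma Hsp_integrable:
  assumes f: "f \<in> Hsp D \<alpha> F"
  shows "integrable M (\<lambda>Y. (cmod (indicator D Y *\<^sub>R f Y))\<^sup>2)"
proof -
  have h: "holo_on D f" using f by (simp add: Hsp_def)
  note [measurable] = holo_on_indicator_measurable[OF h]
  show ?thesis
  proof (rule integrableI_nonneg)
    show "(\<lambda>Y. (cmod (indicator D Y *\<^sub>R f Y))\<^sup>2) \<in> borel_measurable M" by measurable
  qed (use f Hsp_iff[OF h] in auto)
qed

text \<open>The pairing over the truncated sets has two limits. Dominated convergence with majorant
  |f|^2 + |k|^2 gives the inner product; Tannery's theorem, applied to the diagonal series, gives f
  Z. Truncation uses the series of f and of the kernel simultaneously.\<close>

lemma kernel_reproducing:
  assumes Z: "Z \<in> D" and f: "f \<in> Hsp D \<alpha> F"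
  shows "Hinner D \<alpha> F f (kernel Z) = f Z"
proof -
  have h: "holo_on D f" using f by (simp add: Hsp_def)
  note [measurable] = holo_on_indicator_measurable[OF h] holo_on_indicator_measurable[OF kernel_holo_on[OF Z]]
  obtain c' :: "('k \<Rightarrow> nat) \<Rightarrow> complex" where c':
    "\<And>Y. Y \<in> D \<Longrightarrow> ((\<lambda>a. c' a * mon a Y) has_sum f Y) UNIV"
    "\<And>Y. Y \<in> D \<Longrightarrow> (\<lambda>a. c' a * mon a Y) abs_summable_on UNIV"
    using holo_on_power_series[OF open_D reinhardt_D h] by blast
  define c where "c = (\<lambda>i. c' (E i))"
  have c: "(\<lambda>i. c i * mon (E i) Y) sums f Y" "summable (\<lambda>i. norm (c i * mon (E i) Y))" if "Y \<in> D" for Y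
    using has_sum_imp_sums[OF has_sum_E[THEN iffD1, OF c'(1)[OF that]]] abs_summable_E[OF c'(2)[OF that]]
    by (auto simp: c_def)
  let ?k = "kernel_coeff Z"
  let ?S = "\<lambda>R::nat. trunc c ?k (real R)"
  let ?n = "\<lambda>R i. \<integral>Y. indicator (?S R) Y * (cmod (mon (E i) Y))\<^sup>2 \<partial>M"
  let ?I = "\<lambda>R. \<integral>Y. indicator (?S R) Y *\<^sub>R (f Y * cnj (kernel Z Y)) \<partial>M"
  have eq: "indicator D Y *\<^sub>R (f Y * cnj (kernel Z Y)) = (indicator D Y *\<^sub>R f Y) * cnj (indicator D Y *\<^sub>R kernel Z Y)" for Y
    by (simp add: indicator_def)
  have eq2: "indicator (?S R) Y *\<^sub>R (f Y * cnj (kernel Z Y)) = indicator (?S R) Y *\<^sub>R ((indicator D Y *\<^sub>R f Y) * cnj (indicator D Y *\<^sub>R kernel Z Y))" for Y R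
    using trunc_subset[of c ?k "real R"] by (auto simp: indicator_def)
  have "?I \<longlonglongrightarrow> (\<integral>Y. indicator D Y *\<^sub>R (f Y * cnj (kernel Z Y)) \<partial>M)"
    unfolding eq eq2
  proof (rule integral_dominated_convergence[where w = "\<lambda>Y. (cmod (indicator D Y *\<^sub>R f Y))\<^sup>2 + (cmod (indicator D Y *\<^sub>R kernel Z Y))\<^sup>2"])
    show "integrable M (\<lambda>Y. (cmod (indicator D Y *\<^sub>R f Y))\<^sup>2 + (cmod (indicator D Y *\<^sub>R kernel Z Y))\<^sup>2)"
      by (intro Bochner_Integration.integrable_add Hsp_integrable f kernel_in_Hsp Z)
    show "AE Y in M. (\<lambda>R. indicator (?S R) Y *\<^sub>R ((indicator D Y *\<^sub>R f Y) * cnj (indicator D Y *\<^sub>R kernel Z Y)))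
      \<longlonglongrightarrow> (indicator D Y *\<^sub>R f Y) * cnj (indicator D Y *\<^sub>R kernel Z Y)"
      using AE_M_D
    proof eventually_elim
      case (elim Y)
      show ?case
        by (rule tendsto_eventually)
           (use trunc_eventually[OF elim c(2)[OF elim] kernel_abs_summable[OF Z elim]] in eventually_elim, simp)
    qed
    have "x * y \<le> x\<^sup>2 + y\<^sup>2" if "x \<ge> 0" "y \<ge> 0" for x y :: real
      using sum_squares_bound[of x y] that mult_nonneg_nonneg[OF that] by linarith
    then show "AE Y in M. cmod (indicator (?S R) Y *\<^sub>R ((indicator D Y *\<^sub>R f Y) * cnj (indicator D Y *\<^sub>R kernel Z Y)))
      \<le> (cmod (indicator D Y *\<^sub>R f Y))\<^sup>2 + (cmod (indicator D Y *\<^sub>R kernel Z Y))\<^sup>2" for R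
      by (auto simp: indicator_def norm_mult)
  qed measurable
  moreover have "?I \<longlonglongrightarrow> f Z"
  proof -
    define a where "a = (\<lambda>i R. c i * cnj (?k i) * complex_of_real (?n R i))"
    \<comment> \<open>The kernel coefficient turns each diagonal term into the term of the expansion
      of f at Z times a ratio of truncated to full norm. This ratio lies in [0, 1] and tends to 1,
      which provides both the majorant and the limit.\<close>
    have aeq: "a i R = (c i * mon (E i) Z) * complex_of_real (?n R i / N (E i))" for i R
      by (simp add: a_def kernel_coeff_def)
    have "?I R = (\<Sum>i. a i R)" for R
      using truncated_pairing(2)[OF c(1) kernel_sums[OF Z], where R = "real R"] by (simp add: a_def sums_iff)
    moreover have "(\<lambda>R. \<Sum>i. a i R) \<longlonglongrightarrow> (\<Sum>i. c i * mon (E i) Z)"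
    proof (rule tannerys_theorem[THEN conjunct2, THEN conjunct2])
      fix i
      have "(\<lambda>R. (c i * mon (E i) Z) * complex_of_real (?n R i / N (E i))) \<longlonglongrightarrow> (c i * mon (E i) Z) * complex_of_real (N (E i) / N (E i))"
        using N_pos[of "E i"]
        by (intro tendsto_intros trunc_norm_tendsto c(2) kernel_abs_summable Z) auto
      then show "(\<lambda>R. a i R) \<longlonglongrightarrow> c i * mon (E i) Z"
        using N_pos[of "E i"] unfolding aeq by simp
    next
      show "\<forall>\<^sub>F (i, R) in sequentially \<times>\<^sub>F sequentially. norm (a i R) \<le> norm (c i * mon (E i) Z)"
      proof (intro always_eventually allI, clarify)
        fix i R
        have "\<bar>?n R i / N (E i)\<bar> \<le> 1"
          using trunc_norm_le[of c ?k "real R" "E i"] trunc_norm_nonneg[of c ?k "real R" "E i"] N_pos[of "E i"]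
          by simp
        then show "norm (a i R) \<le> norm (c i * mon (E i) Z)"
          unfolding aeq norm_mult[of _ "complex_of_real _"] norm_of_real by (rule mult_left_le) simp
      qed
    qed (use c(2)[OF Z] in auto)
    ultimately show ?thesis using c(1)[OF Z] by (simp add: sums_iff)
  qed
  ultimately show ?thesis
    unfolding Hinner_eq[OF h kernel_holo_on[OF Z]] by (rule LIMSEQ_unique)
qed

lemma Hinner_cnj: "Hinner D \<alpha> F g f = cnj (Hinner D \<alpha> F f g)"
  unfolding Hinner_def set_lebesgue_integral_def by (simp add: mult.commute flip: Bochner_Integration.integral_cnj)

text \<open>Representers can differ outside D, so uniqueness is shown for the value at Z: letting a
  representer k and the kernel reproduce each other gives k Z = cnj (kernel Z Z), and self-pairing
  shows that the latter is real.\<close>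

lemma Kdiag_eq_kernel:
  assumes Z: "Z \<in> D"
  shows "Kdiag D \<alpha> F Z = kernel Z Z"
  unfolding Kdiag_def
proof (rule the_equality)
  show "\<exists>k\<in>Hsp D \<alpha> F. (\<forall>f\<in>Hsp D \<alpha> F. f Z = Hinner D \<alpha> F f k) \<and> kernel Z Z = k Z"
    using kernel_in_Hsp[OF Z] kernel_reproducing[OF Z] by (intro bexI[of _ "kernel Z"]) auto
  fix c assume "\<exists>k\<in>Hsp D \<alpha> F. (\<forall>f\<in>Hsp D \<alpha> F. f Z = Hinner D \<alpha> F f k) \<and> c = k Z"
  then obtain k where k: "k \<in> Hsp D \<alpha> F" "\<And>f. f \<in> Hsp D \<alpha> F \<Longrightarrow> f Z = Hinner D \<alpha> F f k" "c = k Z" by blast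
  have "kernel Z Z = cnj (kernel Z Z)"
    using kernel_reproducing[OF Z kernel_in_Hsp[OF Z]] Hinner_cnj by metis
  moreover have "k Z = cnj (kernel Z Z)"
    using k(2)[OF kernel_in_Hsp[OF Z]] kernel_reproducing[OF Z k(1)] Hinner_cnj by metis
  ultimately show "c = kernel Z Z" using k(3) by simp
qed

theorem Kdiag_eq_infsum:
  assumes Z: "Z \<in> D"
  shows "Kdiag D \<alpha> F Z = complex_of_real (\<Sum>\<^sub>\<infinity>a. (cmod (mon a Z))\<^sup>2 / N a)"
proof -
  have "((\<lambda>a. (cmod (mon a Z))\<^sup>2 / N a) has_sum (\<Sum>\<^sub>\<infinity>a. (cmod (mon a Z))\<^sup>2 / N a)) UNIV"
    using kernel_summable[OF Z] by (rule has_sum_infsum)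
  then have "(\<lambda>i. (cmod (mon (E i) Z))\<^sup>2 / N (E i)) sums (\<Sum>\<^sub>\<infinity>a. (cmod (mon a Z))\<^sup>2 / N a)"
    using has_sum_E has_sum_imp_sums by blast
  then have "(\<lambda>i. complex_of_real ((cmod (mon (E i) Z))\<^sup>2 / N (E i))) sums complex_of_real (\<Sum>\<^sub>\<infinity>a. (cmod (mon a Z))\<^sup>2 / N a)"
    by (simp only: sums_of_real_iff)
  moreover have "kernel_coeff Z i * mon (E i) Z = complex_of_real ((cmod (mon (E i) Z))\<^sup>2 / N (E i))" for i
  proof -
    have "cnj (mon (E i) Z) * mon (E i) Z = complex_of_real ((cmod (mon (E i) Z))\<^sup>2)"
      by (subst mult.commute) (rule complex_norm_square[symmetric])
    then show ?thesis by (simp only: kernel_coeff_def of_real_divide times_divide_eq_left)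
  qed
  ultimately show ?thesis
    unfolding Kdiag_eq_kernel[OF Z] kernel_def by (simp add: sums_iff)
qed

end

section \<open>The volume density\<close>

text \<open>For x nonzero, a change of basis sends a basis vector to x, after which the perturbation
  lives in a single row and Cramer's lemma evaluates the determinant.\<close>

lemma det_identity_plus_rank_one:
  fixes x y :: "'k::finite \<Rightarrow> 'a::field"
  shows "det (\<chi> i j. (if i = j then 1 else 0) + x i * y j) = 1 + (\<Sum>i\<in>UNIV. x i * y i)"
proof (cases "\<forall>i. x i = 0")
  case True
  then show ?thesis using det_I[where 'a = 'a and 'n = 'k] by (simp add: mat_def)
next
  case False
  then obtain k where k: "x k \<noteq> 0" by blast
  \<comment> \<open>The identity with column k replaced by x. Its determinant is x k, nonzero by the
    choice of k, and A S = S B, where B differs from the identity only by the row v = y^T S in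
    position k.\<close>
  define S :: "'a^'k^'k" where "S = (\<chi> i j. if j = k then x i else if i = j then 1 else 0)"
  define v where "v = (\<lambda>j. \<Sum>i\<in>UNIV. y i * S $ i $ j)"
  define A :: "'a^'k^'k" where "A = (\<chi> i j. (if i = j then 1 else 0) + x i * y j)"
  define B :: "'a^'k^'k" where "B = (\<chi> i j. (if i = j then 1 else 0) + (if i = k then v j else 0))"
  have "(\<chi> i j. if j = k then (mat 1 *v (\<chi> i. x i)) $ i else (mat 1 :: 'a^'k^'k) $ i $ j) = S"
    unfolding matrix_vector_mul_lid by (simp add: S_def mat_def vec_eq_iff)
  with cramer_lemma[of k "mat 1 :: 'a^'k^'k" "\<chi> i. x i"] have dS: "det S = x k"
    by (simp only: det_I vec_lambda_beta mult_1_right)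
  have vk: "v k = (\<Sum>i\<in>UNIV. x i * y i)" by (simp add: v_def S_def mult.commute)
  have "(\<chi> i. if i = k then (\<Sum>i\<in>UNIV. (axis k 1 + (\<chi> j. v j)) $ i *s row i (mat 1 :: 'a^'k^'k)) else row i (mat 1)) = B"
    by (auto simp: B_def row_def mat_def vec_eq_iff axis_def if_distrib[of "\<lambda>z. _ * z"] distrib_right sum.distrib cong: if_cong)
  then have "det B = (axis k 1 + (\<chi> j. v j)) $ k * det (mat 1 :: 'a^'k^'k)"
    using cramer_lemma_transpose[of k "axis k 1 + (\<chi> j. v j)" "mat 1 :: 'a^'k^'k"] by (simp only:)
  then have dB: "det B = 1 + v k" by (simp add: axis_def)
  have "A ** S = S ** B"
  proof -
    have "(A ** S) $ i $ j = S $ i $ j + x i * v j" for i j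
      by (simp add: A_def matrix_matrix_mult_def v_def distrib_right sum.distrib sum_distrib_left mult.assoc if_distrib[of "\<lambda>z. z * _"] cong: if_cong)
    moreover have "(S ** B) $ i $ j = S $ i $ j + x i * v j" for i j
    proof -
      have "(S ** B) $ i $ j = (\<Sum>l\<in>UNIV. (if l = j then S $ i $ l else 0)) + (\<Sum>l\<in>UNIV. (if l = k then S $ i $ l * v j else 0))"
        by (simp add: B_def matrix_matrix_mult_def distrib_left sum.distrib if_distrib[of "\<lambda>z. _ * z"] cong: if_cong)
      then show ?thesis by (simp add: S_def)
    qed
    ultimately show ?thesis by (simp add: vec_eq_iff)
  qed
  then have "det A * det S = det S * det B" by (metis det_mul)
  then have "det A = det B" using k dS by simp
  then show ?thesis using dB vk by (simp add: A_def)
qed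

lemma det_diagonal_plus_rank_one:
  fixes d x y :: "'k::finite \<Rightarrow> 'a::field"
  assumes d: "\<And>i. d i \<noteq> 0"
  shows "det (\<chi> i j. (if i = j then d i else 0) + x i * y j) = (\<Prod>i\<in>UNIV. d i) * (1 + (\<Sum>i\<in>UNIV. x i * y i / d i))"
proof -
  define \<Delta> :: "'a^'k^'k" where "\<Delta> = (\<chi> i j. if i = j then d i else 0)"
  have "(\<Delta> ** B) $ i $ j = d i * B $ i $ j" for B :: "'a^'k^'k" and i j
    by (simp add: \<Delta>_def matrix_matrix_mult_def if_distrib[of "\<lambda>z. z * _"] cong: if_cong)
  then have "(\<chi> i j. (if i = j then d i else 0) + x i * y j) = \<Delta> ** (\<chi> i j. (if i = j then 1 else 0) + (x i / d i) * y j)"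
    using d by (simp add: vec_eq_iff distrib_left)
  then show ?thesis
    using det_identity_plus_rank_one[of "\<lambda>i. x i / d i" y] det_diagonal[of \<Delta>]
    by (simp add: det_mul) (simp add: \<Delta>_def)
qed

section \<open>Wirtinger derivatives of the potential\<close>

lemma dirder_eq:
  assumes "(G has_derivative L) (at p)"
  shows "dirder v G p = L v"
proof -
  interpret bounded_linear L by (rule has_derivative_bounded_linear[OF assms])
  have "((\<lambda>t. p + t *\<^sub>R v) has_derivative (\<lambda>t. t *\<^sub>R v)) (at 0)"
    by (auto intro!: derivative_eq_intros)
  from has_derivative_compose[OF this, of G L] assms
  have "((\<lambda>t. G (p + t *\<^sub>R v)) has_derivative (\<lambda>t. L (t *\<^sub>R v))) (at 0)" by simp
  then have "((\<lambda>t. G (p + t *\<^sub>R v)) has_vector_derivative L v) (at 0)"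
    by (simp add: has_vector_derivative_def scaleR)
  then show ?thesis unfolding dirder_def by (rule vector_derivative_at)
qed

lemma has_derivative_cmod_sq:
  "((\<lambda>Z::complex^'k::finite. (cmod (Z $ i))\<^sup>2) has_derivative (\<lambda>h. 2 * Re (cnj (p $ i) * h $ i))) (at p)"
proof -
  have 1: "((\<lambda>Z. Z $ i) has_derivative (\<lambda>h. h $ i)) (at p)"
    by (intro bounded_linear_imp_has_derivative bounded_linear_vec_nth)
  have "((\<lambda>Z. (Re (Z $ i))\<^sup>2 + (Im (Z $ i))\<^sup>2) has_derivative (\<lambda>h. 2 * Re (cnj (p $ i) * h $ i))) (at p)"
    by (rule has_derivative_eq_rhs[OF has_derivative_add[OF has_derivative_power[OF has_derivative_Re[OF 1]] has_derivative_power[OF has_derivative_Im[OF 1]]]])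
       (simp add: fun_eq_iff algebra_simps)
  then show ?thesis by (simp add: cmod_power2)
qed

definition zdiff :: "complex^('n::finite + 'm::finite) \<Rightarrow> complex^('n + 'm) \<Rightarrow> real" where
  "zdiff p h = 2 * Re (\<Sum>j\<in>UNIV. cnj (p $ Inl j) * h $ Inl j)"

definition wdiff :: "complex^('n::finite + 'm::finite) \<Rightarrow> complex^('n + 'm) \<Rightarrow> real" where
  "wdiff p h = 2 * Re (\<Sum>j\<in>UNIV. cnj (p $ Inr j) * h $ Inr j)"

lemma has_derivative_sqn_zpart: "((\<lambda>Z. sqn (zpart Z)) has_derivative zdiff p) (at p)"
proof -
  have "((\<lambda>Z. \<Sum>j\<in>UNIV. (cmod (Z $ Inl j))\<^sup>2) has_derivative (\<lambda>h. \<Sum>j\<in>UNIV. 2 * Re (cnj (p $ Inl j) * h $ Inl j))) (at p)"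
    by (intro has_derivative_sum has_derivative_cmod_sq)
  then show ?thesis by (simp add: sqn_def zpart_def zdiff_def[abs_def] sum_distrib_left)
qed

lemma has_derivative_sqn_wpart: "((\<lambda>Z. sqn (wpart Z)) has_derivative wdiff p) (at p)"
proof -
  have "((\<lambda>Z. \<Sum>j\<in>UNIV. (cmod (Z $ Inr j))\<^sup>2) has_derivative (\<lambda>h. \<Sum>j\<in>UNIV. 2 * Re (cnj (p $ Inr j) * h $ Inr j))) (at p)"
    by (intro has_derivative_sum has_derivative_cmod_sq)
  then show ?thesis by (simp add: sqn_def wpart_def wdiff_def[abs_def] sum_distrib_left)
qed

lemma zdiff_axis [simp]:
  fixes p :: "complex^('n::finite + 'm::finite)"
  shows "zdiff p (axis (Inl j) c) = 2 * Re (cnj (p $ Inl j) * c)" "zdiff p (axis (Inr k) c) = 0"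
  and wdiff_axis [simp]: "wdiff p (axis (Inl j) c) = 0" "wdiff p (axis (Inr k) c) = 2 * Re (cnj (p $ Inr k) * c)"
proof -
  have a: "(axis i c :: complex^('n + 'm)) $ l = (if l = i then c else 0)" for i l by (simp add: axis_def)
  show "zdiff p (axis (Inl j) c) = 2 * Re (cnj (p $ Inl j) * c)" "zdiff p (axis (Inr k) c) = 0"
    "wdiff p (axis (Inl j) c) = 0" "wdiff p (axis (Inr k) c) = 2 * Re (cnj (p $ Inr k) * c)"
    by (simp_all add: zdiff_def wdiff_def a if_distrib[of "\<lambda>z. _ * z"] cong: if_cong)
qed

lemma continuous_sqn_zpart [continuous_intros]: "continuous_on S (\<lambda>Z. sqn (zpart Z))"
  unfolding sqn_def zpart_def by (auto intro!: continuous_intros)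

lemma continuous_sqn_wpart [continuous_intros]: "continuous_on S (\<lambda>Z. sqn (wpart Z))"
  unfolding sqn_def wpart_def by (auto intro!: continuous_intros)

lemma open_Dom: "open (Dom \<mu>)"
  unfolding Dom_def by (intro open_Collect_less continuous_intros)

definition expz :: "real \<Rightarrow> complex^('n::finite + 'm::finite) \<Rightarrow> real" where
  "expz \<mu> Z = exp (- \<mu> * sqn (zpart Z))"

definition gap :: "real \<Rightarrow> complex^('n::finite + 'm::finite) \<Rightarrow> real" where
  "gap \<mu> Z = expz \<mu> Z - sqn (wpart Z)"

lemma gap_pos: "Z \<in> Dom \<mu> \<Longrightarrow> gap \<mu> Z > 0"
  by (simp add: Dom_def gap_def expz_def)

lemma has_derivative_expz: "(expz \<mu> has_derivative (\<lambda>h. - \<mu> * expz \<mu> p * zdiff p h)) (at p)"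
  unfolding expz_def[abs_def]
  by (rule derivative_eq_intros has_derivative_sqn_zpart refl)+ (simp add: fun_eq_iff)

lemma has_derivative_gap: "(gap \<mu> has_derivative (\<lambda>h. - \<mu> * expz \<mu> p * zdiff p h - wdiff p h)) (at p)"
  unfolding gap_def[abs_def]
  by (rule derivative_eq_intros has_derivative_expz has_derivative_sqn_wpart refl)+

text \<open>In terms of T = e^(\<mu>|z|^2) |w|^2 this is \<mu> (\<nu> + 1/(1-T)), since
  \<open>expz\<close> / \<open>gap\<close> = 1/(1-T).\<close>

definition zcoef :: "real \<Rightarrow> real \<Rightarrow> complex^('n::finite + 'm::finite) \<Rightarrow> real" where
  "zcoef \<mu> \<nu> Z = \<nu> * \<mu> + \<mu> * expz \<mu> Z / gap \<mu> Z"

lemma has_derivative_Phi: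
  assumes p: "p \<in> Dom \<mu>"
  shows "(Phi \<mu> \<nu> has_derivative (\<lambda>h. zcoef \<mu> \<nu> p * zdiff p h + wdiff p h / gap \<mu> p)) (at p)"
proof -
  have u: "gap \<mu> p > 0" by (rule gap_pos[OF p])
  have eq: "Phi \<mu> \<nu> = (\<lambda>Z. \<nu> * \<mu> * sqn (zpart Z) - ln (gap \<mu> Z))"
    by (simp add: fun_eq_iff Phi_def gap_def expz_def)
  show ?thesis unfolding eq
    by (rule derivative_eq_intros has_derivative_sqn_zpart has_derivative_gap refl u)+
       (use u in \<open>auto simp: fun_eq_iff zcoef_def field_simps\<close>)
qed

lemma has_derivative_zcoef:
  assumes p: "p \<in> Dom \<mu>"
  shows "(zcoef \<mu> \<nu> has_derivative (\<lambda>h. \<mu> * expz \<mu> p * (\<mu> * sqn (wpart p) * zdiff p h + wdiff p h) / (gap \<mu> p)\<^sup>2)) (at p)"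
proof -
  have u: "gap \<mu> p \<noteq> 0" using gap_pos[OF p] by simp
  have s: "sqn (wpart p) = expz \<mu> p - gap \<mu> p" by (simp add: gap_def)
  show ?thesis unfolding zcoef_def[abs_def]
    by (rule derivative_eq_intros has_derivative_expz has_derivative_gap refl u)+
       (use u in \<open>auto simp: fun_eq_iff s field_simps power2_eq_square\<close>)
qed

lemma has_derivative_inverse_gap:
  assumes p: "p \<in> Dom \<mu>"
  shows "((\<lambda>Z. 1 / gap \<mu> Z) has_derivative (\<lambda>h. (\<mu> * expz \<mu> p * zdiff p h + wdiff p h) / (gap \<mu> p)\<^sup>2)) (at p)"
proof -
  have u: "gap \<mu> p \<noteq> 0" using gap_pos[OF p] by simp
  show ?thesis
    by (rule derivative_eq_intros has_derivative_gap refl u)+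
       (use u in \<open>auto simp: fun_eq_iff field_simps power2_eq_square\<close>)
qed

lemma wirt_dbar_Phi:
  assumes p: "p \<in> Dom \<mu>"
  shows "wirt_dbar (Inl k) (\<lambda>q. complex_of_real (Phi \<mu> \<nu> q)) p = complex_of_real (zcoef \<mu> \<nu> p) * p $ Inl k"
    and "wirt_dbar (Inr k') (\<lambda>q. complex_of_real (Phi \<mu> \<nu> q)) p = complex_of_real (1 / gap \<mu> p) * p $ Inr k'"
proof -
  note d = dirder_eq[OF has_derivative_of_real[OF has_derivative_Phi[OF p, of \<nu>]]]
  show "wirt_dbar (Inl k) (\<lambda>q. complex_of_real (Phi \<mu> \<nu> q)) p = complex_of_real (zcoef \<mu> \<nu> p) * p $ Inl k"
    "wirt_dbar (Inr k') (\<lambda>q. complex_of_real (Phi \<mu> \<nu> q)) p = complex_of_real (1 / gap \<mu> p) * p $ Inr k'"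
    by (auto simp: wirt_dbar_def d complex_eq_iff)
qed

text \<open>The closed form of the antiholomorphic derivatives is available on the domain only.
  Agreement on an open neighbourhood is enough to differentiate it once more.\<close>

lemma wirt_d_cong:
  assumes "open S" "p \<in> S" "\<And>q. q \<in> S \<Longrightarrow> f q = g q" "(g has_derivative L) (at p)"
  shows "wirt_d j f p = (L (axis j 1) - \<i> * L (axis j \<i>)) / 2"
proof -
  have "(f has_derivative L) (at p)"
    using has_derivative_transform_within_open[OF assms(4,1,2)] assms(3) by metis
  from dirder_eq[OF this] show ?thesis by (simp add: wirt_d_def)
qed

text \<open>Applied to a real coefficient times a coordinate function: the real differential 2
  Re(cnj x h), evaluated in the directions 1 and i, recombines to cnj x. The parameter d stands for
  the Kronecker delta from differentiating the coordinate.\<close>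

lemma wirtinger_combine:
  "((a * d + complex_of_real (\<kappa> * (2 * Re (cnj x * 1))) * y) - \<i> * (a * (d * \<i>) + complex_of_real (\<kappa> * (2 * Re (cnj x * \<i>))) * y)) / 2
    = a * d + complex_of_real \<kappa> * cnj x * y"
  by (simp add: complex_eq_iff field_simps)

lemma cHess_Phi:
  fixes p :: "complex^('n::finite + 'm::finite)" and \<mu> \<nu> :: real
  assumes p: "p \<in> Dom \<mu>"
  shows "cHess (Phi \<mu> \<nu>) p $ Inl j $ Inl k = complex_of_real (zcoef \<mu> \<nu> p) * (if j = k then 1 else 0) + complex_of_real (\<mu>\<^sup>2 * expz \<mu> p * sqn (wpart p) / (gap \<mu> p)\<^sup>2) * cnj (p $ Inl j) * p $ Inl k"
    and "cHess (Phi \<mu> \<nu>) p $ Inl j $ Inr k' = complex_of_real (\<mu> * expz \<mu> p / (gap \<mu> p)\<^sup>2) * cnj (p $ Inl j) * p $ Inr k'"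
    and "cHess (Phi \<mu> \<nu>) p $ Inr j' $ Inl k = complex_of_real (\<mu> * expz \<mu> p / (gap \<mu> p)\<^sup>2) * cnj (p $ Inr j') * p $ Inl k"
    and "cHess (Phi \<mu> \<nu>) p $ Inr j' $ Inr k' = complex_of_real (1 / gap \<mu> p) * (if j' = k' then 1 else 0) + complex_of_real (1 / (gap \<mu> p)\<^sup>2) * cnj (p $ Inr j') * p $ Inr k'"
proof -
  let ?\<Phi> = "\<lambda>q. complex_of_real (Phi \<mu> \<nu> q)"
  have n: "((\<lambda>Z. Z $ i) has_derivative (\<lambda>h. h $ i)) (at p)" for i
    by (intro bounded_linear_imp_has_derivative bounded_linear_vec_nth)
  have a: "(axis i c :: complex^('n + 'm)) $ l = (if i = l then 1 else 0) * c" for i l c by (simp add: axis_def)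
  define e u s where "e = expz \<mu> p" and "u = gap \<mu> p" and "s = sqn (wpart p)"
  note dz = has_derivative_mult[OF has_derivative_of_real[OF has_derivative_zcoef[OF p, of \<nu>]] n, folded e_def u_def s_def]
  note dw = has_derivative_mult[OF has_derivative_of_real[OF has_derivative_inverse_gap[OF p]] n, folded e_def u_def s_def]
  have z: "wirt_d i (wirt_dbar (Inl k) ?\<Phi>) p = (L (axis i 1) - \<i> * L (axis i \<i>)) / 2"
    if "L = (\<lambda>h. complex_of_real (zcoef \<mu> \<nu> p) * h $ Inl k + complex_of_real (\<mu> * e * (\<mu> * s * zdiff p h + wdiff p h) / u\<^sup>2) * p $ Inl k)" for i k L
    unfolding that by (rule wirt_d_cong[OF open_Dom p _ dz]) (rule wirt_dbar_Phi(1))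
  have w: "wirt_d i (wirt_dbar (Inr k) ?\<Phi>) p = (L (axis i 1) - \<i> * L (axis i \<i>)) / 2"
    if "L = (\<lambda>h. complex_of_real (1 / u) * h $ Inr k + complex_of_real ((\<mu> * e * zdiff p h + wdiff p h) / u\<^sup>2) * p $ Inr k)" for i k L
    unfolding that by (rule wirt_d_cong[OF open_Dom p _ dw]) (simp add: wirt_dbar_Phi(2) u_def)
  show "cHess (Phi \<mu> \<nu>) p $ Inl j $ Inl k = complex_of_real (zcoef \<mu> \<nu> p) * (if j = k then 1 else 0) + complex_of_real (\<mu>\<^sup>2 * expz \<mu> p * sqn (wpart p) / (gap \<mu> p)\<^sup>2) * cnj (p $ Inl j) * p $ Inl k"
    unfolding cHess_def vec_lambda_beta z[OF refl] a
    by (subst wirtinger_combine[symmetric]) (simp add: e_def u_def s_def power2_eq_square mult_ac)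
  show "cHess (Phi \<mu> \<nu>) p $ Inl j $ Inr k' = complex_of_real (\<mu> * expz \<mu> p / (gap \<mu> p)\<^sup>2) * cnj (p $ Inl j) * p $ Inr k'"
    unfolding cHess_def vec_lambda_beta w[OF refl] a
    using wirtinger_combine[of 0 0 "\<mu> * expz \<mu> p / (gap \<mu> p)\<^sup>2" "p $ Inl j" "p $ Inr k'"] by (simp add: e_def u_def s_def mult_ac)
  show "cHess (Phi \<mu> \<nu>) p $ Inr j' $ Inl k = complex_of_real (\<mu> * expz \<mu> p / (gap \<mu> p)\<^sup>2) * cnj (p $ Inr j') * p $ Inl k"
    unfolding cHess_def vec_lambda_beta z[OF refl] a
    using wirtinger_combine[of 0 0 "\<mu> * expz \<mu> p / (gap \<mu> p)\<^sup>2" "p $ Inr j'" "p $ Inl k"] by (simp add: e_def u_def s_def mult_ac)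
  show "cHess (Phi \<mu> \<nu>) p $ Inr j' $ Inr k' = complex_of_real (1 / gap \<mu> p) * (if j' = k' then 1 else 0) + complex_of_real (1 / (gap \<mu> p)\<^sup>2) * cnj (p $ Inr j') * p $ Inr k'"
    unfolding cHess_def vec_lambda_beta w[OF refl] a
    by (subst wirtinger_combine[symmetric]) (simp add: e_def u_def s_def power2_eq_square mult_ac)
qed

lemma sum_UNIV_sum:
  "(\<Sum>i\<in>(UNIV::('n::finite + 'm::finite) set). g i) = (\<Sum>j\<in>UNIV. g (Inl j)) + (\<Sum>k\<in>UNIV. g (Inr k))"
  by (subst UNIV_sum, subst sum.union_disjoint) (auto simp: sum.reindex)

lemma expz_gap_ge: "Z \<in> Dom \<mu> \<Longrightarrow> expz \<mu> Z / gap \<mu> Z \<ge> 1"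
  using gap_pos[of Z \<mu>] by (simp add: gap_def sqn_def sum_nonneg)

text \<open>The quotient 1/(1-T) is at least 1 on the domain, which is why \<nu> > -1 is the right
  threshold.\<close>

lemma zcoef_pos:
  assumes "Z \<in> Dom \<mu>" "\<mu> > 0" "\<nu> > -1"
  shows "zcoef \<mu> \<nu> Z > 0"
proof -
  have "zcoef \<mu> \<nu> Z = \<mu> * (\<nu> + expz \<mu> Z / gap \<mu> Z)" by (simp add: zcoef_def algebra_simps)
  then show ?thesis using expz_gap_ge[OF assms(1)] assms(2,3) by simp
qed

text \<open>Subtracting \<open>\<mu> \<cdot> cnj z\<^sub>j\<close> times the \<open>w\<close>-combination of the lower rows from the
  upper rows clears the mixed block and leaves a rank one perturbation of a diagonal matrix.\<close>

lemma det_cHess_Phi: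
  fixes p :: "complex^('n::finite + 'm::finite)"
  assumes p: "p \<in> Dom \<mu>" and "\<mu> > 0" "\<nu> > -1"
  shows "det (cHess (Phi \<mu> \<nu>) p) =
    complex_of_real (zcoef \<mu> \<nu> p ^ CARD('n) * (1 / gap \<mu> p) ^ CARD('m) * (expz \<mu> p / gap \<mu> p))"
proof -
  define G where "G = cHess (Phi \<mu> \<nu>) p"
  define A e u s where "A = zcoef \<mu> \<nu> p" and "e = expz \<mu> p" and "u = gap \<mu> p" and "s = sqn (wpart p)"
  have A: "A > 0" and u: "u > 0" and us: "e = u + s"
    using zcoef_pos[OF assms] gap_pos[OF p] by (auto simp: A_def e_def u_def s_def gap_def)
  have G: "G $ Inl j $ Inl k = complex_of_real A * (if j = k then 1 else 0) + complex_of_real (\<mu>\<^sup>2 * e * s / u\<^sup>2) * cnj (p $ Inl j) * p $ Inl k"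
    "G $ Inl j $ Inr k' = complex_of_real (\<mu> * e / u\<^sup>2) * cnj (p $ Inl j) * p $ Inr k'"
    "G $ Inr j' $ Inl k = complex_of_real (\<mu> * e / u\<^sup>2) * cnj (p $ Inr j') * p $ Inl k"
    "G $ Inr j' $ Inr k' = complex_of_real (1 / u) * (if j' = k' then 1 else 0) + complex_of_real (1 / u\<^sup>2) * cnj (p $ Inr j') * p $ Inr k'" for j k j' k'
    unfolding G_def A_def e_def u_def s_def by (rule cHess_Phi[OF p])+
  have ws: "(\<Sum>k\<in>UNIV. p $ Inr k * cnj (p $ Inr k)) = complex_of_real s"
    by (simp add: s_def sqn_def wpart_def flip: complex_norm_square)
  define a where "a = case_sum (\<lambda>j. - complex_of_real \<mu> * cnj (p $ Inl j)) (\<lambda>_::'m. 0)"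
  define b where "b = case_sum (\<lambda>_::'n. 0) (\<lambda>k. p $ Inr k)"
  define d where "d = case_sum (\<lambda>_::'n. complex_of_real A) (\<lambda>_::'m. complex_of_real (1 / u))"
  define x where "x = case_sum (\<lambda>_::'n. 0) (\<lambda>k. cnj (p $ Inr k))"
  define y where "y = case_sum (\<lambda>j. complex_of_real (\<mu> * e / u\<^sup>2) * p $ Inl j) (\<lambda>k. complex_of_real (1 / u\<^sup>2) * p $ Inr k)"
  \<comment> \<open>The vectors a and b are supported on complementary blocks, so this row operation
    has determinant 1.\<close>
  define L :: "complex^('n + 'm)^('n + 'm)" where "L = (\<chi> i j. (if i = j then 1 else 0) + a i * b j)"
  have "det L = 1"
    unfolding L_def det_identity_plus_rank_one by (simp add: sum_UNIV_sum a_def b_def)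
  define C where "C = (\<lambda>j. \<Sum>k\<in>UNIV. p $ Inr k * G $ Inr k $ j)"
  have LG: "(L ** G) $ i $ j = G $ i $ j + a i * C j" for i j
  proof -
    have "(L ** G) $ i $ j = G $ i $ j + a i * (\<Sum>l\<in>UNIV. b l * G $ l $ j)"
      by (simp add: L_def matrix_matrix_mult_def distrib_right sum.distrib sum_distrib_left mult.assoc
          if_distrib[of "\<lambda>z. z * _"] cong: if_cong)
    then show ?thesis by (simp add: sum_UNIV_sum b_def C_def)
  qed
  have c1: "(\<Sum>k\<in>UNIV. p $ Inr k * G $ Inr k $ Inl l) = complex_of_real (\<mu> * e * s / u\<^sup>2) * p $ Inl l" for l
  proof -
    have "(\<Sum>k\<in>UNIV. p $ Inr k * G $ Inr k $ Inl l) = (\<Sum>k\<in>UNIV. p $ Inr k * cnj (p $ Inr k)) * (complex_of_real (\<mu> * e / u\<^sup>2) * p $ Inl l)"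
      unfolding G sum_distrib_right by (rule sum.cong) (simp_all only: mult_ac)
    then show ?thesis unfolding ws by simp
  qed
  have c2: "(\<Sum>k\<in>UNIV. p $ Inr k * G $ Inr k $ Inr l) = complex_of_real (e / u\<^sup>2) * p $ Inr l" for l
  proof -
    have "(\<Sum>k\<in>UNIV. p $ Inr k * G $ Inr k $ Inr l) = (\<Sum>k\<in>UNIV. if k = l then complex_of_real (1 / u) * p $ Inr l else 0)
        + (\<Sum>k\<in>UNIV. p $ Inr k * cnj (p $ Inr k)) * (complex_of_real (1 / u\<^sup>2) * p $ Inr l)"
      unfolding G sum_distrib_right sum.distrib[symmetric] by (rule sum.cong) (simp_all add: algebra_simps)
    also have "\<dots> = complex_of_real (1 / u + s / u\<^sup>2) * p $ Inr l"
      unfolding ws by (simp add: algebra_simps)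
    also have "1 / u + s / u\<^sup>2 = e / u\<^sup>2" using u by (simp add: us field_simps power2_eq_square)
    finally show ?thesis .
  qed
  have C: "C (Inl l) = complex_of_real (\<mu> * e * s / u\<^sup>2) * p $ Inl l" "C (Inr l') = complex_of_real (e / u\<^sup>2) * p $ Inr l'" for l l'
    unfolding C_def by (rule c1 c2)+
  \<comment> \<open>In the upper rows the rank one part of the z-block and the whole mixed block
    cancel against -\<mu> cnj z_j times the combined lower rows; only the multiple A of the identity
    survives.\<close>
  have "L ** G = (\<chi> i j. (if i = j then d i else 0) + x i * y j)"
  proof -
    have "(L ** G) $ i $ j = (if i = j then d i else 0) + x i * y j" for i j
      unfolding LG by (cases i; cases j) (simp_all add: C G a_def d_def x_def y_def power2_eq_square)
    then show ?thesis by (simp add: vec_eq_iff)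
  qed
  then have "det G = det (\<chi> i j. (if i = j then d i else 0) + x i * y j)"
    using det_mul[of L G] \<open>det L = 1\<close> by simp
  also have "\<dots> = (\<Prod>i\<in>UNIV. d i) * (1 + (\<Sum>i\<in>UNIV. x i * y i / d i))"
    by (rule det_diagonal_plus_rank_one) (use A u in \<open>auto simp: d_def split: sum.splits\<close>)
  also have "(\<Prod>i\<in>UNIV. d i) = complex_of_real (A ^ CARD('n) * (1 / u) ^ CARD('m))"
    by (subst UNIV_sum, subst prod.union_disjoint) (auto simp: prod.reindex d_def)
  also have "(\<Sum>i\<in>UNIV. x i * y i / d i) = (\<Sum>k\<in>UNIV. p $ Inr k * cnj (p $ Inr k)) * complex_of_real (1 / u)"
    using u by (simp add: sum_UNIV_sum x_def y_def d_def sum_divide_distrib power2_eq_square mult_ac)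
  also have "1 + \<dots> = complex_of_real (e / u)"
    unfolding ws using u by (simp add: us add_divide_distrib)
  finally show ?thesis
    unfolding G_def A_def e_def u_def by (simp only: of_real_mult)
qed

lemma volden_Phi:
  fixes p :: "complex^('n::finite + 'm::finite)"
  assumes "p \<in> Dom \<mu>" "\<mu> > 0" "\<nu> > -1"
  shows "volden (Phi \<mu> \<nu>) p =
    zcoef \<mu> \<nu> p ^ CARD('n) * (1 / gap \<mu> p) ^ CARD('m) * (expz \<mu> p / gap \<mu> p) / pi ^ (CARD('n) + CARD('m))"
  unfolding volden_def det_cHess_Phi[OF assms] by simp

section \<open>Radial integrals\<close>

text \<open>The Erlang density without its exponential. The normalisation by k! makes convolution
  add the shapes k + 1 without further constants.\<close>

definition gamma_kernel :: "nat \<Rightarrow> real \<Rightarrow> ennreal" where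
  "gamma_kernel k x = ennreal (indicator {0..} x * x ^ k / fact k)"

lemma gamma_kernel_measurable [measurable]: "gamma_kernel k \<in> borel_measurable borel"
  unfolding gamma_kernel_def[abs_def] by measurable

lemma gamma_kernel_erlang: "gamma_kernel k x = ennreal (exp x) * ennreal (erlang_density k 1 x)"
  by (auto simp: gamma_kernel_def erlang_density_def indicator_def exp_minus field_simps simp flip: ennreal_mult)

text \<open>The exponential factors of two Erlang densities of rate 1 multiply to that of the sum,
  so their convolution formula transfers; Fubini and a translation bring the double integral into
  convolution form.\<close>

lemma gamma_kernel_convolution:
  assumes [measurable]: "\<phi> \<in> borel_measurable borel"
  shows "(\<integral>\<^sup>+s. (\<integral>\<^sup>+t. \<phi> (s + t) * gamma_kernel p t \<partial>lborel) * gamma_kernel k s \<partial>lborel)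
    = (\<integral>\<^sup>+x. \<phi> x * gamma_kernel (Suc (k + p)) x \<partial>lborel)"
proof -
  have conv: "(\<integral>\<^sup>+t. gamma_kernel k (x - t) * gamma_kernel p t \<partial>lborel) = gamma_kernel (Suc (k + p)) x" for x
  proof -
    have "gamma_kernel k (x - t) * gamma_kernel p t = ennreal (exp x) * (ennreal (erlang_density k 1 (x - t)) * ennreal (erlang_density p 1 t))" for t
      unfolding gamma_kernel_erlang by (simp add: exp_diff mult_ac flip: ennreal_mult)
    then have "(\<integral>\<^sup>+t. gamma_kernel k (x - t) * gamma_kernel p t \<partial>lborel)
        = ennreal (exp x) * (\<integral>\<^sup>+t. ennreal (erlang_density k 1 (x - t)) * ennreal (erlang_density p 1 t) \<partial>lborel)"
      by (simp add: nn_integral_cmult)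
    also have "(\<integral>\<^sup>+t. ennreal (erlang_density k 1 (x - t)) * ennreal (erlang_density p 1 t) \<partial>lborel) = ennreal (erlang_density (Suc k + Suc p - 1) 1 x)"
      by (rule fun_cong[OF convolution_erlang_density]) simp
    finally show ?thesis by (simp add: gamma_kernel_erlang)
  qed
  have "(\<integral>\<^sup>+s. (\<integral>\<^sup>+t. \<phi> (s + t) * gamma_kernel p t \<partial>lborel) * gamma_kernel k s \<partial>lborel)
      = (\<integral>\<^sup>+s. (\<integral>\<^sup>+t. \<phi> (s + t) * gamma_kernel p t * gamma_kernel k s \<partial>lborel) \<partial>lborel)"
    by (simp add: nn_integral_multc)
  also have "\<dots> = (\<integral>\<^sup>+t. (\<integral>\<^sup>+s. \<phi> (s + t) * gamma_kernel p t * gamma_kernel k s \<partial>lborel) \<partial>lborel)"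
    by (rule lborel_pair.Fubini') measurable
  also have "\<dots> = (\<integral>\<^sup>+t. (\<integral>\<^sup>+x. \<phi> x * gamma_kernel p t * gamma_kernel k (x - t) \<partial>lborel) \<partial>lborel)"
  proof (rule nn_integral_cong)
    fix t
    show "(\<integral>\<^sup>+s. \<phi> (s + t) * gamma_kernel p t * gamma_kernel k s \<partial>lborel) = (\<integral>\<^sup>+x. \<phi> x * gamma_kernel p t * gamma_kernel k (x - t) \<partial>lborel)"
      using nn_integral_real_affine[of "\<lambda>x. \<phi> x * gamma_kernel p t * gamma_kernel k (x - t)" 1 t] by (simp add: add.commute)
  qed
  also have "\<dots> = (\<integral>\<^sup>+x. (\<integral>\<^sup>+t. \<phi> x * gamma_kernel p t * gamma_kernel k (x - t) \<partial>lborel) \<partial>lborel)"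
    by (rule lborel_pair.Fubini') measurable
  also have "\<dots> = (\<integral>\<^sup>+x. \<phi> x * (\<integral>\<^sup>+t. gamma_kernel k (x - t) * gamma_kernel p t \<partial>lborel) \<partial>lborel)"
    by (subst nn_integral_cmult[symmetric]) (auto simp: mult_ac)
  finally show ?thesis by (simp add: conv)
qed

lemma nn_integral_radial_complex:
  assumes [measurable]: "\<phi> \<in> borel_measurable borel"
  shows "(\<integral>\<^sup>+z. \<phi> ((cmod z)\<^sup>2) * ennreal (cmod z ^ (2 * p)) \<partial>lborel)
    = ennreal (pi * fact p) * (\<integral>\<^sup>+t. \<phi> t * gamma_kernel p t \<partial>lborel)"
proof -
  have "(\<integral>\<^sup>+z. \<phi> ((cmod z)\<^sup>2) * ennreal (cmod z ^ (2 * p)) \<partial>lborel)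
      = (\<integral>\<^sup>+z. \<phi> ((cmod z)\<^sup>2) * ennreal (((cmod z)\<^sup>2) ^ p) \<partial>lborel)"
    by (simp add: power_mult)
  also have "\<dots> = (\<integral>\<^sup>+t. \<phi> t * ennreal (t ^ p) \<partial>distr lborel borel (\<lambda>z::complex. (cmod z)\<^sup>2))"
    by (subst nn_integral_distr) auto
  also have "\<dots> = (\<integral>\<^sup>+t. ennreal pi * indicator {0..} t * (\<phi> t * ennreal (t ^ p)) \<partial>lborel)"
    unfolding distr_cmod_sq by (subst nn_integral_density) auto
  also have "\<dots> = (\<integral>\<^sup>+t. ennreal (pi * fact p) * (\<phi> t * gamma_kernel p t) \<partial>lborel)"
  proof (rule nn_integral_cong)
    fix t :: real
    show "ennreal pi * indicator {0..} t * (\<phi> t * ennreal (t ^ p)) = ennreal (pi * fact p) * (\<phi> t * gamma_kernel p t)"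
    proof (cases "t \<ge> 0")
      case True
      have "ennreal (pi * fact p) * ennreal (t ^ p / fact p) = ennreal pi * ennreal (t ^ p)"
        using True by (subst (1 2) ennreal_mult[symmetric]) auto
      then show ?thesis using True by (simp add: gamma_kernel_def mult_ac)
    qed (simp add: gamma_kernel_def)
  qed
  also have "\<dots> = ennreal (pi * fact p) * (\<integral>\<^sup>+t. \<phi> t * gamma_kernel p t \<partial>lborel)"
    by (rule nn_integral_cmult) measurable
  finally show ?thesis .
qed

text \<open>A Dirichlet integral, by induction on the coordinates: with t = |x_j|^2, coordinate j
  contributes pi p_j! times the kernel of index p_j. Convolution adds the shapes p_j + 1, whence the
  final index sum p + card J - 1.\<close>

lemma nn_integral_radial_PiM:
  fixes \<phi> :: "real \<Rightarrow> ennreal" and p :: "'k \<Rightarrow> nat"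
  assumes "finite J" "J \<noteq> {}" "\<phi> \<in> borel_measurable borel"
  shows "(\<integral>\<^sup>+x. \<phi> (\<Sum>j\<in>J. (cmod (x j))\<^sup>2) * ennreal (\<Prod>j\<in>J. cmod (x j) ^ (2 * p j)) \<partial>PiM J (\<lambda>_. lborel))
    = ennreal (\<Prod>j\<in>J. pi * fact (p j)) * (\<integral>\<^sup>+t. \<phi> t * gamma_kernel (sum p J + card J - 1) t \<partial>lborel)"
  using assms
proof (induction J arbitrary: \<phi> rule: finite_ne_induct)
  case (singleton i)
  note [measurable] = singleton
  interpret product_sigma_finite "\<lambda>_::'k. lborel :: complex measure" by standard
  show ?case
    using product_nn_integral_singleton[of "\<lambda>z. \<phi> ((cmod z)\<^sup>2) * ennreal (cmod z ^ (2 * p i))" i]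
    by (simp add: nn_integral_radial_complex)
next
  case (insert i J)
  note [measurable] = insert.prems
  interpret product_sigma_finite "\<lambda>_::'k. lborel :: complex measure" by standard
  define \<psi> where "\<psi> = (\<lambda>s. \<integral>\<^sup>+t. \<phi> (s + t) * gamma_kernel (p i) t \<partial>lborel)"
  have [measurable]: "\<psi> \<in> borel_measurable borel" unfolding \<psi>_def by measurable
  let ?F = "\<lambda>J x. \<phi> (\<Sum>j\<in>J. (cmod (x j))\<^sup>2) * ennreal (\<Prod>j\<in>J. cmod (x j) ^ (2 * p j))"
  have "(\<integral>\<^sup>+x. ?F (insert i J) x \<partial>PiM (insert i J) (\<lambda>_. lborel))
      = (\<integral>\<^sup>+x. \<integral>\<^sup>+z. ?F (insert i J) (x(i := z)) \<partial>lborel \<partial>PiM J (\<lambda>_. lborel))"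
    using insert.hyps by (intro product_nn_integral_insert) auto
  also have "\<dots> = (\<integral>\<^sup>+x. ennreal (pi * fact (p i)) * (\<psi> (\<Sum>j\<in>J. (cmod (x j))\<^sup>2) * ennreal (\<Prod>j\<in>J. cmod (x j) ^ (2 * p j))) \<partial>PiM J (\<lambda>_. lborel))"
  proof (rule nn_integral_cong)
    fix x :: "'k \<Rightarrow> complex"
    let ?S = "\<Sum>j\<in>J. (cmod (x j))\<^sup>2" and ?P = "\<Prod>j\<in>J. cmod (x j) ^ (2 * p j)"
    have 1: "(\<Sum>j\<in>J. (cmod ((x(i := z)) j))\<^sup>2) = ?S" for z
      using insert.hyps by (intro sum.cong) auto
    have 2: "(\<Prod>j\<in>J. cmod ((x(i := z)) j) ^ (2 * p j)) = ?P" for z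
      using insert.hyps by (intro prod.cong) auto
    have "?F (insert i J) (x(i := z)) = (\<phi> (?S + (cmod z)\<^sup>2) * ennreal (cmod z ^ (2 * p i))) * ennreal ?P" for z
    proof -
      have "?F (insert i J) (x(i := z)) = \<phi> ((cmod z)\<^sup>2 + ?S) * ennreal (cmod z ^ (2 * p i) * ?P)"
        by (simp only: sum.insert[OF insert.hyps(1,3)] prod.insert[OF insert.hyps(1,3)] 1 2 fun_upd_same)
      then show ?thesis by (simp add: add.commute ennreal_mult prod_nonneg mult.assoc)
    qed
    then have "(\<integral>\<^sup>+z. ?F (insert i J) (x(i := z)) \<partial>lborel)
        = (\<integral>\<^sup>+z. \<phi> (?S + (cmod z)\<^sup>2) * ennreal (cmod z ^ (2 * p i)) \<partial>lborel) * ennreal ?P"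
      by (simp add: nn_integral_multc)
    also have "(\<integral>\<^sup>+z. \<phi> (?S + (cmod z)\<^sup>2) * ennreal (cmod z ^ (2 * p i)) \<partial>lborel) = ennreal (pi * fact (p i)) * \<psi> ?S"
      using nn_integral_radial_complex[of "\<lambda>t. \<phi> (?S + t)" "p i"] by (simp add: \<psi>_def)
    finally show "(\<integral>\<^sup>+z. ?F (insert i J) (x(i := z)) \<partial>lborel) = ennreal (pi * fact (p i)) * (\<psi> ?S * ennreal ?P)"
      by (simp add: mult_ac)
  qed
  also have "\<dots> = ennreal (pi * fact (p i)) * (\<integral>\<^sup>+x. \<psi> (\<Sum>j\<in>J. (cmod (x j))\<^sup>2) * ennreal (\<Prod>j\<in>J. cmod (x j) ^ (2 * p j)) \<partial>PiM J (\<lambda>_. lborel))"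
    by (rule nn_integral_cmult) measurable
  also have "\<dots> = ennreal (pi * fact (p i)) * (ennreal (\<Prod>j\<in>J. pi * fact (p j)) * (\<integral>\<^sup>+t. \<psi> t * gamma_kernel (sum p J + card J - 1) t \<partial>lborel))"
    by (subst insert.IH) auto
  also have "(\<integral>\<^sup>+t. \<psi> t * gamma_kernel (sum p J + card J - 1) t \<partial>lborel) = (\<integral>\<^sup>+x. \<phi> x * gamma_kernel (Suc (sum p J + card J - 1 + p i)) x \<partial>lborel)"
    unfolding \<psi>_def by (rule gamma_kernel_convolution) measurable
  \<comment> \<open>The truncated subtraction is exact since J is nonempty, which is also why the
    induction starts from singletons.\<close>
  also have "Suc (sum p J + card J - 1 + p i) = sum p (insert i J) + card (insert i J) - 1"
  proof -
    have "card J > 0" using insert.hyps by (simp add: card_gt_0_iff)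
    then show ?thesis using insert.hyps by simp
  qed
  also have "ennreal (pi * fact (p i)) * (ennreal (\<Prod>j\<in>J. pi * fact (p j)) * X) = ennreal (\<Prod>j\<in>insert i J. pi * fact (p j)) * X" for X
    using insert.hyps by (simp add: ennreal_mult prod_nonneg mult.assoc)
  finally show ?case .
qed

lemma nn_integral_radial_vec:
  fixes \<phi> :: "real \<Rightarrow> ennreal" and p :: "'k::finite \<Rightarrow> nat"
  assumes [measurable]: "\<phi> \<in> borel_measurable borel"
  shows "(\<integral>\<^sup>+v. \<phi> (sqn v) * ennreal (\<Prod>j\<in>UNIV. cmod (v $ j) ^ (2 * p j)) \<partial>lborel)
    = ennreal (\<Prod>j\<in>UNIV. pi * fact (p j)) * (\<integral>\<^sup>+t. \<phi> t * gamma_kernel (sum p UNIV + CARD('k) - 1) t \<partial>lborel)"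
proof -
  have [measurable]: "(\<lambda>v::complex^'k. sqn v) \<in> borel_measurable borel" unfolding sqn_def by measurable
  show ?thesis
    using nn_integral_radial_PiM[of UNIV \<phi> p] by (subst nn_integral_vec) (auto simp: sqn_def)
qed

section \<open>Norms of the monomials and the kernel\<close>

definition chi_denom :: "nat \<Rightarrow> nat \<Rightarrow> real \<Rightarrow> real \<Rightarrow> nat \<Rightarrow> real" where
  "chi_denom n m \<nu> a s =
     (\<Sum>d=0..n. real (n choose d) * \<nu> ^ (n - d) * Gamma (a - real m - real d) / Gamma (a - real d + real s))"

text \<open>Each term of the binomial expansion of (\<nu> + 1/(1-t))^n is a Beta integral with
  second parameter \<alpha> - m - d, positive for all d \<le> n by the hypothesis on \<alpha>.
  Division by (s+m-1)! cancels the first Gamma factor.\<close>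

lemma chi_denom_has_integral:
  fixes \<nu> \<alpha> :: real
  assumes \<alpha>: "\<alpha> > real (n + m)" and m: "m \<ge> 1"
  shows "((\<lambda>t. (\<nu> + 1 / (1 - t)) ^ n * (1 - t) powr (\<alpha> - real m - 1) * t ^ (s + m - 1) / fact (s + m - 1))
    has_integral chi_denom n m \<nu> \<alpha> s) {0<..<1}"
proof -
  let ?k = "s + m - 1"
  have "((\<lambda>t. real (n choose d) * \<nu> ^ (n - d) / fact ?k * (t powr (real ?k + 1 - 1) * (1 - t) powr (\<alpha> - real m - real d - 1)))
      has_integral real (n choose d) * \<nu> ^ (n - d) / fact ?k * Beta (real ?k + 1) (\<alpha> - real m - real d)) {0<..<1}" if "d \<le> n" for d
    using has_integral_Beta_real[of "real ?k + 1" "\<alpha> - real m - real d"] that \<alpha>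
    by (intro has_integral_mult_right) (simp add: has_integral_Icc_iff_Ioo)
  then have "((\<lambda>t. \<Sum>d=0..n. real (n choose d) * \<nu> ^ (n - d) / fact ?k * (t powr (real ?k + 1 - 1) * (1 - t) powr (\<alpha> - real m - real d - 1)))
      has_integral (\<Sum>d=0..n. real (n choose d) * \<nu> ^ (n - d) / fact ?k * Beta (real ?k + 1) (\<alpha> - real m - real d))) {0<..<1}"
    by (intro has_integral_sum) auto
  also have "(\<Sum>d=0..n. real (n choose d) * \<nu> ^ (n - d) / fact ?k * Beta (real ?k + 1) (\<alpha> - real m - real d)) = chi_denom n m \<nu> \<alpha> s"
    unfolding chi_denom_def
  proof (rule sum.cong)
    fix d
    have 1: "real ?k + 1 + (\<alpha> - real m - real d) = \<alpha> - real d + real s" using m by (simp add: of_nat_diff)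
    have 2: "Gamma (real ?k + 1) = fact ?k" by (metis Gamma_fact add.commute)
    show "real (n choose d) * \<nu> ^ (n - d) / fact ?k * Beta (real ?k + 1) (\<alpha> - real m - real d)
      = real (n choose d) * \<nu> ^ (n - d) * Gamma (\<alpha> - real m - real d) / Gamma (\<alpha> - real d + real s)"
      unfolding Beta_def 1 2 by simp
  qed simp
  finally show ?thesis
  proof (rule has_integral_eq[rotated])
    fix t :: real assume t: "t \<in> {0<..<1}"
    have bin: "(\<nu> + 1 / (1 - t)) ^ n = (\<Sum>d=0..n. real (n choose d) * \<nu> ^ (n - d) * (1 / (1 - t)) ^ d)"
      by (subst add.commute, subst binomial_ring) (simp add: atLeast0AtMost mult_ac)
    have "(\<nu> + 1 / (1 - t)) ^ n * (1 - t) powr (\<alpha> - real m - 1) * t ^ ?k / fact ?k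
      = (\<Sum>d=0..n. real (n choose d) * \<nu> ^ (n - d) / fact ?k * (t ^ ?k * ((1 / (1 - t)) ^ d * (1 - t) powr (\<alpha> - real m - 1))))"
      unfolding bin sum_distrib_right sum_divide_distrib by (rule sum.cong) (simp_all add: mult_ac)
    also have "\<dots> = (\<Sum>d=0..n. real (n choose d) * \<nu> ^ (n - d) / fact ?k * (t powr (real ?k + 1 - 1) * (1 - t) powr (\<alpha> - real m - real d - 1)))"
    proof (rule sum.cong)
      fix d
      have "(1 - t) powr (\<alpha> - real m - real d - 1) = (1 - t) powr (\<alpha> - real m - 1) / (1 - t) ^ d"
        using t by (simp add: powr_realpow[symmetric] powr_diff[symmetric] algebra_simps)
      then show "real (n choose d) * \<nu> ^ (n - d) / fact ?k * (t ^ ?k * ((1 / (1 - t)) ^ d * (1 - t) powr (\<alpha> - real m - 1)))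
        = real (n choose d) * \<nu> ^ (n - d) / fact ?k * (t powr (real ?k + 1 - 1) * (1 - t) powr (\<alpha> - real m - real d - 1))"
        using t by (simp add: powr_realpow power_divide)
    qed simp
    finally show "(\<Sum>d=0..n. real (n choose d) * \<nu> ^ (n - d) / fact ?k * (t powr (real ?k + 1 - 1) * (1 - t) powr (\<alpha> - real m - real d - 1)))
      = (\<nu> + 1 / (1 - t)) ^ n * (1 - t) powr (\<alpha> - real m - 1) * t ^ ?k / fact ?k" ..
  qed
qed

section \<open>The weight in radial variables\<close>

text \<open>The weight as a function of r = |z|^2 and s = |w|^2. As a total expression it is
  measurable everywhere, although it represents the weight only inside the domain.\<close>

definition wt_profile :: "nat \<Rightarrow> nat \<Rightarrow> real \<Rightarrow> real \<Rightarrow> real \<Rightarrow> real \<Rightarrow> real \<Rightarrow> real" where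
  "wt_profile n m \<mu> \<nu> \<alpha> r s =
     exp (- \<alpha> * (\<nu> * \<mu> * r - ln (exp (- \<mu> * r) - s))) *
     ((\<nu> * \<mu> + \<mu> * exp (- \<mu> * r) / (exp (- \<mu> * r) - s)) ^ n * (1 / (exp (- \<mu> * r) - s)) ^ m *
      (exp (- \<mu> * r) / (exp (- \<mu> * r) - s)) / pi ^ (n + m))"

lemma wt_profile_measurable [measurable (raw)]:
  assumes [measurable]: "f \<in> borel_measurable M" "g \<in> borel_measurable M"
  shows "(\<lambda>x. wt_profile n m \<mu> \<nu> \<alpha> (f x) (g x)) \<in> borel_measurable M"
  unfolding wt_profile_def by measurable

lemma wt_Phi:
  fixes Z :: "complex^('n::finite + 'm::finite)"
  assumes "Z \<in> Dom \<mu>" "\<mu> > 0" "\<nu> > -1"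
  shows "wt \<alpha> (Phi \<mu> \<nu>) Z = wt_profile CARD('n) CARD('m) \<mu> \<nu> \<alpha> (sqn (zpart Z)) (sqn (wpart Z))"
  unfolding wt_def volden_Phi[OF assms] wt_profile_def Phi_def zcoef_def gap_def expz_def ..

lemma wt_Phi_pos:
  fixes Z :: "complex^('n::finite + 'm::finite)"
  assumes "Z \<in> Dom \<mu>" "\<mu> > 0" "\<nu> > -1"
  shows "wt \<alpha> (Phi \<mu> \<nu>) Z > 0"
  unfolding wt_def volden_Phi[OF assms]
  using zcoef_pos[OF assms] gap_pos[OF assms(1)] by (simp add: expz_def)

text \<open>Substitution |w|^2 = e^(-\<mu>r) t, with the leading exponential as Jacobian. Write e =
  e^(-\<mu>r): the weight exponential gives e^((\<nu>+1)\<alpha>), Jacobian and radial kernel give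
  e^(s+m), and the power of 1/gap removes e^m.\<close>

lemma wt_profile_scaled:
  assumes t: "t < 1" and m: "m \<ge> 1"
  shows "exp (- \<mu> * r) * (wt_profile n m \<mu> \<nu> \<alpha> r (exp (- \<mu> * r) * t) * ((exp (- \<mu> * r) * t) ^ (s + m - 1) / fact (s + m - 1)))
    = exp (- \<mu> * ((\<nu> + 1) * \<alpha> + real s) * r) * (\<mu> ^ n / pi ^ (n + m)) *
      ((\<nu> + 1 / (1 - t)) ^ n * (1 - t) powr (\<alpha> - real m - 1) * t ^ (s + m - 1) / fact (s + m - 1))"
proof -
  define e where "e = exp (- \<mu> * r)"
  define k where "k = s + m - 1"
  have e: "e > 0" by (simp add: e_def)
  have ln_e: "ln e = - \<mu> * r" by (simp add: e_def)
  have k: "e * e ^ k = e ^ s * e ^ m" using m by (simp add: k_def flip: power_add power_Suc)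
  have u: "e - e * t = e * (1 - t)" by (simp add: algebra_simps)
  have A: "\<nu> * \<mu> + \<mu> * e / (e * (1 - t)) = \<mu> * (\<nu> + 1 / (1 - t))" using e t by (simp add: field_simps)
  have E: "exp (- \<alpha> * (\<nu> * \<mu> * r - ln (e * (1 - t)))) = exp (- \<mu> * ((\<nu> + 1) * \<alpha>) * r) * (1 - t) powr \<alpha>"
  proof -
    have "- \<alpha> * (\<nu> * \<mu> * r - ln (e * (1 - t))) = - \<mu> * ((\<nu> + 1) * \<alpha>) * r + \<alpha> * ln (1 - t)"
    proof -
      have "ln (e * (1 - t)) = - \<mu> * r + ln (1 - t)" using e t by (subst ln_mult) (auto simp: ln_e)
      then show ?thesis by (simp only:) (simp add: algebra_simps)
    qed
    from arg_cong[OF this, of exp] show ?thesis unfolding exp_add using t by (simp add: powr_def)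
  qed
  have P: "(1 - t) powr (\<alpha> - real m - 1) = (1 - t) powr \<alpha> / ((1 - t) ^ m * (1 - t))"
    using t by (simp add: powr_realpow[symmetric] powr_diff powr_add)
  have S: "exp (- \<mu> * ((\<nu> + 1) * \<alpha> + real s) * r) = exp (- \<mu> * ((\<nu> + 1) * \<alpha>) * r) * e ^ s"
    by (simp add: e_def algebra_simps flip: exp_of_nat_mult exp_add)
  have "e * (wt_profile n m \<mu> \<nu> \<alpha> r (e * t) * ((e * t) ^ k / fact k))
     = (e * e ^ k) * (exp (- \<mu> * ((\<nu> + 1) * \<alpha>) * r) * (1 - t) powr \<alpha> * ((\<mu> * (\<nu> + 1 / (1 - t))) ^ n * (1 / (e * (1 - t))) ^ m * (1 / (1 - t)) / pi ^ (n + m)) * (t ^ k / fact k))"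
    unfolding wt_profile_def e_def[symmetric] u A E using e t by (simp add: power_mult_distrib)
  also have "\<dots> = (exp (- \<mu> * ((\<nu> + 1) * \<alpha>) * r) * e ^ s) * (\<mu> ^ n / pi ^ (n + m)) *
      ((\<nu> + 1 / (1 - t)) ^ n * ((1 - t) powr \<alpha> / ((1 - t) ^ m * (1 - t))) * t ^ k / fact k)"
    unfolding k using e by (simp add: power_mult_distrib power_divide mult_ac)
  finally show ?thesis unfolding S P e_def[symmetric] k_def[symmetric] .
qed

text \<open>For negative \<nu> the summands alternate in sign, so nonnegativity is read off from the
  integral representation, where \<nu> + 1/(1-t) is positive.\<close>

lemma chi_denom_nonneg:
  assumes "\<alpha> > real (n + m)" "m \<ge> 1" "\<nu> > -1"
  shows "chi_denom n m \<nu> \<alpha> s \<ge> 0"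
proof (rule has_integral_nonneg[OF chi_denom_has_integral[OF assms(1,2)]])
  fix t :: real assume t: "t \<in> {0<..<1}"
  have "1 / (1 - t) \<ge> 1" using t by simp
  then have "\<nu> + 1 / (1 - t) \<ge> 0" using assms(3) by linarith
  then show "0 \<le> (\<nu> + 1 / (1 - t)) ^ n * (1 - t) powr (\<alpha> - real m - 1) * t ^ (s + m - 1) / fact (s + m - 1)"
    using t by simp
qed

lemma nn_integral_wt_profile:
  assumes \<alpha>: "\<alpha> > real (n + m)" and m: "m \<ge> 1" and \<nu>: "\<nu> > -1" and \<mu>: "\<mu> > 0"
  shows "(\<integral>\<^sup>+x. (if x < exp (- \<mu> * r) then ennreal (wt_profile n m \<mu> \<nu> \<alpha> r x) else 0) * gamma_kernel (s + m - 1) x \<partial>lborel)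
    = ennreal (exp (- \<mu> * ((\<nu> + 1) * \<alpha> + real s) * r) * (\<mu> ^ n / pi ^ (n + m)) * chi_denom n m \<nu> \<alpha> s)"
proof -
  define e where "e = exp (- \<mu> * r)"
  define k where "k = s + m - 1"
  define c where "c = exp (- \<mu> * ((\<nu> + 1) * \<alpha> + real s) * r) * (\<mu> ^ n / pi ^ (n + m))"
  define h where "h = (\<lambda>t. (\<nu> + 1 / (1 - t)) ^ n * (1 - t) powr (\<alpha> - real m - 1) * t ^ k / fact k)"
  have e: "e > 0" by (simp add: e_def)
  have c: "c \<ge> 0" using \<mu> by (simp add: c_def)
  have h0: "h t \<ge> 0" if "t \<in> {0<..<1}" for t
  proof -
    have "1 / (1 - t) \<ge> 1" using that by simp
    then have "\<nu> + 1 / (1 - t) \<ge> 0" using \<nu> by linarith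
    then show ?thesis using that by (simp add: h_def)
  qed
  let ?f = "\<lambda>x. (if x < e then ennreal (wt_profile n m \<mu> \<nu> \<alpha> r x) else 0) * gamma_kernel k x"
  have "(\<integral>\<^sup>+x. ?f x \<partial>lborel) = ennreal \<bar>e\<bar> * (\<integral>\<^sup>+t. ?f (0 + e * t) \<partial>lborel)"
    by (rule nn_integral_real_affine) (use e in \<open>measurable, auto\<close>)
  also have "\<dots> = ennreal e * (\<integral>\<^sup>+t. ?f (e * t) \<partial>lborel)"
    by (simp only: add_0_left abs_of_pos[OF e])
  also have "\<dots> = (\<integral>\<^sup>+t. ennreal e * ?f (e * t) \<partial>lborel)"
    by (rule nn_integral_cmult[symmetric]) measurable
  also have "\<dots> = (\<integral>\<^sup>+t. ennreal (if t \<in> {0<..<1} then c * h t else 0) \<partial>lborel)"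
  proof (rule nn_integral_cong_AE)
    \<comment> \<open>The point t = 0 must be discarded: for s = 0 and m = 1 the kernel has index 0
      and does not vanish there, whereas the Beta integrand is restricted to the open
      interval.\<close>
    show "AE t in lborel. ennreal e * ?f (e * t) = ennreal (if t \<in> {0<..<1} then c * h t else 0)"
      using AE_lborel_singleton[of 0]
    proof eventually_elim
      case (elim t)
      have *: "e * t < e \<longleftrightarrow> t < 1" "0 \<le> e * t \<longleftrightarrow> 0 \<le> t" using e by (auto simp: zero_le_mult_iff)
      show ?case
      proof (cases "t \<in> {0<..<1}")
        case True
        have p: "wt_profile n m \<mu> \<nu> \<alpha> r (e * t) \<ge> 0"
        proof -
          have "e - e * t > 0" using True e by (simp add: *)
          moreover have "\<nu> * \<mu> + \<mu> * e / (e - e * t) \<ge> 0"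
          proof -
            have "e / (e - e * t) \<ge> 1" using True e \<open>e - e * t > 0\<close> by simp
            then have "\<mu> * (\<nu> + e / (e - e * t)) \<ge> 0" using \<mu> \<nu> by (intro mult_nonneg_nonneg) auto
            then show ?thesis by (simp add: algebra_simps)
          qed
          ultimately show ?thesis using e unfolding wt_profile_def e_def[symmetric] by simp
        qed
        have "ennreal e * ?f (e * t) = ennreal (e * (wt_profile n m \<mu> \<nu> \<alpha> r (e * t) * ((e * t) ^ k / fact k)))"
        proof -
          have q: "(e * t) ^ k / fact k \<ge> 0" using True e by simp
          have "?f (e * t) = ennreal (wt_profile n m \<mu> \<nu> \<alpha> r (e * t)) * ennreal ((e * t) ^ k / fact k)"
            using True e by (simp add: * gamma_kernel_def less_imp_le)
          then show ?thesis
            using e p q by (simp only: ennreal_mult[OF less_imp_le[OF e] mult_nonneg_nonneg[OF p q]] ennreal_mult[OF p q])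
        qed
        also have "\<dots> = ennreal (c * h t)"
          using wt_profile_scaled[of t m \<mu> r n \<nu> \<alpha> s] True m by (simp add: e_def k_def c_def h_def)
        finally show ?thesis using True by simp
      qed (use elim * in \<open>auto simp: gamma_kernel_def\<close>)
    qed
  qed
  also have "\<dots> = ennreal (c * chi_denom n m \<nu> \<alpha> s)"
  proof (rule nn_integral_has_integral_lborel)
    show "(\<lambda>t. if t \<in> {0<..<1} then c * h t else 0) \<in> borel_measurable borel"
      unfolding h_def by measurable
    show "((\<lambda>t. if t \<in> {0<..<1} then c * h t else 0) has_integral c * chi_denom n m \<nu> \<alpha> s) UNIV"
      unfolding has_integral_restrict_UNIV h_def k_def
      by (intro has_integral_mult_right chi_denom_has_integral \<alpha> m)
  qed (use c h0 in auto)
  finally show ?thesis by (simp only: e_def k_def c_def)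
qed

lemma nn_integral_exp_gamma_kernel:
  assumes l: "l > 0"
  shows "(\<integral>\<^sup>+r. ennreal (exp (- l * r)) * gamma_kernel k r \<partial>lborel) = ennreal (1 / l ^ Suc k)"
proof -
  have "ennreal (exp (- l * r)) * gamma_kernel k r = ennreal (1 / l ^ Suc k) * ennreal (erlang_density k l r)" for r
    using l by (auto simp: gamma_kernel_def erlang_density_def indicator_def simp flip: ennreal_mult)
  then have "(\<integral>\<^sup>+r. ennreal (exp (- l * r)) * gamma_kernel k r \<partial>lborel)
    = ennreal (1 / l ^ Suc k) * (\<integral>\<^sup>+r. ennreal (erlang_density k l r) \<partial>lborel)"
    by (simp add: nn_integral_cmult)
  also have "(\<integral>\<^sup>+r. ennreal (erlang_density k l r) \<partial>lborel) = 1"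
    using nn_integral_erlang_ith_moment[OF l, of k 0] by simp
  finally show ?thesis by simp
qed

text \<open>All powers of pi from the radial integrals cancel those of the volume density, and the
  factor \<mu>^n of the determinant leaves \<mu> with exponent |p| only, while (\<nu>+1)\<alpha> +
  |q| keeps exponent n + |p|.\<close>

definition monomial_norm :: "real \<Rightarrow> real \<Rightarrow> real \<Rightarrow> ('n::finite + 'm::finite \<Rightarrow> nat) \<Rightarrow> real" where
  "monomial_norm \<mu> \<nu> \<alpha> a =
     (\<Prod>j\<in>UNIV. fact (a (Inl j))) * (\<Prod>k\<in>UNIV. fact (a (Inr k))) *
     chi_denom CARD('n) CARD('m) \<nu> \<alpha> (\<Sum>k\<in>UNIV. a (Inr k)) /
     (((\<nu> + 1) * \<alpha> + real (\<Sum>k\<in>UNIV. a (Inr k))) ^ (CARD('n) + (\<Sum>j\<in>UNIV. a (Inl j))) * \<mu> ^ (\<Sum>j\<in>UNIV. a (Inl j)))"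

lemma sqn_measurable [measurable]: "(\<lambda>v::complex^'k::finite. sqn v) \<in> borel_measurable borel"
  unfolding sqn_def by measurable

lemma zpart_join [simp]: "zpart (join_vec z w) = z" and wpart_join [simp]: "wpart (join_vec z w) = w"
  by (simp_all add: zpart_def wpart_def vec_eq_iff)

lemma zpart_wpart_measurable [measurable]:
  "(\<lambda>Z::complex^('n::finite + 'm::finite). sqn (zpart Z)) \<in> borel_measurable borel"
  "(\<lambda>Z::complex^('n::finite + 'm::finite). sqn (wpart Z)) \<in> borel_measurable borel"
  by (intro borel_measurable_continuous_onI continuous_intros)+

lemma indicator_wt_Phi:
  fixes Z :: "complex^('n::finite + 'm::finite)"
  assumes "\<mu> > 0" "\<nu> > -1"
  shows "indicator (Dom \<mu>) Z * wt \<alpha> (Phi \<mu> \<nu>) Z =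
    (if sqn (wpart Z) < exp (- \<mu> * sqn (zpart Z)) then wt_profile CARD('n) CARD('m) \<mu> \<nu> \<alpha> (sqn (zpart Z)) (sqn (wpart Z)) else 0)"
  using wt_Phi[of Z \<mu> \<nu> \<alpha>] assms by (auto simp: Dom_def indicator_def)

text \<open>The w-integral is done first because its range depends on z. Its value depends on z only
  through an exponential in |z|^2, so the z-integral is a Gamma integral.\<close>

lemma nn_integral_monomial:
  fixes a :: "'n::finite + 'm::finite \<Rightarrow> nat"
  assumes \<mu>: "\<mu> > 0" and \<nu>: "\<nu> > -1" and \<alpha>: "\<alpha> > real (CARD('n) + CARD('m))"
  shows "(\<integral>\<^sup>+Y. indicator (Dom \<mu>) Y * ennreal (wt \<alpha> (Phi \<mu> \<nu>) Y * (cmod (mon a Y))\<^sup>2) \<partial>lborel)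
    = ennreal (monomial_norm \<mu> \<nu> \<alpha> a)"
proof -
  define n m where "n = CARD('n)" and "m = CARD('m)"
  define p where "p = (\<lambda>j. a (Inl j))"
  define q where "q = (\<lambda>k. a (Inr k))"
  define s where "s = sum q UNIV"
  define \<beta> where "\<beta> = (\<nu> + 1) * \<alpha> + real s"
  define \<Psi> where "\<Psi> = (\<lambda>r x. if x < exp (- \<mu> * r) then ennreal (wt_profile n m \<mu> \<nu> \<alpha> r x) else 0)"
  define P where "P = (\<lambda>z::complex^'n. \<Prod>j\<in>UNIV. cmod (z $ j) ^ (2 * p j))"
  define Q where "Q = (\<lambda>w::complex^'m. \<Prod>k\<in>UNIV. cmod (w $ k) ^ (2 * q k))"
  define c where "c = \<mu> ^ n / pi ^ (n + m) * chi_denom n m \<nu> \<alpha> s"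
  have nm: "n \<ge> 1" "m \<ge> 1" by (auto simp: n_def m_def Suc_le_eq)
  have \<alpha>': "\<alpha> > real (n + m)" using \<alpha> by (simp add: n_def m_def)
  have c: "c \<ge> 0" using chi_denom_nonneg[OF \<alpha>' nm(2) \<nu>] \<mu> by (simp add: c_def)
  have "\<alpha> > 0" using \<alpha>' by (meson le_less_trans of_nat_0_le_iff)
  then have \<beta>: "\<beta> > 0" using \<nu> by (simp add: \<beta>_def add_pos_nonneg)
  have PQ0: "P z \<ge> 0" "Q w \<ge> 0" for z w by (auto simp: P_def Q_def intro!: prod_nonneg)
  have [measurable]: "P \<in> borel_measurable borel" "Q \<in> borel_measurable borel"
    unfolding P_def Q_def by measurable
  have [measurable]: "(\<lambda>Y::complex^('n + 'm). indicator (Dom \<mu>) Y * ennreal (wt \<alpha> (Phi \<mu> \<nu>) Y * (cmod (mon a Y))\<^sup>2)) \<in> borel_measurable borel"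
  proof -
    have "(\<lambda>Y::complex^('n + 'm). ennreal ((indicator (Dom \<mu>) Y * wt \<alpha> (Phi \<mu> \<nu>) Y) * (cmod (mon a Y))\<^sup>2)) \<in> borel_measurable borel"
      unfolding indicator_wt_Phi[OF \<mu> \<nu>] by measurable
    also have "(\<lambda>Y::complex^('n + 'm). ennreal ((indicator (Dom \<mu>) Y * wt \<alpha> (Phi \<mu> \<nu>) Y) * (cmod (mon a Y))\<^sup>2))
      = (\<lambda>Y. indicator (Dom \<mu>) Y * ennreal (wt \<alpha> (Phi \<mu> \<nu>) Y * (cmod (mon a Y))\<^sup>2))"
      by (auto simp: fun_eq_iff indicator_def)
    finally show ?thesis .
  qed
  have eq: "indicator (Dom \<mu>) (join_vec z w) * ennreal (wt \<alpha> (Phi \<mu> \<nu>) (join_vec z w) * (cmod (mon a (join_vec z w)))\<^sup>2)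
      = (\<Psi> (sqn z) (sqn w) * ennreal (Q w)) * ennreal (P z)" for z w
  proof (cases "join_vec z w \<in> Dom \<mu>")
    case True
    have m1: "(cmod (mon a (join_vec z w)))\<^sup>2 = Q w * P z"
      by (simp add: norm_mon prod_UNIV_sum P_def Q_def p_def q_def power_mult_distrib mult.commute prod_power_distrib flip: power_mult)
    have m2: "wt \<alpha> (Phi \<mu> \<nu>) (join_vec z w) = wt_profile n m \<mu> \<nu> \<alpha> (sqn z) (sqn w)"
      using wt_Phi[OF True \<mu> \<nu>] by (simp add: n_def m_def)
    have m3: "wt_profile n m \<mu> \<nu> \<alpha> (sqn z) (sqn w) \<ge> 0"
      using wt_Phi_pos[OF True \<mu> \<nu>, of \<alpha>] m2 by simp
    have "sqn w < exp (- \<mu> * sqn z)" using True by (simp add: Dom_def)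
    then show ?thesis
      using True unfolding \<Psi>_def m1 m2
      by (simp add: ennreal_mult[OF m3 mult_nonneg_nonneg[OF PQ0(2,1)]] ennreal_mult[OF PQ0(2,1)] mult.assoc)
  qed (simp add: \<Psi>_def Dom_def)
  have inner: "(\<integral>\<^sup>+w. \<Psi> (sqn z) (sqn w) * ennreal (Q w) \<partial>lborel)
      = ennreal (\<Prod>k\<in>UNIV. pi * fact (q k)) * (ennreal (exp (- (\<mu> * \<beta>) * sqn z)) * ennreal c)" for z
  proof -
    have "(\<lambda>x. \<Psi> (sqn z) x) \<in> borel_measurable borel" unfolding \<Psi>_def by measurable
    then have "(\<integral>\<^sup>+w. \<Psi> (sqn z) (sqn w) * ennreal (Q w) \<partial>lborel)
      = ennreal (\<Prod>k\<in>UNIV. pi * fact (q k)) * (\<integral>\<^sup>+x. \<Psi> (sqn z) x * gamma_kernel (s + m - 1) x \<partial>lborel)"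
      unfolding Q_def s_def m_def by (rule nn_integral_radial_vec)
    also have "(\<integral>\<^sup>+x. \<Psi> (sqn z) x * gamma_kernel (s + m - 1) x \<partial>lborel) = ennreal (exp (- (\<mu> * \<beta>) * sqn z) * c)"
      unfolding \<Psi>_def using nn_integral_wt_profile[OF \<alpha>' nm(2) \<nu> \<mu>, of "sqn z" s]
      by (simp add: \<beta>_def c_def mult.assoc)
    also have "\<dots> = ennreal (exp (- (\<mu> * \<beta>) * sqn z)) * ennreal c" using c by (simp add: ennreal_mult)
    finally show ?thesis .
  qed
  have [measurable]: "(\<lambda>p. \<Psi> (sqn (fst p)) (sqn (snd p))) \<in> borel_measurable (borel \<Otimes>\<^sub>M borel)"
    "(\<lambda>w. \<Psi> (sqn z) (sqn w)) \<in> borel_measurable borel" for z :: "complex^'n"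
    unfolding \<Psi>_def by measurable
  let ?Cq = "\<Prod>k\<in>UNIV. pi * fact (q k) :: real" and ?Cp = "\<Prod>j\<in>UNIV. pi * fact (p j) :: real"
  have "(\<integral>\<^sup>+Y. indicator (Dom \<mu>) Y * ennreal (wt \<alpha> (Phi \<mu> \<nu>) Y * (cmod (mon a Y))\<^sup>2) \<partial>lborel)
      = (\<integral>\<^sup>+z. \<integral>\<^sup>+w. (\<Psi> (sqn z) (sqn w) * ennreal (Q w)) * ennreal (P z) \<partial>lborel \<partial>lborel)"
    by (subst nn_integral_join) (simp_all add: eq)
  also have "\<dots> = (\<integral>\<^sup>+z. (ennreal ?Cq * ennreal c) * (ennreal (exp (- (\<mu> * \<beta>) * sqn z)) * ennreal (P z)) \<partial>lborel)"
  proof (rule nn_integral_cong)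
    fix z :: "complex^'n"
    have "(\<integral>\<^sup>+w. (\<Psi> (sqn z) (sqn w) * ennreal (Q w)) * ennreal (P z) \<partial>lborel) = (\<integral>\<^sup>+w. \<Psi> (sqn z) (sqn w) * ennreal (Q w) \<partial>lborel) * ennreal (P z)"
      by (rule nn_integral_multc) measurable
    then show "(\<integral>\<^sup>+w. (\<Psi> (sqn z) (sqn w) * ennreal (Q w)) * ennreal (P z) \<partial>lborel) = (ennreal ?Cq * ennreal c) * (ennreal (exp (- (\<mu> * \<beta>) * sqn z)) * ennreal (P z))"
      unfolding inner by (simp only: mult_ac)
  qed
  also have "\<dots> = (ennreal ?Cq * ennreal c) * (\<integral>\<^sup>+z. ennreal (exp (- (\<mu> * \<beta>) * sqn z)) * ennreal (P z) \<partial>lborel)"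
    by (rule nn_integral_cmult) measurable
  also have "(\<integral>\<^sup>+z. ennreal (exp (- (\<mu> * \<beta>) * sqn z)) * ennreal (P z) \<partial>lborel)
      = ennreal ?Cp * (\<integral>\<^sup>+t. ennreal (exp (- (\<mu> * \<beta>) * t)) * gamma_kernel (sum p UNIV + n - 1) t \<partial>lborel)"
    unfolding P_def n_def by (rule nn_integral_radial_vec) measurable
  also have "(\<integral>\<^sup>+t. ennreal (exp (- (\<mu> * \<beta>) * t)) * gamma_kernel (sum p UNIV + n - 1) t \<partial>lborel)
      = ennreal (1 / (\<mu> * \<beta>) ^ Suc (sum p UNIV + n - 1))"
    by (rule nn_integral_exp_gamma_kernel) (use \<mu> \<beta> in simp)
  also have "Suc (sum p UNIV + n - 1) = n + sum p UNIV" using nm by simp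
  also have "(ennreal ?Cq * ennreal c) * (ennreal ?Cp * ennreal (1 / (\<mu> * \<beta>) ^ (n + sum p UNIV)))
      = ennreal ((?Cq * c) * (?Cp * (1 / (\<mu> * \<beta>) ^ (n + sum p UNIV))))"
  proof -
    have "?Cq \<ge> 0" "?Cp \<ge> 0" "1 / (\<mu> * \<beta>) ^ (n + sum p UNIV) \<ge> 0"
      using \<mu> \<beta> by (auto intro!: prod_nonneg)
    with c show ?thesis by (simp only: ennreal_mult[symmetric] mult_nonneg_nonneg)
  qed
  also have "(?Cq * c) * (?Cp * (1 / (\<mu> * \<beta>) ^ (n + sum p UNIV))) = monomial_norm \<mu> \<nu> \<alpha> a"
  proof -
    have "?Cq = pi ^ m * (\<Prod>k\<in>UNIV. fact (q k))" "?Cp = pi ^ n * (\<Prod>j\<in>UNIV. fact (p j))"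
      by (simp_all add: prod.distrib n_def m_def)
    then have "(?Cq * c) * (?Cp * (1 / (\<mu> * \<beta>) ^ (n + sum p UNIV)))
        = (\<Prod>j\<in>UNIV. fact (p j)) * (\<Prod>k\<in>UNIV. fact (q k)) * chi_denom n m \<nu> \<alpha> s / (\<beta> ^ (n + sum p UNIV) * \<mu> ^ sum p UNIV)"
      using \<mu> \<beta> by (simp add: c_def power_add power_mult_distrib field_simps)
    then show ?thesis by (simp add: monomial_norm_def n_def m_def p_def q_def s_def \<beta>_def)
  qed
  finally show ?thesis .
qed

section \<open>The kernel of the given domain\<close>

lemma sqn_mono: "(\<And>i. cmod (v $ i) \<le> cmod (w $ i)) \<Longrightarrow> sqn v \<le> sqn w"
  unfolding sqn_def by (intro sum_mono power_mono) auto

lemma reinhardt_Dom: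
  assumes "\<mu> > 0"
  shows "reinhardt (Dom \<mu> :: (complex^('n::finite + 'm::finite)) set)"
  unfolding reinhardt_def
proof (intro ballI allI impI)
  fix X Y :: "complex^('n + 'm)"
  assume Y: "Y \<in> Dom \<mu>" and le: "\<forall>i. cmod (X $ i) \<le> cmod (Y $ i)"
  have "sqn (zpart X) \<le> sqn (zpart Y)" "sqn (wpart X) \<le> sqn (wpart Y)"
    using le by (auto intro!: sqn_mono simp: zpart_def wpart_def)
  then have "sqn (wpart X) \<le> sqn (wpart Y)" "exp (- \<mu> * sqn (zpart Y)) \<le> exp (- \<mu> * sqn (zpart X))"
    using assms by auto
  then show "X \<in> Dom \<mu>" using Y unfolding Dom_def mem_Collect_eq by linarith
qed

lemma reinhardt_weight_Dom:
  assumes \<mu>: "\<mu> > 0" and \<nu>: "\<nu> > -1" and \<alpha>: "\<alpha> > real (CARD('n::finite) + CARD('m::finite))"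
  shows "reinhardt_weight (Dom \<mu> :: (complex^('n + 'm)) set) \<alpha> (Phi \<mu> \<nu>) (monomial_norm \<mu> \<nu> \<alpha>)"
proof
  show "open (Dom \<mu> :: (complex^('n + 'm)) set)" by (rule open_Dom)
  show "reinhardt (Dom \<mu> :: (complex^('n + 'm)) set)" by (rule reinhardt_Dom[OF \<mu>])
  have "(0 :: complex^('n + 'm)) \<in> Dom \<mu>" by (simp add: Dom_def sqn_def zpart_def wpart_def)
  then show "(Dom \<mu> :: (complex^('n + 'm)) set) \<noteq> {}" by blast
  show "(\<lambda>Y::complex^('n + 'm). indicator (Dom \<mu>) Y * wt \<alpha> (Phi \<mu> \<nu>) Y) \<in> borel_measurable borel"
    unfolding indicator_wt_Phi[OF \<mu> \<nu>] by measurable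
  show "0 < wt \<alpha> (Phi \<mu> \<nu>) Y" if "Y \<in> Dom \<mu>" for Y :: "complex^('n + 'm)"
    by (rule wt_Phi_pos[OF that \<mu> \<nu>])
  show "wt \<alpha> (Phi \<mu> \<nu>) X = wt \<alpha> (Phi \<mu> \<nu>) Y"
    if "X \<in> Dom \<mu>" "Y \<in> Dom \<mu>" "\<And>i. cmod (X $ i) = cmod (Y $ i)" for X Y :: "complex^('n + 'm)"
    unfolding wt_Phi[OF that(1) \<mu> \<nu>] wt_Phi[OF that(2) \<mu> \<nu>]
    by (simp add: sqn_def zpart_def wpart_def that(3))
  show "(\<integral>\<^sup>+Y. indicator (Dom \<mu>) Y * ennreal (wt \<alpha> (Phi \<mu> \<nu>) Y * (cmod (mon a Y))\<^sup>2) \<partial>lborel)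
    = ennreal (monomial_norm \<mu> \<nu> \<alpha> a)" for a :: "'n + 'm \<Rightarrow> nat"
    by (rule nn_integral_monomial[OF \<mu> \<nu> \<alpha>])
qed

text \<open>The w-exponents come first in the pair, so that iterated summation keeps them as the
  outer index and sums out the z-exponents.\<close>

lemma bij_case_sum: "bij_betw (\<lambda>(q, p). case_sum p q) (UNIV :: (('m \<Rightarrow> 'c) \<times> ('n \<Rightarrow> 'c)) set) UNIV"
proof (rule bij_betwI[where g = "\<lambda>a. (a \<circ> Inr, a \<circ> Inl)"])
qed (auto simp: fun_eq_iff split: sum.splits)

text \<open>For fixed q the reciprocal norm depends on p through (\<beta>\<mu>)^|p| / p!, giving a
  product of exponential series. The leftover \<beta>^n over the Beta-type denominator is
  \<open>chi\<close>.\<close>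

lemma kernel_sum_over_z:
  fixes Z :: "complex^('n::finite + 'm::finite)" and q :: "'m \<Rightarrow> nat"
  assumes \<mu>: "\<mu> > 0" and \<nu>: "\<nu> > -1" and \<alpha>: "\<alpha> > real (CARD('n) + CARD('m))"
  defines "\<beta> \<equiv> (\<nu> + 1) * \<alpha> + real (sum q UNIV)"
  shows "((\<lambda>p. (cmod (mon (case_sum p q) Z))\<^sup>2 / monomial_norm \<mu> \<nu> \<alpha> (case_sum p q)) has_sum
    (exp (\<beta> * \<mu> * sqn (zpart Z)) * chi CARD('n) CARD('m) \<nu> \<alpha> (sum q UNIV) / (\<Prod>k\<in>UNIV. fact (q k)) * (cmod (\<Prod>k\<in>UNIV. wpart Z $ k ^ q k))\<^sup>2)) UNIV"
proof -
  have "\<alpha> > 0" using \<alpha> by (meson le_less_trans of_nat_0_le_iff)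
  then have \<beta>: "\<beta> > 0" 
    using \<nu> unfolding \<beta>_def by (intro add_pos_nonneg[OF mult_pos_pos]) (auto intro: sum_nonneg)
  define x where "x = (\<lambda>j. \<beta> * \<mu> * (cmod (zpart Z $ j))\<^sup>2)"
  have x0: "x j \<ge> 0" for j using \<beta> \<mu> by (simp add: x_def)
  have "((\<lambda>p. \<Prod>j\<in>UNIV. x j ^ p j / fact (p j)) has_sum (\<Prod>j\<in>UNIV. exp (x j))) (PiE UNIV (\<lambda>_. UNIV))"
  proof (rule prod_has_sum_PiE)
    show "(\<lambda>n. x j ^ n / fact n) sums exp (x j)" for j
      using exp_converges[of "x j"] by (simp add: divide_inverse mult.commute)
  qed (use x0 in auto)
  moreover have "(\<Prod>j\<in>UNIV. exp (x j)) = exp (\<beta> * \<mu> * sqn (zpart Z))"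
    by (simp add: exp_sum x_def sqn_def sum_distrib_left)
  ultimately have "((\<lambda>p. \<Prod>j\<in>UNIV. x j ^ p j / fact (p j)) has_sum exp (\<beta> * \<mu> * sqn (zpart Z))) UNIV" by simp
  from has_sum_cmult_left[OF this, of "chi CARD('n) CARD('m) \<nu> \<alpha> (sum q UNIV) / (\<Prod>k\<in>UNIV. fact (q k)) * (cmod (\<Prod>k\<in>UNIV. wpart Z $ k ^ q k))\<^sup>2"]
  have "((\<lambda>p. (\<Prod>j\<in>UNIV. x j ^ p j / fact (p j)) * (chi CARD('n) CARD('m) \<nu> \<alpha> (sum q UNIV) / (\<Prod>k\<in>UNIV. fact (q k)) * (cmod (\<Prod>k\<in>UNIV. wpart Z $ k ^ q k))\<^sup>2))
    has_sum exp (\<beta> * \<mu> * sqn (zpart Z)) * (chi CARD('n) CARD('m) \<nu> \<alpha> (sum q UNIV) / (\<Prod>k\<in>UNIV. fact (q k)) * (cmod (\<Prod>k\<in>UNIV. wpart Z $ k ^ q k))\<^sup>2)) UNIV" .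
  moreover have "(cmod (mon (case_sum p q) Z))\<^sup>2 / monomial_norm \<mu> \<nu> \<alpha> (case_sum p q)
     = (\<Prod>j\<in>UNIV. x j ^ p j / fact (p j)) * (chi CARD('n) CARD('m) \<nu> \<alpha> (sum q UNIV) / (\<Prod>k\<in>UNIV. fact (q k)) * (cmod (\<Prod>k\<in>UNIV. wpart Z $ k ^ q k))\<^sup>2)" for p
  proof -
    have "(cmod (mon (case_sum p q) Z))\<^sup>2 = (\<Prod>j\<in>UNIV. ((cmod (zpart Z $ j))\<^sup>2) ^ p j) * (cmod (\<Prod>k\<in>UNIV. wpart Z $ k ^ q k))\<^sup>2"
      by (simp add: mon_def prod_UNIV_sum norm_mult power_mult_distrib zpart_def wpart_def norm_power prod_power_distrib mult.commute flip: prod_norm power_mult)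
    moreover have "(\<Prod>j\<in>UNIV. x j ^ p j / fact (p j)) = (\<beta> * \<mu>) ^ sum p UNIV * (\<Prod>j\<in>UNIV. ((cmod (zpart Z $ j))\<^sup>2) ^ p j) / (\<Prod>j\<in>UNIV. fact (p j))"
      by (simp add: x_def power_mult_distrib prod.distrib prod_dividef power_sum)
    moreover have "chi CARD('n) CARD('m) \<nu> \<alpha> (sum q UNIV) = \<beta> ^ CARD('n) / chi_denom CARD('n) CARD('m) \<nu> \<alpha> (sum q UNIV)"
      by (simp add: chi_def chi_denom_def \<beta>_def)
    moreover have "monomial_norm \<mu> \<nu> \<alpha> (case_sum p q) = (\<Prod>j\<in>UNIV. fact (p j)) * (\<Prod>k\<in>UNIV. fact (q k)) *
        chi_denom CARD('n) CARD('m) \<nu> \<alpha> (sum q UNIV) / (\<beta> ^ (CARD('n) + sum p UNIV) * \<mu> ^ sum p UNIV)"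
      by (simp only: monomial_norm_def \<beta>_def sum.case)
    ultimately show ?thesis
      using \<beta> \<mu> by (simp add: power_add power_mult_distrib mult_ac)
  qed
  ultimately show ?thesis by (simp only: times_divide_eq_right mult.assoc times_divide_eq_left)
qed

text \<open>The second conjunct ensures that the unordered sum is genuine, since
  \<open>infsum\<close> takes the value 0 on families that are not summable.\<close>

theorem theorem2p7:
  fixes \<mu> \<nu> \<alpha> :: real
    and Z :: "complex^('n::finite + 'm::finite)"
  assumes "\<mu> > 0" and "\<nu> > -1"
    and "\<alpha> > real (CARD('n) + CARD('m))"
    and "Z \<in> Dom \<mu>"
  shows "rawnsley (Dom \<mu>) \<alpha> (Phi \<mu> \<nu>) Z =
    complex_of_real
      (let n = CARD('n); m = CARD('m);
           wt = (\<chi> j. complex_of_real (exp (\<mu> / 2 * sqn (zpart Z))) * wpart Z $ j)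
       in poch (\<alpha> - real (m + n)) (m + n) * (1 - sqn wt) powr \<alpha> *
          (\<Sum>\<^sub>\<infinity>q\<in>(UNIV :: ('m \<Rightarrow> nat) set).
             psi n m \<nu> \<alpha> (\<Sum>i\<in>UNIV. q i) *
             Gamma (real (\<Sum>i\<in>UNIV. q i) + \<alpha>) / (Gamma \<alpha> * (\<Prod>i\<in>UNIV. Gamma (real (q i) + 1))) *
             (cmod (\<Prod>j\<in>UNIV. (wt $ j) ^ q j))^2))
    \<and> (let n = CARD('n); m = CARD('m);
           wt = (\<chi> j. complex_of_real (exp (\<mu> / 2 * sqn (zpart Z))) * wpart Z $ j)
       in (\<lambda>q::'m \<Rightarrow> nat. psi n m \<nu> \<alpha> (\<Sum>i\<in>UNIV. q i) *
             Gamma (real (\<Sum>i\<in>UNIV. q i) + \<alpha>) / (Gamma \<alpha> * (\<Prod>i\<in>UNIV. Gamma (real (q i) + 1))) *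
             (cmod (\<Prod>j\<in>UNIV. (wt $ j) ^ q j))^2) summable_on UNIV)"
proof -
  interpret reinhardt_weight "Dom \<mu> :: (complex^('n + 'm)) set" \<alpha> "Phi \<mu> \<nu>" "monomial_norm \<mu> \<nu> \<alpha>"
    by (rule reinhardt_weight_Dom) (use assms in auto)
  define n m where "n = CARD('n)" and "m = CARD('m)"
  define r where "r = sqn (zpart Z)"
  define W :: "complex^'m" where "W = (\<chi> j. complex_of_real (exp (\<mu> / 2 * sqn (zpart Z))) * wpart Z $ j)"
  define S where "S = (\<Sum>\<^sub>\<infinity>a. (cmod (mon a Z))\<^sup>2 / monomial_norm \<mu> \<nu> \<alpha> a)"
  define h where "h = (\<lambda>q::'m \<Rightarrow> nat. exp (((\<nu> + 1) * \<alpha> + real (sum q UNIV)) * \<mu> * r) * chi n m \<nu> \<alpha> (sum q UNIV) / (\<Prod>k\<in>UNIV. fact (q k)) * (cmod (\<Prod>k\<in>UNIV. wpart Z $ k ^ q k))\<^sup>2)"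
  define t where "t = (\<lambda>q::'m \<Rightarrow> nat. psi n m \<nu> \<alpha> (\<Sum>i\<in>UNIV. q i) *
             Gamma (real (\<Sum>i\<in>UNIV. q i) + \<alpha>) / (Gamma \<alpha> * (\<Prod>i\<in>UNIV. Gamma (real (q i) + 1))) *
             (cmod (\<Prod>j\<in>UNIV. (W $ j) ^ q j))^2)"
  \<comment> \<open>The q-independent ratio between the terms of the claimed series and those of the
    kernel series already summed over z.\<close>
  define \<kappa> where "\<kappa> = Gamma (\<alpha> - real m - real n) / Gamma \<alpha> * exp (- ((\<nu> + 1) * \<alpha> * \<mu> * r))"
  have \<alpha>: "\<alpha> > real (n + m)" using assms(3) by (simp add: n_def m_def)
  then have "\<alpha> > 0" by (meson le_less_trans of_nat_0_le_iff)
  have G1: "Gamma \<alpha> > 0" using \<open>\<alpha> > 0\<close> by (rule Gamma_real_pos)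
  have G2: "Gamma (\<alpha> - real m - real n) > 0" using \<alpha> by (intro Gamma_real_pos) simp
  have G3: "Gamma (\<alpha> + real k) > 0" for k using \<open>\<alpha> > 0\<close> by (intro Gamma_real_pos) (simp add: add_pos_nonneg)
  have "((\<lambda>a. (cmod (mon a Z))\<^sup>2 / monomial_norm \<mu> \<nu> \<alpha> a) has_sum S) UNIV"
    unfolding S_def by (rule has_sum_infsum[OF kernel_summable[OF assms(4)]])
  then have "((\<lambda>(q, p). (cmod (mon (case_sum p q) Z))\<^sup>2 / monomial_norm \<mu> \<nu> \<alpha> (case_sum p q)) has_sum S) (UNIV \<times> UNIV)"
    by (subst (asm) has_sum_reindex_bij_betw[OF bij_case_sum, symmetric]) (simp add: case_prod_unfold)
  then have hS: "(h has_sum S) UNIV"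
    by (rule has_sum_SigmaD) (use kernel_sum_over_z[OF assms(1-3)] in \<open>simp add: h_def n_def m_def r_def\<close>)
  have th: "t q = \<kappa> * h q" for q
  proof -
    let ?s = "sum q UNIV"
    have 1: "(cmod (\<Prod>j\<in>UNIV. (W $ j) ^ q j))\<^sup>2 = exp (real ?s * \<mu> * r) * (cmod (\<Prod>k\<in>UNIV. wpart Z $ k ^ q k))\<^sup>2"
    proof -
      have "(\<Prod>j\<in>UNIV. (W $ j) ^ q j) = complex_of_real (exp (\<mu> / 2 * r)) ^ ?s * (\<Prod>k\<in>UNIV. wpart Z $ k ^ q k)"
        by (simp add: W_def r_def power_mult_distrib prod.distrib power_sum)
      moreover have "(exp (\<mu> / 2 * r) ^ ?s)\<^sup>2 = exp (real ?s * \<mu> * r)"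
        by (simp add: mult_ac flip: exp_of_nat_mult)
      ultimately show ?thesis by (simp add: norm_mult norm_power power_mult_distrib)
    qed
    have 2: "(\<Prod>i\<in>UNIV. Gamma (real (q i) + 1)) = (\<Prod>i\<in>UNIV. fact (q i))"
      by (intro prod.cong refl) (metis Gamma_fact add.commute)
    have 3: "exp (((\<nu> + 1) * \<alpha> + real ?s) * \<mu> * r) = exp ((\<nu> + 1) * \<alpha> * \<mu> * r) * exp (real ?s * \<mu> * r)"
      by (simp add: algebra_simps flip: exp_add)
    have 4: "exp (- ((\<nu> + 1) * \<alpha> * \<mu> * r)) * exp ((\<nu> + 1) * \<alpha> * \<mu> * r) = 1"
      by (simp flip: exp_add)
    have 5: "Gamma (real ?s + \<alpha>) / Gamma (\<alpha> + real ?s) = 1" using G3[of ?s] by (simp add: add.commute)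
    let ?R = "Gamma (\<alpha> - real m - real n) * chi n m \<nu> \<alpha> ?s / (Gamma \<alpha> * (\<Prod>i\<in>UNIV. fact (q i))) * (exp (real ?s * \<mu> * r) * (cmod (\<Prod>k\<in>UNIV. wpart Z $ k ^ q k))\<^sup>2)"
    have "t q = (Gamma (real ?s + \<alpha>) / Gamma (\<alpha> + real ?s)) * ?R"
      unfolding t_def psi_def 1 2 by (simp add: mult_ac)
    moreover have "\<kappa> * h q = (exp (- ((\<nu> + 1) * \<alpha> * \<mu> * r)) * exp ((\<nu> + 1) * \<alpha> * \<mu> * r)) * ?R"
      unfolding \<kappa>_def h_def 3 by (simp add: mult_ac)
    ultimately show ?thesis unfolding 4 5 by (simp only:)
  qed
  have ts: "(t has_sum \<kappa> * S) UNIV"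
    unfolding th by (rule has_sum_cmult_right[OF hS])
  have \<epsilon>: "rawnsley (Dom \<mu>) \<alpha> (Phi \<mu> \<nu>) Z = complex_of_real (exp (- \<alpha> * Phi \<mu> \<nu> Z) * S)"
    unfolding rawnsley_def Kdiag_eq_infsum[OF assms(4)] S_def by simp
  have T: "exp (- \<alpha> * Phi \<mu> \<nu> Z) = exp (- ((\<nu> + 1) * \<alpha> * \<mu> * r)) * (1 - sqn W) powr \<alpha>"
  proof -
    have sW: "sqn W = exp (\<mu> * r) * sqn (wpart Z)"
      by (simp add: W_def sqn_def r_def norm_mult power_mult_distrib sum_distrib_left flip: exp_of_nat_mult)
    have u: "exp (- \<mu> * r) - sqn (wpart Z) = exp (- \<mu> * r) * (1 - sqn W)"
      by (simp add: sW algebra_simps flip: exp_add)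
    have "exp (- \<mu> * r) - sqn (wpart Z) > 0" using assms(4) by (simp add: Dom_def r_def)
    then have pos: "1 - sqn W > 0" unfolding u by (simp add: zero_less_mult_iff)
    have "Phi \<mu> \<nu> Z = (\<nu> + 1) * \<mu> * r - ln (1 - sqn W)"
      unfolding Phi_def r_def[symmetric] u using pos by (subst ln_mult) (auto simp: algebra_simps)
    then have "- \<alpha> * Phi \<mu> \<nu> Z = - ((\<nu> + 1) * \<alpha> * \<mu> * r) + \<alpha> * ln (1 - sqn W)"
      by (simp only:) (simp add: algebra_simps)
    from arg_cong[OF this, of exp] show ?thesis unfolding exp_add using pos by (simp add: powr_def)
  qed
  \<comment> \<open>The Pochhammer factor equals Gamma \<alpha> / Gamma (\<alpha> - m - n), so it
    cancels the Gamma quotient in \<kappa> and leaves the exponential contained in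
    e^(-\<alpha>\<Phi>).\<close>
  have "poch (\<alpha> - real (m + n)) (m + n) * \<kappa> = exp (- ((\<nu> + 1) * \<alpha> * \<mu> * r))"
    using G1 G2 by (simp add: poch_def \<kappa>_def diff_diff_eq)
  then have "exp (- \<alpha> * Phi \<mu> \<nu> Z) * S = poch (\<alpha> - real (m + n)) (m + n) * (1 - sqn W) powr \<alpha> * infsum t UNIV"
    unfolding T infsumI[OF ts] by (metis mult.assoc mult.commute)
  then show ?thesis
    using \<epsilon> has_sum_imp_summable[OF ts]
    unfolding Let_def n_def[symmetric] m_def[symmetric] W_def[symmetric] t_def[symmetric] by (simp only: simp_thms)
qed

end
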